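(* There exists a sequence of initial data $(u_{n,0},0)$ with $u_{n,0}\in\dot H^1(\mathbb R^6)$ and $$\sup_{R>0}\|r^{-1}u_{n,0}\|_{L^2(\{R\le r\le2R\})}\to\infty\quad\text{as }n\to\infty,$$ such that the corresponding solutions $u_{F,n}$ of the free wave equation $\partial_t^2u_{F,n}-\Delta u_{F,n}=0$ on $\mathbb R\times\mathbb R^6$, $(u_{F,n},\partial_tu_{F,n})_{|t=0}=(u_{n,0},0)$, satisfy $$\lim_{t\to\infty}\int_{|x|\ge t}|\nabla_{t,x}u_{F,n}(t,x)|^2dx\le1\qquad\text{for all }n.$$
   Context: $r=|x|$, $\nabla_{t,x}f=(\partial_tf,\nabla f)$, and $L^2(\{R\le r\le2R\})$ is taken with respect to Lebesgue measure on $\mathbb R^6$. *)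

theory Defs
  imports "HOL-Analysis.Analysis"
begin

type_synonym R6 = "real ^ 6"

section \<open>Test functions\<close>

abbreviation dir_deriv :: "'a::euclidean_space \<Rightarrow> ('a \<Rightarrow> real) \<Rightarrow> 'a \<Rightarrow> real" where
  "dir_deriv v f \<equiv> (\<lambda>x. frechet_derivative f (at x) v)"

primrec Ck :: "nat \<Rightarrow> ('a::euclidean_space \<Rightarrow> real) \<Rightarrow> bool" where
  "Ck 0 f \<longleftrightarrow> continuous_on UNIV f"
| "Ck (Suc k) f \<longleftrightarrow> (\<forall>x. f differentiable at x) \<and> (\<forall>v. Ck k (dir_deriv v f))"

definition test_function :: "('a::euclidean_space \<Rightarrow> real) \<Rightarrow> bool" where
  "test_function \<phi> \<longleftrightarrow> (\<forall>k. Ck k \<phi>) \<and> compact (closure {x. \<phi> x \<noteq> 0})"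

section \<open>Lebesgue and Sobolev spaces\<close>

definition locally_integrable :: "('a::euclidean_space \<Rightarrow> 'b::euclidean_space) \<Rightarrow> bool" where
  "locally_integrable f \<longleftrightarrow> (\<forall>K. compact K \<longrightarrow> f absolutely_integrable_on K)"

definition square_integrable :: "('a::euclidean_space \<Rightarrow> 'b::euclidean_space) \<Rightarrow> bool" where
  "square_integrable f \<longleftrightarrow>
     f \<in> borel_measurable lebesgue \<and> integrable lebesgue (\<lambda>x. (norm (f x))\<^sup>2)"

definition L2_norm_on :: "'a::euclidean_space set \<Rightarrow> ('a \<Rightarrow> 'b::euclidean_space) \<Rightarrow> real" where
  "L2_norm_on S f = sqrt (LINT x:S|lebesgue. (norm (f x))\<^sup>2)"

text \<open>The Bochner integral of a non-integrable function is 0, so square integrability of the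
  difference has to be demanded separately.\<close>

definition tendsto_L2 ::
  "('i \<Rightarrow> 'a::euclidean_space \<Rightarrow> 'b::euclidean_space) \<Rightarrow> ('a \<Rightarrow> 'b) \<Rightarrow> 'i filter \<Rightarrow> bool" where
  "tendsto_L2 F f A \<longleftrightarrow>
     (\<forall>\<^sub>F s in A. square_integrable (\<lambda>x. F s x - f x)) \<and>
     ((\<lambda>s. L2_norm_on UNIV (\<lambda>x. F s x - f x)) \<longlongrightarrow> 0) A"

definition weak_gradient :: "('a::euclidean_space \<Rightarrow> real) \<Rightarrow> ('a \<Rightarrow> 'a) \<Rightarrow> bool" where
  "weak_gradient u G \<longleftrightarrow>
     locally_integrable u \<and> locally_integrable G \<and>
     (\<forall>\<phi>. test_function \<phi> \<longrightarrow> (\<forall>e\<in>Basis.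
        (LINT x|lebesgue. u x * dir_deriv e \<phi> x) = - (LINT x|lebesgue. (G x \<bullet> e) * \<phi> x)))"

text \<open>The homogeneous Sobolev space of order 1 on \<open>\<real>\<^sup>6\<close>, realised as a space of functions: those
  with weak gradient in \<open>L\<^sup>2\<close> that lie in \<open>L\<^sup>p\<close> for the critical Sobolev exponent
  \<open>p = 2N/(N-2) = 3\<close>. The \<open>L\<^sup>3\<close> condition excludes nonzero constants, so that the \<open>L\<^sup>2\<close> norm
  of the gradient is a norm (up to equality almost everywhere).\<close>

definition Hdot1 :: "(R6 \<Rightarrow> real) set" where
  "Hdot1 = {u. u \<in> borel_measurable lebesgue \<and> integrable lebesgue (\<lambda>x. \<bar>u x\<bar> ^ 3) \<and>
               (\<exists>G. weak_gradient u G \<and> square_integrable G)}"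

section \<open>Finite-energy solutions of the free wave equation\<close>

definition wave_op :: "(real \<times> R6 \<Rightarrow> real) \<Rightarrow> real \<times> R6 \<Rightarrow> real" where
  "wave_op \<phi> z = dir_deriv (1, 0) (dir_deriv (1, 0) \<phi>) z
                - (\<Sum>e\<in>Basis. dir_deriv (0, e) (dir_deriv (0, e) \<phi>) z)"

text \<open>\<open>u\<close> is the solution with initial data \<open>(u0, u1)\<close>, and \<open>ut\<close>, \<open>Du\<close> are its time derivative
  and its spatial gradient (determined almost everywhere at each time): \<open>(u, ut)\<close> is a continuous
  curve in the energy space, the time derivative being a limit of difference quotients
  in \<open>L\<^sup>2\<close>, and the equation holds in the sense of distributions on \<open>\<real> \<times> \<real>\<^sup>6\<close> (the wave
  operator is formally self-adjoint).\<close>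

definition free_wave_solution ::
  "(R6 \<Rightarrow> real) \<Rightarrow> (R6 \<Rightarrow> real) \<Rightarrow>
   (real \<Rightarrow> R6 \<Rightarrow> real) \<Rightarrow> (real \<Rightarrow> R6 \<Rightarrow> real) \<Rightarrow> (real \<Rightarrow> R6 \<Rightarrow> R6) \<Rightarrow> bool" where
  "free_wave_solution u0 u1 u ut Du \<longleftrightarrow>
     (\<forall>t. u t \<in> Hdot1 \<and> weak_gradient (u t) (Du t) \<and> square_integrable (Du t)
          \<and> square_integrable (ut t)) \<and>
     (\<forall>t. tendsto_L2 Du (Du t) (at t)) \<and>
     (\<forall>t. tendsto_L2 ut (ut t) (at t)) \<and>
     (\<forall>t. tendsto_L2 (\<lambda>h x. (u (t + h) x - u t x) / h) (ut t) (at 0)) \<and>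
     locally_integrable (\<lambda>(t, x). u t x) \<and>
     (\<forall>\<phi>. test_function \<phi> \<longrightarrow> (LINT (t, x)|lebesgue. u t x * wave_op \<phi> (t, x)) = 0) \<and>
     (AE x in lebesgue. u 0 x = u0 x) \<and>
     (AE x in lebesgue. ut 0 x = u1 x)"

end

theory Submission
  imports Defs
begin

text \<open>
  In dimension 6 the function \<open>(z + \<zeta>) powi (- 2)\<close> with \<open>\<zeta> = sqrt (\<bar>x\<bar>\<^sup>2 + z\<^sup>2)\<close> is harmonic in
  \<open>(z, x)\<close>, so the real part of its value at \<open>z = a + \<i> t\<close> is a radial solution of the wave equation with zero
  initial velocity, whose initial datum behaves like \<open>r powi (- 2)\<close> for \<open>r\<close> much larger than \<open>a\<close>. Up to the
  exact solution \<open>1 / r\<^sup>2 - 2 t\<^sup>2 / r\<^sup>4\<close>, which does not depend on \<open>a\<close>, its radiation profile outside the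
  light cone is bounded by \<open>q\<^sub>a(\<eta>) = a (\<eta> + a) powr (- 3/2)\<close>. These profiles all have the same \<open>L\<^sup>2\<close>
  norm and are almost orthogonal for different scales. Hence
  \<open>N powr (- 1/2)\<close> times the sum of \<open>N\<close> solutions at the scales \<open>4 powi (- j)\<close> minus the sum of \<open>N\<close> solutions at
  the scales \<open>4\<^sup>j\<close>, \<open>1 \<le> j \<le> N\<close>, has bounded exterior energy, although its datum at \<open>r = 1\<close> is of size \<open>sqrt N\<close>.
\<close>

text \<open>The obstacle is the common part 1/r^2 - 2t^2/r^4. Its r^(-2) tail is borderline: on R^6
  it is not in L^3, and its gradient is not square integrable at infinity, so no single solution of
  the family is admissible. Coefficients with sum zero remove this part exactly and gain one power
  of decay, which suffices. The negative half serves this cancellation: for a much larger than r the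
  datum is about 1/(4 a^2), so near r = 1 it takes away little of what the positive half
  contributes.

  The exponent in q_a comes from |\<zeta>|^2, which for r = t + \<eta> and a \<le> t is comparable
  to (\<eta> + a) r: the derivatives of the remainder are O(a / (|\<zeta>|^3 r)), and r^5, the
  weight of polar coordinates, times their squares is O(q_a(\<eta>)^2). Since the integral of q_a
  q_b is at most 2 sqrt(a/b), for scales in geometric progression the sum over all pairs grows like
  N and not N^2, while at r = 1 the N positive terms all have the same sign.

  All functions are smooth in |x|^2, also at the origin, so the weak notions reduce to classical
  calculus and decay at infinity.\<close>

section \<open>Integration by parts and radial integrals\<close>

text \<open>Polar coordinates without a surface measure: both sides give a half-line
  \<open>{..r}\<close> the volume of the ball of radius r, and half-lines form an
  intersection-stable generator of the Borel sets.\<close>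

lemma distr_norm_lborel:
  "distr lborel borel (norm :: 'a::euclidean_space \<Rightarrow> real) =
     density lborel (\<lambda>r. ennreal (unit_ball_vol DIM('a) * DIM('a) * r ^ (DIM('a) - 1)) * indicator {0..} r)"
    (is "?M = density lborel ?g")
proof (rule measure_eqI_generator_eq)
  let ?d = "DIM('a)"
  let ?f = "\<lambda>r. unit_ball_vol ?d * ?d * r ^ (?d - 1)"
  have M: "emeasure ?M {..r} = (if 0 \<le> r then ennreal (unit_ball_vol ?d * r ^ ?d) else 0)" for r
  proof -
    have "norm -` {..r} = cball (0::'a) r" by auto
    then show ?thesis
      by (simp add: emeasure_distr emeasure_cball)
  qed
  have N: "emeasure (density lborel ?g) {..r} = (if 0 \<le> r then ennreal (unit_ball_vol ?d * r ^ ?d) else 0)" for r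
  proof -
    have "emeasure (density lborel ?g) {..r} = (\<integral>\<^sup>+x. ennreal (?f x) * indicator {0..r} x \<partial>lborel)"
      by (subst emeasure_density) (auto intro!: nn_integral_cong simp: indicator_def)
    also have "\<dots> = (if 0 \<le> r then ennreal (unit_ball_vol ?d * r ^ ?d) else 0)"
    proof (cases "0 \<le> r")
      case True
      have "(\<integral>\<^sup>+x. ennreal (?f x) * indicator {0..r} x \<partial>lborel)
          = unit_ball_vol ?d * r ^ ?d - unit_ball_vol ?d * 0 ^ ?d"
        by (rule nn_integral_FTC_Icc)
           (use True in \<open>auto intro!: derivative_eq_intros simp: mult_ac\<close>)
      with True show ?thesis by simp
    qed auto
    finally show ?thesis .
  qed
  show "Int_stable (range (\<lambda>a::real. {..a}))"
    by (auto simp: Int_stable_def)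
  show "emeasure ?M X = emeasure (density lborel ?g) X" if "X \<in> range (\<lambda>a. {..a})" for X
    using that M N by auto
  show "sets ?M = sigma_sets UNIV (range (\<lambda>a::real. {..a}))"
    "sets (density lborel ?g) = sigma_sets UNIV (range (\<lambda>a::real. {..a}))"
    by (simp_all add: borel_eq_atMost)
  show "range (\<lambda>n::nat. {..real n}) \<subseteq> range (\<lambda>a. {..a})" by auto
  show "(\<Union>n::nat. {..real n}) = UNIV"
    by (auto simp: real_arch_simple)
  show "emeasure ?M {..real n} \<noteq> \<infinity>" for n
    by (simp add: M)
qed auto

lemma
  fixes g :: "real \<Rightarrow> real"
  assumes [measurable]: "g \<in> borel_measurable borel"
  shows integrable_radial_iff:
      "integrable lborel (\<lambda>x::'a::euclidean_space. g (norm x)) \<longleftrightarrow>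
       integrable lborel (\<lambda>r. unit_ball_vol DIM('a) * DIM('a) * (indicator {0..} r * r ^ (DIM('a) - 1) * g r))"
        (is ?th1)
    and integral_radial:
      "(LINT x|lborel. g (norm (x::'a))) =
         (LINT r|lborel. unit_ball_vol DIM('a) * DIM('a) * (indicator {0..} r * r ^ (DIM('a) - 1) * g r))"
        (is ?th2)
proof -
  let ?d = "DIM('a)"
  let ?f = "\<lambda>r. unit_ball_vol ?d * ?d * (indicator {0..} r * r ^ (?d - 1))"
  have d: "distr lborel borel (norm :: 'a \<Rightarrow> real) = density lborel (\<lambda>r. ennreal (?f r))"
    unfolding distr_norm_lborel by (rule density_cong) (auto simp: indicator_def)
  have pos: "AE r in lborel. 0 \<le> ?f r"
    by (auto simp: indicator_def)
  have "integrable lborel (\<lambda>x::'a. g (norm x)) \<longleftrightarrow> integrable (distr lborel borel (norm :: 'a \<Rightarrow> real)) g"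
    by (subst integrable_distr_eq) auto
  also have "\<dots> \<longleftrightarrow> integrable lborel (\<lambda>r. ?f r *\<^sub>R g r)"
    unfolding d by (rule integrable_density) (use pos in auto)
  finally show ?th1 by (simp add: mult.assoc)
  have "(LINT x|lborel. g (norm (x::'a))) = integral\<^sup>L (distr lborel borel (norm :: 'a \<Rightarrow> real)) g"
    by (subst integral_distr) auto
  also have "\<dots> = (LINT r|lborel. ?f r *\<^sub>R g r)"
    unfolding d by (rule integral_density) (use pos in auto)
  finally show ?th2 by (simp add: mult.assoc)
qed

section \<open>Integration by parts against compactly supported functions\<close>

lemma integrable_continuous_compact_support:
  fixes f :: "'a::euclidean_space \<Rightarrow> real"
  assumes "continuous_on UNIV f" "compact K" "\<And>x. x \<notin> K \<Longrightarrow> f x = 0"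
  shows "integrable lborel f"
proof -
  have "integrable lborel (\<lambda>x. indicator K x *\<^sub>R f x)"
    by (intro borel_integrable_compact assms continuous_on_subset[OF assms(1)]) auto
  moreover have "(\<lambda>x. indicator K x *\<^sub>R f x) = f"
    using assms(3) by (force simp: indicator_def)
  ultimately show ?thesis by metis
qed

lemma has_real_derivative_along_line:
  fixes h :: "'a::real_normed_vector \<Rightarrow> real"
  assumes "\<And>x. ((\<lambda>s. h (x + s *\<^sub>R v)) has_real_derivative h' x) (at 0)"
  shows "((\<lambda>s. h (x + s *\<^sub>R v)) has_real_derivative h' (x + s *\<^sub>R v)) (at s)"
proof -
  have "((\<lambda>\<sigma>. h ((x + s *\<^sub>R v) + (\<sigma> + - s) *\<^sub>R v)) has_real_derivative h' (x + s *\<^sub>R v)) (at s)"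
    using assms[of "x + s *\<^sub>R v"] DERIV_shift[of "\<lambda>\<sigma>. h ((x + s *\<^sub>R v) + \<sigma> *\<^sub>R v)" _ s "- s"]
    by simp
  then show ?thesis by (simp add: algebra_simps)
qed

text \<open>The difference quotients of \<open>h\<close> have integral zero by translation invariance, and they are
  dominated by the mean value theorem.\<close>

lemma integral_directional_derivative_eq_0:
  fixes h :: "'a::euclidean_space \<Rightarrow> real"
  assumes deriv: "\<And>x. ((\<lambda>s. h (x + s *\<^sub>R v)) has_real_derivative h' x) (at 0)"
    and cont: "continuous_on UNIV h" "continuous_on UNIV h'"
    and K: "compact K" "\<And>x. x \<notin> K \<Longrightarrow> h x = 0" "\<And>x. x \<notin> K \<Longrightarrow> h' x = 0"
  shows "(LINT x|lborel. h' x) = 0"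
proof -
  have [measurable]: "h \<in> borel_measurable borel" "h' \<in> borel_measurable borel"
    using cont borel_measurable_continuous_onI by auto
  have int_h: "integrable lborel h"
    using cont K integrable_continuous_compact_support by blast
  obtain R where R: "\<And>x. x \<in> K \<Longrightarrow> norm x \<le> R"
    using compact_imp_bounded[OF K(1)] by (auto simp: bounded_iff)
  have "compact (h' ` K)"
    using K(1) cont(2) compact_continuous_image continuous_on_subset by blast
  then obtain B0 where B0: "\<And>x. x \<in> K \<Longrightarrow> \<bar>h' x\<bar> \<le> B0"
    using compact_imp_bounded[of "h' ` K"] by (auto simp: bounded_iff)
  define B where "B = max B0 0"
  have B: "\<bar>h' x\<bar> \<le> B" for x
    using B0[of x] K(3)[of x] by (cases "x \<in> K") (auto simp: B_def)
  define s where "s n = inverse (real (Suc n))" for n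
  have s: "0 < s n" "s n \<le> 1" for n
    by (auto simp: s_def field_simps)
  define q where "q n x = (h (x + s n *\<^sub>R v) - h x) / s n" for n x
  have shift: "integrable lborel (\<lambda>x. h (x + c))" "(LINT x|lborel. h (x + c)) = (LINT x|lborel. h x)" for c
  proof -
    have "integrable (distr lborel borel ((+) c)) h"
      using int_h by (simp add: lborel_distr_plus)
    then show "integrable lborel (\<lambda>x. h (x + c))"
      by (subst (asm) integrable_distr_eq) (auto simp: add.commute)
    have "integral\<^sup>L (distr lborel borel ((+) c)) h = integral\<^sup>L lborel h"
      by (simp add: lborel_distr_plus)
    then show "(LINT x|lborel. h (x + c)) = (LINT x|lborel. h x)"
      by (subst (asm) integral_distr) (auto simp: add.commute)
  qed
  have q0: "(LINT x|lborel. q n x) = 0" for n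
    using shift int_h by (simp add: q_def)
  have "(\<lambda>n. LINT x|lborel. q n x) \<longlonglongrightarrow> (LINT x|lborel. h' x)"
  proof (rule integral_dominated_convergence[where w="\<lambda>x. B * indicator (cball 0 (R + norm v)) x"])
    show "h' \<in> borel_measurable lborel" "q n \<in> borel_measurable lborel" for n
      unfolding q_def by measurable
    show "integrable lborel (\<lambda>x::'a. B * indicator (cball 0 (R + norm v)) x)"
      by (intro integrable_mult_right integrable_real_indicator emeasure_bounded_finite) auto
    have s0: "filterlim s (at 0) sequentially"
      using LIMSEQ_inverse_real_of_nat s(1) unfolding s_def[abs_def]
      by (auto simp: filterlim_at eventually_sequentially)
    have "(\<lambda>n. q n x) \<longlonglongrightarrow> h' x" for x
      using filterlim_compose[OF deriv[of x, unfolded DERIV_def] s0] by (simp add: q_def)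
    then show "AE x in lborel. (\<lambda>n. q n x) \<longlonglongrightarrow> h' x" by simp
    have "norm (q n x) \<le> B * indicator (cball 0 (R + norm v)) x" for n x
    proof (cases "x \<in> cball 0 (R + norm v)")
      case True
      have "((\<lambda>s. h (x + s *\<^sub>R v)) has_real_derivative h' (x + \<sigma> *\<^sub>R v)) (at \<sigma>)" for \<sigma>
        by (rule has_real_derivative_along_line) (rule deriv)
      from MVT2[OF s(1)[of n] this]
      obtain \<sigma> where "h (x + s n *\<^sub>R v) - h (x + 0 *\<^sub>R v) = (s n - 0) * h' (x + \<sigma> *\<^sub>R v)"
        by blast
      then have "q n x = h' (x + \<sigma> *\<^sub>R v)"
        using s(1)[of n] by (simp add: q_def)
      with B True show ?thesis by simp
    next
      case False
      \<comment> \<open>The step \<open>s n *\<^sub>R v\<close> is no longer than \<open>v\<close>,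
        so both points of the difference quotient stay outside the ball of radius \<open>R\<close>
        that contains \<open>K\<close>.\<close>
      then have nx: "norm x > R + norm v" by simp
      have "norm (s n *\<^sub>R v) \<le> norm v"
        using s[of n] by (simp add: mult_left_le_one_le)
      then have "norm (x + s n *\<^sub>R v) > R"
        using nx norm_triangle_ineq4[of "x + s n *\<^sub>R v" "s n *\<^sub>R v"] by simp
      then have "x + s n *\<^sub>R v \<notin> K" using R leD by blast
      moreover have "x \<notin> K" using nx R[of x] by (smt (verit) norm_ge_zero)
      ultimately show ?thesis using K(2) by (simp add: q_def B_def)
    qed
    then show "AE x in lborel. norm (q n x) \<le> B * indicator (cball 0 (R + norm v)) x" for n
      by simp
  qed
  then have "(\<lambda>n::nat. 0::real) \<longlonglongrightarrow> (LINT x|lborel. h' x)"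
    unfolding q0 .
  from LIMSEQ_unique[OF this tendsto_const] show ?thesis .
qed

text \<open>The product rule turns the claim into the vanishing of the integral of a directional
  derivative; the compact support of \<open>g\<close> alone makes every product compactly
  supported.\<close>

lemma integral_by_parts_compact_support:
  fixes f g :: "'a::euclidean_space \<Rightarrow> real"
  assumes f: "\<And>x. ((\<lambda>s. f (x + s *\<^sub>R v)) has_real_derivative f' x) (at 0)"
      "continuous_on UNIV f" "continuous_on UNIV f'"
    and g: "\<And>x. ((\<lambda>s. g (x + s *\<^sub>R v)) has_real_derivative g' x) (at 0)"
      "continuous_on UNIV g" "continuous_on UNIV g'"
    and K: "compact K" "\<And>x. x \<notin> K \<Longrightarrow> g x = 0" "\<And>x. x \<notin> K \<Longrightarrow> g' x = 0"
  shows "(LINT x|lborel. f x * g' x) = - (LINT x|lborel. f' x * g x)"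
proof -
  have "(LINT x|lborel. f x * g' x + f' x * g x) = 0"
  proof (rule integral_directional_derivative_eq_0[where h="\<lambda>x. f x * g x" and K=K])
    show "((\<lambda>s. f (x + s *\<^sub>R v) * g (x + s *\<^sub>R v)) has_real_derivative f x * g' x + f' x * g x) (at 0)" for x
      using DERIV_mult[OF f(1) g(1), of x] by (simp add: algebra_simps)
    show "continuous_on UNIV (\<lambda>x. f x * g x)" "continuous_on UNIV (\<lambda>x. f x * g' x + f' x * g x)"
      by (intro continuous_on_mult continuous_on_add f g)+
  qed (simp_all add: K)
  moreover have "integrable lborel (\<lambda>x. f x * g' x)"
    by (intro integrable_continuous_compact_support[OF _ K(1)] continuous_on_mult f g) (simp add: K)
  moreover have "integrable lborel (\<lambda>x. f' x * g x)"
    by (intro integrable_continuous_compact_support[OF _ K(1)] continuous_on_mult f g) (simp add: K)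
  ultimately show ?thesis by simp
qed

lemma test_function_continuous: "test_function \<phi> \<Longrightarrow> continuous_on UNIV \<phi>"
  unfolding test_function_def Ck.simps(1)[symmetric] by blast

lemma test_function_bounded_support: "test_function \<phi> \<Longrightarrow> bounded {x. \<phi> x \<noteq> 0}"
  by (simp add: test_function_def)

lemma vanishes_outside_support:
  "x \<notin> closure {x. \<phi> x \<noteq> 0} \<Longrightarrow> \<phi> x = 0"
  using closure_subset[of "{x. \<phi> x \<noteq> 0}"] by blast

text \<open>Passes from the Frechet derivatives of the definitions to one-variable derivatives along
  lines, the form in which all integrations by parts are done.\<close>

lemma test_function_has_derivative:
  assumes "test_function \<phi>"
  shows "((\<lambda>s. \<phi> (x + s *\<^sub>R v)) has_real_derivative dir_deriv v \<phi> x) (at 0)"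
proof -
  have "Ck (Suc 0) \<phi>" using assms by (simp add: test_function_def)
  then have "(\<phi> has_derivative frechet_derivative \<phi> (at x)) (at (x + 0 *\<^sub>R v))"
    by (simp add: frechet_derivative_works[symmetric])
  moreover have "((\<lambda>s. x + s *\<^sub>R v) has_derivative (\<lambda>s. s *\<^sub>R v)) (at (0::real))"
    by (auto intro!: derivative_eq_intros)
  ultimately have "((\<lambda>s. \<phi> (x + s *\<^sub>R v)) has_derivative (\<lambda>s. frechet_derivative \<phi> (at x) (s *\<^sub>R v))) (at 0)"
    by (rule has_derivative_compose[rotated])
  moreover have "linear (frechet_derivative \<phi> (at x))"
    using \<open>Ck (Suc 0) \<phi>\<close> by (simp add: linear_frechet_derivative)
  then have "frechet_derivative \<phi> (at x) (s *\<^sub>R v) = dir_deriv v \<phi> x * s" for s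
    by (simp add: linear_cmul)
  ultimately show ?thesis
    by (simp add: has_field_derivative_def)
qed

lemma dir_deriv_vanishes:
  assumes "test_function \<phi>" "x \<notin> closure {x. \<phi> x \<noteq> 0}"
  shows "dir_deriv v \<phi> x = 0"
proof -
  have "(\<phi> has_derivative (\<lambda>_. 0)) (at x)"
  proof (rule has_derivative_transform_within_open[where s="- closure {x. \<phi> x \<noteq> 0}"])
    show "((\<lambda>_. 0) has_derivative (\<lambda>_. 0)) (at x)" by simp
    show "0 = \<phi> y" if "y \<in> - closure {x. \<phi> x \<noteq> 0}" for y
      using that vanishes_outside_support[of y \<phi>] by simp
  qed (use assms(2) in auto)
  then have "(\<lambda>_. 0) = frechet_derivative \<phi> (at x)" by (rule frechet_derivative_at)
  then show ?thesis by metis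
qed

lemma test_function_dir_deriv:
  assumes "test_function \<phi>"
  shows "test_function (dir_deriv v \<phi>)"
  unfolding test_function_def
proof
  show "\<forall>k. Ck k (dir_deriv v \<phi>)"
  proof
    fix k
    have "Ck (Suc k) \<phi>" using assms by (simp only: test_function_def)
    then show "Ck k (dir_deriv v \<phi>)" by simp
  qed
  have "{x. dir_deriv v \<phi> x \<noteq> 0} \<subseteq> closure {x. \<phi> x \<noteq> 0}"
    using dir_deriv_vanishes[OF assms, of _ v] by blast
  then have "bounded {x. dir_deriv v \<phi> x \<noteq> 0}"
    by (rule bounded_subset[OF bounded_closure[OF test_function_bounded_support[OF assms]]])
  then show "compact (closure {x. dir_deriv v \<phi> x \<noteq> 0})"
    by simp
qed

lemma integral_by_parts_test_function:
  fixes f :: "'a::euclidean_space \<Rightarrow> real"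
  assumes "\<And>x. ((\<lambda>s. f (x + s *\<^sub>R v)) has_real_derivative f' x) (at 0)"
      "continuous_on UNIV f" "continuous_on UNIV f'" "test_function \<phi>"
  shows "(LINT x|lborel. f x * dir_deriv v \<phi> x) = - (LINT x|lborel. f' x * \<phi> x)"
proof (rule integral_by_parts_compact_support[where K="closure {x. \<phi> x \<noteq> 0}"])
  show "((\<lambda>s. \<phi> (x + s *\<^sub>R v)) has_real_derivative dir_deriv v \<phi> x) (at 0)" for x
    using assms(4) by (rule test_function_has_derivative)
  show "continuous_on UNIV \<phi>" "continuous_on UNIV (dir_deriv v \<phi>)"
    by (rule test_function_continuous[OF assms(4)], rule test_function_continuous[OF test_function_dir_deriv[OF assms(4)]])
  show "\<phi> x = 0" "dir_deriv v \<phi> x = 0" if "x \<notin> closure {x. \<phi> x \<noteq> 0}" for x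
    using vanishes_outside_support[OF that] dir_deriv_vanishes[OF assms(4) that] by blast+
  show "compact (closure {x. \<phi> x \<noteq> 0})"
    using assms(4) by (simp only: test_function_def)
qed (fact assms)+

lemma integrable_mult_test_function:
  fixes f :: "'a::euclidean_space \<Rightarrow> real"
  assumes "continuous_on UNIV f" "test_function \<phi>"
  shows "integrable lborel (\<lambda>x. f x * \<phi> x)"
proof (rule integrable_continuous_compact_support[where K="closure {x. \<phi> x \<noteq> 0}"])
  show "continuous_on UNIV (\<lambda>x. f x * \<phi> x)"
    by (rule continuous_on_mult[OF assms(1) test_function_continuous[OF assms(2)]])
  show "f x * \<phi> x = 0" if "x \<notin> closure {x. \<phi> x \<noteq> 0}" for x
    using vanishes_outside_support[OF that] by simp
  show "compact (closure {x. \<phi> x \<noteq> 0})"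
    using assms(2) by (simp only: test_function_def)
qed

lemma locally_integrable_continuous:
  fixes f :: "'a::euclidean_space \<Rightarrow> 'b::euclidean_space"
  assumes "continuous_on UNIV f"
  shows "locally_integrable f"
  unfolding locally_integrable_def set_integrable_def
proof (intro allI impI)
  fix K :: "'a set" assume "compact K"
  then have "integrable lborel (\<lambda>x. indicator K x *\<^sub>R f x)"
    by (intro borel_integrable_compact continuous_on_subset[OF assms]) auto
  then show "integrable lebesgue (\<lambda>x. indicator K x *\<^sub>R f x)"
    by (metis borel_measurable_integrable integrable_completion)
qed

lemma continuous_on_measurable_lebesgue:
  fixes f :: "'a::euclidean_space \<Rightarrow> 'b::euclidean_space"
  assumes "continuous_on UNIV f"
  shows "f \<in> borel_measurable lebesgue"
  using borel_measurable_continuous_onI[OF assms] by (intro measurable_completion) simp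

section \<open>Classical solutions are finite-energy solutions\<close>

text \<open>In polar coordinates the integrand is r^5 / (1 + r)^8, which is at most (1 + r)^(-2).
  The exponent 8 is twice the decay order 4 of the derivatives of the solutions.\<close>

lemma integrable_weight: "integrable lborel (\<lambda>x::R6. 1 / (1 + norm x) ^ 8)"
proof -
  have "(\<integral>\<^sup>+r. ennreal (1 / (1 + r)\<^sup>2) * indicator {0..} r \<partial>lborel) = 0 - (- 1 / (1 + 0::real))"
  proof (rule nn_integral_FTC_atLeast)
    show "((\<lambda>r. - 1 / (1 + r)) has_real_derivative 1 / (1 + r)\<^sup>2) (at r)" if "0 \<le> r" for r :: real
      using that by (auto intro!: derivative_eq_intros simp: power2_eq_square)
    show "((\<lambda>r::real. - 1 / (1 + r)) \<longlongrightarrow> 0) at_top"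
      by (intro tendsto_divide_0[OF tendsto_const] filterlim_at_top_imp_at_infinity
          filterlim_tendsto_add_at_top[OF tendsto_const] filterlim_ident)
  qed auto
  moreover have "ennreal (1 / (1 + r)\<^sup>2) * indicator {0..} r = ennreal (1 / (1 + r)\<^sup>2 * indicator {0..} r)" for r :: real
    by (simp split: split_indicator)
  ultimately have "integrable lborel (\<lambda>r::real. 1 / (1 + r)\<^sup>2 * indicator {0..} r)"
    by (intro integrableI_nonneg) simp_all
  then have "integrable lborel (\<lambda>r::real. indicator {0..} r * r ^ 5 * (1 / (1 + r) ^ 8))"
  proof (rule Bochner_Integration.integrable_bound)
    have "norm (indicator {0..} r * r ^ 5 * (1 / (1 + r) ^ 8)) \<le> norm (1 / (1 + r)\<^sup>2 * indicator {0..} r)" for r :: real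
    proof (cases "0 \<le> r")
      case True
      have "r ^ 5 * (1 + r)\<^sup>2 \<le> (1 + r) ^ 5 * (1 + r) ^ 3"
        using True by (intro mult_mono power_mono power_increasing) auto
      also have "\<dots> = (1 + r) ^ 8" by (simp flip: power_add)
      finally show ?thesis using True by (simp add: divide_simps)
    qed simp
    then show "AE r in lborel. norm (indicator {0..} r * r ^ 5 * (1 / (1 + r) ^ 8)) \<le> norm (1 / (1 + r)\<^sup>2 * indicator {0..} r :: real)"
      by simp
  qed simp
  then have "integrable lborel (\<lambda>r. unit_ball_vol DIM(R6) * DIM(R6) * (indicator {0..} r * r ^ 5 * (1 / (1 + r) ^ 8)))"
    by (rule integrable_mult_right)
  moreover have "DIM(R6) - 1 = 5" by simp
  moreover have "(\<lambda>r::real. 1 / (1 + r) ^ 8) \<in> borel_measurable borel" by measurable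
  note integrable_radial_iff[where 'a=R6, OF this]
  ultimately show ?thesis by (simp only:)
qed

lemma integrable_weight_lebesgue: "integrable lebesgue (\<lambda>x::R6. c / (1 + norm x) ^ 8)"
proof -
  have "integrable lborel (\<lambda>x::R6. c * (1 / (1 + norm x) ^ 8))"
    using integrable_weight by (rule integrable_mult_right)
  then have "integrable lebesgue (\<lambda>x::R6. c * (1 / (1 + norm x) ^ 8))"
    by (subst integrable_completion) (rule borel_measurable_integrable)
  then show ?thesis by simp
qed

lemma square_integrable_bound:
  fixes f :: "R6 \<Rightarrow> 'b::euclidean_space"
  assumes "continuous_on UNIV f" "\<And>x. norm (f x) \<le> C / (1 + norm x) ^ 4"
  shows "square_integrable f"
  unfolding square_integrable_def
proof
  show f: "f \<in> borel_measurable lebesgue"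
    using assms(1) by (rule continuous_on_measurable_lebesgue)
  show "integrable lebesgue (\<lambda>x. (norm (f x))\<^sup>2)"
  proof (rule Bochner_Integration.integrable_bound[OF integrable_weight_lebesgue[of "C\<^sup>2"]])
    show "(\<lambda>x. (norm (f x))\<^sup>2) \<in> borel_measurable lebesgue"
      using f by measurable
    have "(norm (f x))\<^sup>2 \<le> C\<^sup>2 / (1 + norm x) ^ 8" for x
      using power_mono[OF assms(2)[of x], of 2] by (simp add: power_divide flip: power_mult)
    then show "AE x in lebesgue. norm ((norm (f x))\<^sup>2) \<le> norm (C\<^sup>2 / (1 + norm x) ^ 8)"
      by simp
  qed
qed

text \<open>Dominated convergence along every sequence tending to \<open>a\<close>, with the square
  of the common bound as the integrable majorant.\<close>

lemma tendsto_L2_dominated: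
  fixes F :: "real \<Rightarrow> R6 \<Rightarrow> 'b::euclidean_space"
  assumes "\<forall>\<^sub>F s in at a. continuous_on UNIV (F s)" "continuous_on UNIV f"
    and lim: "\<And>x. ((\<lambda>s. F s x) \<longlongrightarrow> f x) (at a)"
    and bound: "\<forall>\<^sub>F s in at a. \<forall>x. norm (F s x - f x) \<le> C / (1 + norm x) ^ 4"
  shows "tendsto_L2 F f (at a)"
  unfolding tendsto_L2_def
proof
  have ev: "\<forall>\<^sub>F s in at a. square_integrable (\<lambda>x. F s x - f x) \<and> (\<forall>x. norm (F s x - f x) \<le> C / (1 + norm x) ^ 4)"
    using assms(1) bound
  proof eventually_elim
    case (elim s)
    from square_integrable_bound[OF continuous_on_diff[OF elim(1) assms(2)] elim(2)[rule_format]] elim(2)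
    show ?case ..
  qed
  then show "\<forall>\<^sub>F s in at a. square_integrable (\<lambda>x. F s x - f x)"
    by (rule eventually_mono) simp
  have "((\<lambda>s. LINT x|lebesgue. (norm (F s x - f x))\<^sup>2) \<longlongrightarrow> 0) (at a)"
    unfolding tendsto_at_iff_sequentially
  proof (intro allI impI)
    fix S assume "\<forall>i. S i \<in> UNIV - {a}" "S \<longlonglongrightarrow> a"
    then have S: "filterlim S (at a) sequentially"
      by (simp add: filterlim_at)
    \<comment> \<open>Continuity and the bound are only known near \<open>a\<close>, so the sequence
      is shifted by \<open>N\<close> before dominated convergence is applied.\<close>
    obtain N where N: "\<forall>n\<ge>N. square_integrable (\<lambda>x. F (S n) x - f x) \<and>
        (\<forall>x. norm (F (S n) x - f x) \<le> C / (1 + norm x) ^ 4)"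
      using eventually_compose_filterlim[OF ev S] unfolding eventually_sequentially ..
    have N1: "square_integrable (\<lambda>x. F (S (n + N)) x - f x)"
      and N2: "norm (F (S (n + N)) x - f x) \<le> C / (1 + norm x) ^ 4" for n x
      using N[rule_format, of "n + N"] by simp_all
    have "(\<lambda>n. LINT x|lebesgue. (norm (F (S (n + N)) x - f x))\<^sup>2) \<longlonglongrightarrow> (LINT (x::R6)|lebesgue. 0)"
    proof (rule integral_dominated_convergence[where w="\<lambda>x. C\<^sup>2 / (1 + norm x) ^ 8"])
      show "(\<lambda>x. (norm (F (S (n + N)) x - f x))\<^sup>2) \<in> borel_measurable lebesgue" for n
        using N1 unfolding square_integrable_def by (intro borel_measurable_integrable) simp
      have "(\<lambda>n. (norm (F (S (n + N)) x - f x))\<^sup>2) \<longlonglongrightarrow> 0" for x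
      proof -
        have "(\<lambda>n. (norm (F (S n) x - f x))\<^sup>2) \<longlonglongrightarrow> (norm (f x - f x))\<^sup>2"
          by (intro tendsto_intros filterlim_compose[OF lim S])
        from LIMSEQ_ignore_initial_segment[OF this, of N] show ?thesis by simp
      qed
      then show "AE x in lebesgue. (\<lambda>n. (norm (F (S (n + N)) x - f x))\<^sup>2) \<longlonglongrightarrow> 0" by simp
      have "norm ((norm (F (S (n + N)) x - f x))\<^sup>2) \<le> C\<^sup>2 / (1 + norm x) ^ 8" for n x
        using power_mono[OF N2, of n x 2] by (simp add: power_divide flip: power_mult)
      then show "AE x in lebesgue. norm ((norm (F (S (n + N)) x - f x))\<^sup>2) \<le> C\<^sup>2 / (1 + norm x) ^ 8" for n
        by simp
    qed (simp, rule integrable_weight_lebesgue)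
    then show "((\<lambda>s. LINT x|lebesgue. (norm (F s x - f x))\<^sup>2) \<circ> S) \<longlonglongrightarrow> 0"
      unfolding o_def by - (rule LIMSEQ_offset[of _ N], simp)
  qed
  from tendsto_real_sqrt[OF this]
  show "((\<lambda>s. L2_norm_on UNIV (\<lambda>x. F s x - f x)) \<longlongrightarrow> 0) (at a)"
    by (simp add: L2_norm_on_def set_lebesgue_integral_def)
qed

section \<open>From classical derivatives to the weak formulations\<close>

text \<open>Each second derivative in the wave operator is taken in one fixed direction, so two
  integrations by parts along that direction move it onto \<open>f\<close>. Only continuous pure
  second derivatives of \<open>f\<close> are needed, no joint differentiability.\<close>

lemma wave_op_integral_by_parts:
  fixes f :: "real \<times> R6 \<Rightarrow> real"
  assumes t: "\<And>z. ((\<lambda>s. f (z + s *\<^sub>R (1, 0))) has_real_derivative ft z) (at 0)"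
      "\<And>z. ((\<lambda>s. ft (z + s *\<^sub>R (1, 0))) has_real_derivative ftt z) (at 0)"
    and x: "\<And>e z. e \<in> Basis \<Longrightarrow> ((\<lambda>s. f (z + s *\<^sub>R (0, e))) has_real_derivative fx e z) (at 0)"
      "\<And>e z. e \<in> Basis \<Longrightarrow> ((\<lambda>s. fx e (z + s *\<^sub>R (0, e))) has_real_derivative fxx e z) (at 0)"
    and cont: "continuous_on UNIV f" "continuous_on UNIV ft" "continuous_on UNIV ftt"
      "\<And>e. e \<in> Basis \<Longrightarrow> continuous_on UNIV (fx e)" "\<And>e. e \<in> Basis \<Longrightarrow> continuous_on UNIV (fxx e)"
    and eq: "\<And>z. ftt z = (\<Sum>e\<in>Basis. fxx e z)"
    and \<phi>: "test_function \<phi>"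
  shows "(LINT z|lebesgue. f z * wave_op \<phi> z) = 0"
proof -
  have D: "test_function (dir_deriv v (dir_deriv v \<phi>))" for v
    by (intro test_function_dir_deriv \<phi>)
  have parts: "(LINT z|lborel. f z * dir_deriv v (dir_deriv v \<phi>) z) = (LINT z|lborel. g' z * \<phi> z)"
    if "\<And>z. ((\<lambda>s. f (z + s *\<^sub>R v)) has_real_derivative g z) (at 0)"
       "\<And>z. ((\<lambda>s. g (z + s *\<^sub>R v)) has_real_derivative g' z) (at 0)"
       "continuous_on UNIV g" "continuous_on UNIV g'" for v g g'
  proof -
    have "(LINT z|lborel. f z * dir_deriv v (dir_deriv v \<phi>) z) = - (LINT z|lborel. g z * dir_deriv v \<phi> z)"
      by (rule integral_by_parts_test_function[OF that(1) cont(1) that(3) test_function_dir_deriv[OF \<phi>]])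
    also have "(LINT z|lborel. g z * dir_deriv v \<phi> z) = - (LINT z|lborel. g' z * \<phi> z)"
      by (rule integral_by_parts_test_function[OF that(2-4) \<phi>])
    finally show ?thesis by simp
  qed
  have int: "integrable lborel (\<lambda>z. f z * dir_deriv v (dir_deriv v \<phi>) z)" for v
    by (rule integrable_mult_test_function[OF cont(1) D])
  have expand: "f z * wave_op \<phi> z = f z * dir_deriv (1, 0) (dir_deriv (1, 0) \<phi>) z -
      (\<Sum>e\<in>Basis. f z * dir_deriv (0, e) (dir_deriv (0, e) \<phi>) z)" for z
    by (simp add: wave_op_def sum_distrib_left right_diff_distrib)
  have meas: "(\<lambda>z. f z * wave_op \<phi> z) \<in> borel_measurable lborel"
    unfolding expand
    by (intro borel_measurable_diff borel_measurable_sum borel_measurable_integrable int)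
  have "(LINT z|lebesgue. f z * wave_op \<phi> z) = (LINT z|lborel. f z * wave_op \<phi> z)"
    by (rule integral_completion[OF meas])
  also have "\<dots> = (LINT z|lborel. f z * dir_deriv (1, 0) (dir_deriv (1, 0) \<phi>) z) -
      (\<Sum>e\<in>Basis. LINT z|lborel. f z * dir_deriv (0, e) (dir_deriv (0, e) \<phi>) z)"
    unfolding expand
    by (subst Bochner_Integration.integral_diff)
       (intro int Bochner_Integration.integrable_sum Bochner_Integration.integral_sum
         arg_cong2[where f="(-)"] refl)+
  also have "\<dots> = (LINT z|lborel. ftt z * \<phi> z) - (\<Sum>e\<in>Basis. LINT z|lborel. fxx e z * \<phi> z)"
    by (intro arg_cong2[where f="(-)"] sum.cong refl parts[OF t cont(2,3)] parts[OF x cont(4,5)])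
  also have "(\<Sum>e\<in>Basis. LINT z|lborel. fxx e z * \<phi> z) = (LINT z|lborel. (\<Sum>e\<in>Basis. fxx e z * \<phi> z))"
    by (intro Bochner_Integration.integral_sum[symmetric] integrable_mult_test_function cont \<phi>)
  also have "\<dots> = (LINT z|lborel. ftt z * \<phi> z)"
    by (simp add: eq sum_distrib_right)
  finally show ?thesis by simp
qed

lemma weak_gradient_classical:
  fixes u :: "'a::euclidean_space \<Rightarrow> real" and G :: "'a \<Rightarrow> 'a"
  assumes "continuous_on UNIV u" "continuous_on UNIV G"
    and "\<And>e x. e \<in> Basis \<Longrightarrow> ((\<lambda>s. u (x + s *\<^sub>R e)) has_real_derivative G x \<bullet> e) (at 0)"
  shows "weak_gradient u G"
  unfolding weak_gradient_def
proof (intro conjI allI impI ballI)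
  fix \<phi> :: "'a \<Rightarrow> real" and e :: 'a assume \<phi>: "test_function \<phi>" and e: "e \<in> Basis"
  have G: "continuous_on UNIV (\<lambda>x. G x \<bullet> e)"
    using assms(2) by (intro continuous_intros)
  have "(LINT x|lborel. u x * dir_deriv e \<phi> x) = - (LINT x|lborel. (G x \<bullet> e) * \<phi> x)"
    by (rule integral_by_parts_test_function[OF assms(3)[OF e] assms(1) G \<phi>])
  moreover have "(\<lambda>x. u x * dir_deriv e \<phi> x) \<in> borel_measurable lborel"
      "(\<lambda>x. (G x \<bullet> e) * \<phi> x) \<in> borel_measurable lborel"
    by (intro borel_measurable_integrable integrable_mult_test_function assms G \<phi> test_function_dir_deriv)+
  ultimately show "(LINT x|lebesgue. u x * dir_deriv e \<phi> x) = - (LINT x|lebesgue. (G x \<bullet> e) * \<phi> x)"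
    by (simp add: integral_completion)
qed (intro locally_integrable_continuous assms)+

text \<open>Decay of order 3 becomes order 9 after cubing, which is beyond the integrable order 8;
  order 2, the decay of 1/r^2, would not be enough.\<close>

lemma Hdot1_classical:
  fixes u :: "R6 \<Rightarrow> real"
  assumes "continuous_on UNIV u" "continuous_on UNIV G"
    and "\<And>e x. e \<in> Basis \<Longrightarrow> ((\<lambda>s. u (x + s *\<^sub>R e)) has_real_derivative G x \<bullet> e) (at 0)"
    and u: "\<And>x. \<bar>u x\<bar> \<le> C / (1 + norm x) ^ 3" and "\<And>x. norm (G x) \<le> C / (1 + norm x) ^ 4"
  shows "u \<in> Hdot1"
proof -
  have um: "u \<in> borel_measurable lebesgue"
    using assms(1) by (rule continuous_on_measurable_lebesgue)
  have C: "0 \<le> C"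
    using u[of 0] by simp
  have "integrable lebesgue (\<lambda>x. \<bar>u x\<bar> ^ 3)"
  proof (rule Bochner_Integration.integrable_bound[OF integrable_weight_lebesgue[of "C ^ 3"]])
    show "(\<lambda>x. \<bar>u x\<bar> ^ 3) \<in> borel_measurable lebesgue"
      using um by measurable
    have "\<bar>u x\<bar> ^ 3 \<le> C ^ 3 / (1 + norm x) ^ 8" for x
    proof -
      have "\<bar>u x\<bar> ^ 3 \<le> (C / (1 + norm x) ^ 3) ^ 3"
        using u by (intro power_mono) auto
      also have "\<dots> = C ^ 3 / (1 + norm x) ^ 9"
        by (simp add: power_divide flip: power_mult)
      also have "\<dots> \<le> C ^ 3 / (1 + norm x) ^ 8"
        using C by (intro divide_left_mono power_increasing mult_pos_pos zero_less_power)
          (auto intro: add_pos_nonneg)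
      finally show ?thesis .
    qed
    then show "AE x in lebesgue. norm (\<bar>u x\<bar> ^ 3) \<le> norm (C ^ 3 / (1 + norm x) ^ 8)"
      using C by simp
  qed
  then show ?thesis
    unfolding Hdot1_def
    by (intro CollectI conjI um exI[of _ G] weak_gradient_classical[OF assms(1-3)]
        square_integrable_bound[OF assms(2,5)])
qed

text \<open>Decay bounds uniform on bounded time intervals provide the majorants for all three
  limits in the mean; the distributional equation follows from the pointwise one by parts.\<close>

lemma free_wave_solution_classical:
  fixes v vt vtt :: "real \<Rightarrow> R6 \<Rightarrow> real" and Dv :: "real \<Rightarrow> R6 \<Rightarrow> R6" and vxx :: "R6 \<Rightarrow> real \<Rightarrow> R6 \<Rightarrow> real"
  assumes cont: "continuous_on UNIV (\<lambda>(t, x). v t x)" "continuous_on UNIV (\<lambda>(t, x). vt t x)"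
      "continuous_on UNIV (\<lambda>(t, x). vtt t x)" "continuous_on UNIV (\<lambda>(t, x). Dv t x)"
      "\<And>e. e \<in> Basis \<Longrightarrow> continuous_on UNIV (\<lambda>(t, x). vxx e t x)"
    and t: "\<And>t x. ((\<lambda>s. v s x) has_real_derivative vt t x) (at t)"
      "\<And>t x. ((\<lambda>s. vt s x) has_real_derivative vtt t x) (at t)"
    and x: "\<And>e t x. e \<in> Basis \<Longrightarrow> ((\<lambda>s. v t (x + s *\<^sub>R e)) has_real_derivative Dv t x \<bullet> e) (at 0)"
      "\<And>e t x. e \<in> Basis \<Longrightarrow> ((\<lambda>s. Dv t (x + s *\<^sub>R e) \<bullet> e) has_real_derivative vxx e t x) (at 0)"
    and eq: "\<And>t x. vtt t x = (\<Sum>e\<in>Basis. vxx e t x)"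
    and bound: "\<And>T. \<exists>C. \<forall>t x. \<bar>t\<bar> \<le> T \<longrightarrow> \<bar>v t x\<bar> \<le> C / (1 + norm x) ^ 3 \<and>
        \<bar>vt t x\<bar> \<le> C / (1 + norm x) ^ 4 \<and> norm (Dv t x) \<le> C / (1 + norm x) ^ 4"
    and vt0: "\<And>x. vt 0 x = 0"
  shows "free_wave_solution (v 0) (\<lambda>x. 0) v vt Dv"
proof -
  have slice: "continuous_on UNIV (f t)" if "continuous_on UNIV (\<lambda>(t, x). f t x)"
    for f :: "real \<Rightarrow> R6 \<Rightarrow> 'b::euclidean_space" and t
    using continuous_on_compose2[OF that continuous_on_Pair[OF continuous_on_const[of UNIV t] continuous_on_id]]
    by simp
  have slice': "((\<lambda>s. f s x) \<longlongrightarrow> f t x) (at t)" if "continuous_on UNIV (\<lambda>(t, x). f t x)"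
    for f :: "real \<Rightarrow> R6 \<Rightarrow> 'b::euclidean_space" and t x
  proof -
    have "continuous_on UNIV (\<lambda>t. f t x)"
      using continuous_on_compose2[OF that continuous_on_Pair[OF continuous_on_id continuous_on_const[of UNIV x]]]
      by simp
    then show ?thesis
      by (simp add: continuous_on_def)
  qed
  have near: "\<forall>\<^sub>F s in at t. \<bar>s\<bar> \<le> \<bar>t\<bar> + 1" for t :: real
    unfolding eventually_at dist_real_def by (rule exI[of _ 1]) auto
  have L2: "tendsto_L2 f (f t) (at t)"
    if f: "continuous_on UNIV (\<lambda>(t, x). f t x)" "\<And>T. \<exists>C. \<forall>t x. \<bar>t\<bar> \<le> T \<longrightarrow> norm (f t x) \<le> C / (1 + norm x) ^ 4"
    for f :: "real \<Rightarrow> R6 \<Rightarrow> 'b::euclidean_space" and t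
  proof -
    obtain C where C: "\<And>s x. \<bar>s\<bar> \<le> \<bar>t\<bar> + 1 \<Longrightarrow> norm (f s x) \<le> C / (1 + norm x) ^ 4"
      using f(2)[of "\<bar>t\<bar> + 1"] by blast
    have "norm (f s x - f t x) \<le> (2 * C) / (1 + norm x) ^ 4" if "\<bar>s\<bar> \<le> \<bar>t\<bar> + 1" for s x
      using C[OF that, of x] C[of t x] norm_triangle_ineq4[of "f s x" "f t x"] by simp
    then have "\<forall>\<^sub>F s in at t. \<forall>x. norm (f s x - f t x) \<le> (2 * C) / (1 + norm x) ^ 4"
      by (intro eventually_mono[OF near[of t]]) simp
    then show ?thesis
      by (rule tendsto_L2_dominated[OF always_eventually[OF allI[OF slice[OF f(1)]]] slice[OF f(1)] slice'[OF f(1)]])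
  qed
  have "\<exists>C. \<forall>t x. \<bar>t\<bar> \<le> T \<longrightarrow> norm (vt t x) \<le> C / (1 + norm x) ^ 4"
    "\<exists>C. \<forall>t x. \<bar>t\<bar> \<le> T \<longrightarrow> norm (Dv t x) \<le> C / (1 + norm x) ^ 4" for T
    unfolding real_norm_def using bound[of T] by fast+
  note L2_vt = L2[OF cont(2) this(1)] and L2_Dv = L2[OF cont(4) this(2)]
  have L2_quotient: "tendsto_L2 (\<lambda>h x. (v (t + h) x - v t x) / h) (vt t) (at 0)" for t
  proof -
    obtain C where C: "\<And>s x. \<bar>s\<bar> \<le> \<bar>t\<bar> + 1 \<Longrightarrow> \<bar>vt s x\<bar> \<le> C / (1 + norm x) ^ 4"
      using bound[of "\<bar>t\<bar> + 1"] by blast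
    have "norm ((v (t + h) x - v t x) / h - vt t x) \<le> (2 * C) / (1 + norm x) ^ 4"
      if h: "\<bar>h\<bar> \<le> 1" "h \<noteq> 0" for h x
    proof -
      \<comment> \<open>By the mean value inequality the difference quotient inherits the bound that
        \<open>vt\<close> has on the time interval of radius 1 about \<open>t\<close>.\<close>
      have "norm (v (t + h) x - v t x) \<le> C / (1 + norm x) ^ 4 * norm (t + h - t)"
        by (rule field_differentiable_bound[where S="{t - 1..t + 1}" and f'="\<lambda>s. vt s x"])
           (use h C in \<open>auto intro!: has_field_derivative_at_within t\<close>)
      then have "norm ((v (t + h) x - v t x) / h) \<le> C / (1 + norm x) ^ 4"
        using h(2) by (simp add: abs_divide pos_divide_le_eq)
      then show ?thesis
        using C[of t x] norm_triangle_ineq4[of "(v (t + h) x - v t x) / h" "vt t x"]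
        by (simp add: real_norm_def)
    qed
    then have "\<forall>\<^sub>F h in at 0. \<forall>x. norm ((v (t + h) x - v t x) / h - vt t x) \<le> (2 * C) / (1 + norm x) ^ 4"
      by (auto simp: eventually_at dist_real_def intro!: exI[of _ 1])
    moreover have "\<forall>\<^sub>F h in at 0. continuous_on UNIV (\<lambda>x. (v (t + h) x - v t x) / h)"
      using eventually_neq_at_within[of 0 0 UNIV]
      by eventually_elim (simp add: continuous_on_divide continuous_on_diff slice[OF cont(1)])
    moreover have "((\<lambda>h. (v (t + h) x - v t x) / h) \<longlongrightarrow> vt t x) (at 0)" for x
      using t(1)[of x t] unfolding DERIV_def .
    ultimately show ?thesis
      by (rule tendsto_L2_dominated[OF _ slice[OF cont(2)], rotated 2])
  qed
  have wave: "(LINT (t, x)|lebesgue. v t x * wave_op \<phi> (t, x)) = 0" if "test_function \<phi>" for \<phi>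
  proof -
    have *: "((\<lambda>s. case z + s *\<^sub>R (1, 0) of (t, x) \<Rightarrow> f t x) has_real_derivative (case z of (t, x) \<Rightarrow> f' t x)) (at 0)"
      if "\<And>t x. ((\<lambda>s. f s x) has_real_derivative f' t x) (at t)" for z :: "real \<times> R6" and f f' :: "real \<Rightarrow> R6 \<Rightarrow> real"
    proof (cases z)
      case (Pair t x)
      have "((\<lambda>s. f (s + t) x) has_real_derivative f' t x) (at 0)"
        using that[of x "0 + t"] by (simp only: DERIV_shift) simp
      then show ?thesis by (simp add: Pair add.commute)
    qed
    have "(LINT z|lebesgue. (case z of (t, x) \<Rightarrow> v t x) * wave_op \<phi> z) = 0"
    proof (rule wave_op_integral_by_parts[OF *[OF t(1)] *[OF t(2)] _ _ cont(1-3) _ _ _ that])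
      show "((\<lambda>s. case z + s *\<^sub>R (0, e) of (t, x) \<Rightarrow> v t x) has_real_derivative (case z of (t, x) \<Rightarrow> Dv t x \<bullet> e)) (at 0)"
        "((\<lambda>s. case z + s *\<^sub>R (0, e) of (t, x) \<Rightarrow> Dv t x \<bullet> e) has_real_derivative (case z of (t, x) \<Rightarrow> vxx e t x)) (at 0)"
        if "e \<in> Basis" for z :: "real \<times> R6" and e
        using x[OF that] by (cases z; simp)+
      show "continuous_on UNIV (\<lambda>(t, x). Dv t x \<bullet> e)" for e
        using continuous_on_inner[OF cont(4) continuous_on_const[of _ e]] by (simp add: case_prod_unfold)
      show "continuous_on UNIV (\<lambda>(t, x). vxx e t x)" if "e \<in> Basis" for e
        using that by (rule cont)
      show "(case z of (t, x) \<Rightarrow> vtt t x) = (\<Sum>e\<in>Basis. case z of (t, x) \<Rightarrow> vxx e t x)" for z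
        by (cases z) (simp add: eq)
    qed
    then show ?thesis by (simp add: case_prod_unfold)
  qed
  have "v t \<in> Hdot1 \<and> weak_gradient (v t) (Dv t) \<and> square_integrable (Dv t) \<and> square_integrable (vt t)" for t
  proof -
    obtain C where C: "\<And>x. \<bar>v t x\<bar> \<le> C / (1 + norm x) ^ 3" "\<And>x. \<bar>vt t x\<bar> \<le> C / (1 + norm x) ^ 4"
        "\<And>x. norm (Dv t x) \<le> C / (1 + norm x) ^ 4"
      using bound[of "\<bar>t\<bar>"] by blast
    show ?thesis
      by (intro conjI Hdot1_classical[OF slice[OF cont(1)] slice[OF cont(4)] x(1) C(1,3)]
          weak_gradient_classical[OF slice[OF cont(1)] slice[OF cont(4)] x(1)]
          square_integrable_bound[OF slice[OF cont(4)] C(3)]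
          square_integrable_bound[OF slice[OF cont(2)] C(2)[folded real_norm_def]])
  qed
  with L2_vt L2_Dv L2_quotient wave show ?thesis
    by (simp add: free_wave_solution_def vt0 locally_integrable_continuous[OF cont(1)])
qed

section \<open>An explicit family of solutions\<close>

text \<open>The argument \<open>s\<close> stands for the square of |x|: in this variable nothing is
  singular at the origin, in contrast to the norm. The principal root is the right branch, since for
  \<open>0 < a\<close> and \<open>0 \<le> s\<close> the radicand avoids the cut.\<close>

definition zeta :: "real \<Rightarrow> real \<Rightarrow> real \<Rightarrow> complex" where
  "zeta a t s = csqrt (of_real s + (Complex a t)\<^sup>2)"

text \<open>Differentiation in \<open>t\<close> or \<open>s\<close> multiplies such a product by a
  rational expression in z and \<zeta>, so one derivative rule serves all exponents. The cases that
  occur are (2,0) for the solution, (2,1) for its time derivative and (3,1) for its derivative in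
  \<open>s\<close>.\<close>

definition wv :: "nat \<Rightarrow> nat \<Rightarrow> real \<Rightarrow> real \<Rightarrow> real \<Rightarrow> complex" where
  "wv m k a t s = inverse ((Complex a t + zeta a t s) ^ m * zeta a t s ^ k)"

text \<open>The principal root has nonnegative real part, and a purely imaginary root would have a
  nonpositive real square.\<close>

lemma Re_csqrt_pos:
  assumes "z \<notin> \<real>\<^sub>\<le>\<^sub>0"
  shows "0 < Re (csqrt z)"
proof (rule ccontr)
  define w where "w = csqrt z"
  assume "\<not> 0 < Re (csqrt z)"
  then have "Re w = 0"
    using csqrt_principal[of z] unfolding w_def by blast
  then have "Re (w\<^sup>2) \<le> 0" "Im (w\<^sup>2) = 0"
    by (simp_all add: Re_power2 Im_power2)
  with assms show False
    by (simp add: w_def complex_nonpos_Reals_iff)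
qed

text \<open>The imaginary part is 2at, so the radicand can be real only at t = 0, where it equals s
  + a^2 > 0.\<close>

lemma zeta_arg_not_nonpos:
  assumes "0 < a" "0 \<le> s"
  shows "of_real s + (Complex a t)\<^sup>2 \<notin> \<real>\<^sub>\<le>\<^sub>0"
proof
  assume "of_real s + (Complex a t)\<^sup>2 \<in> \<real>\<^sub>\<le>\<^sub>0"
  then have "s + (a\<^sup>2 - t\<^sup>2) \<le> 0" "2 * a * t = 0"
    by (simp_all add: complex_nonpos_Reals_iff Re_power2 Im_power2)
  with assms show False
    by (auto simp: power2_eq_square) (smt (verit) mult_pos_pos)
qed

lemma zeta_squared: "(zeta a t s)\<^sup>2 = of_real s + (Complex a t)\<^sup>2"
  by (simp add: zeta_def)

lemma Re_zeta_pos: "0 < a \<Longrightarrow> 0 \<le> s \<Longrightarrow> 0 < Re (zeta a t s)"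
  unfolding zeta_def by (intro Re_csqrt_pos zeta_arg_not_nonpos)

lemma zeta_nonzero: "0 < a \<Longrightarrow> 0 \<le> s \<Longrightarrow> zeta a t s \<noteq> 0"
  using Re_zeta_pos[of a s t] by auto

lemma add_zeta_nonzero: "0 < a \<Longrightarrow> 0 \<le> s \<Longrightarrow> Complex a t + zeta a t s \<noteq> 0"
  using Re_zeta_pos[of a s t] by (metis add_pos_pos complex.sel(1) less_irrefl plus_complex.sel(1) zero_complex.sel(1))

lemma continuous_on_zeta:
  assumes "continuous_on A T" "continuous_on A S" "\<And>z. z \<in> A \<Longrightarrow> 0 \<le> S z" "0 < a"
  shows "continuous_on A (\<lambda>z. zeta a (T z) (S z))"
  unfolding zeta_def
proof (rule continuous_on_compose2[OF continuous_on_csqrt])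
  show "continuous_on A (\<lambda>z. of_real (S z) + (Complex a (T z))\<^sup>2)"
    using assms by (auto intro!: continuous_intros simp: Complex_eq)
  show "(\<lambda>z. of_real (S z) + (Complex a (T z))\<^sup>2) ` A \<subseteq> - \<real>\<^sub>\<le>\<^sub>0"
    using zeta_arg_not_nonpos[OF assms(4)] assms(3) by auto
qed

lemma continuous_on_wv:
  assumes "continuous_on A T" "continuous_on A S" "\<And>z. z \<in> A \<Longrightarrow> 0 \<le> S z" "0 < a"
  shows "continuous_on A (\<lambda>z. wv m k a (T z) (S z))"
  unfolding wv_def
  by (intro continuous_intros continuous_on_zeta assms)
     (use assms zeta_nonzero add_zeta_nonzero in \<open>auto simp: Complex_eq intro!: continuous_intros\<close>)

section \<open>Derivatives of the family along real curves\<close>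

lemma has_vector_derivative_Complex:
  assumes "(T has_real_derivative T') (at \<sigma>)"
  shows "((\<lambda>\<sigma>. Complex a (T \<sigma>)) has_vector_derivative \<i> * of_real T') (at \<sigma>)"
proof -
  have "((\<lambda>\<sigma>. of_real (T \<sigma>) :: complex) has_vector_derivative of_real T') (at \<sigma>)"
    using assms by (intro has_vector_derivative_of_real)
  from has_vector_derivative_add[OF has_vector_derivative_const has_vector_derivative_mult_right[OF this]]
  show ?thesis by (simp add: Complex_eq)
qed

lemma has_vector_derivative_zeta:
  assumes T: "(T has_real_derivative T') (at \<sigma>)" and S: "(S has_real_derivative S') (at \<sigma>)"
    and "0 < a" "0 \<le> S \<sigma>"
  shows "((\<lambda>\<sigma>. zeta a (T \<sigma>) (S \<sigma>)) has_vector_derivative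
      (of_real S' + 2 * \<i> * of_real T' * Complex a (T \<sigma>)) / (2 * zeta a (T \<sigma>) (S \<sigma>))) (at \<sigma>)"
proof -
  let ?f = "\<lambda>\<sigma>. of_real (S \<sigma>) + (Complex a (T \<sigma>))\<^sup>2"
  note dz = has_vector_derivative_Complex[OF T, of a]
  have "((\<lambda>\<sigma>. of_real (S \<sigma>) :: complex) has_vector_derivative of_real S') (at \<sigma>)"
    using S by (intro has_vector_derivative_of_real)
  from has_vector_derivative_add[OF this has_vector_derivative_mult[OF dz dz]]
  have "(?f has_vector_derivative of_real S' +
      (Complex a (T \<sigma>) * (\<i> * of_real T') + \<i> * of_real T' * Complex a (T \<sigma>))) (at \<sigma>)"
    unfolding power2_eq_square .
  moreover have "w * v + v * w = 2 * v * w" for v w :: complex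
    by (simp add: mult.commute)
  ultimately have "(?f has_vector_derivative of_real S' + 2 * (\<i> * of_real T') * Complex a (T \<sigma>)) (at \<sigma>)"
    by (simp only:)
  moreover have "(csqrt has_field_derivative inverse (2 * csqrt (?f \<sigma>))) (at (?f \<sigma>))"
    by (intro has_field_derivative_csqrt zeta_arg_not_nonpos assms)
  ultimately have "(csqrt \<circ> ?f has_vector_derivative
      (of_real S' + 2 * \<i> * of_real T' * Complex a (T \<sigma>)) * inverse (2 * csqrt (?f \<sigma>))) (at \<sigma>)"
    unfolding mult.assoc[of 2 \<i>] by (rule field_vector_diff_chain_at)
  then show ?thesis
    unfolding zeta_def o_def divide_inverse .
qed

text \<open>\<open>d1\<close> and \<open>d2\<close> are the logarithmic derivatives of \<open>z + \<zeta>\<close> and \<open>\<zeta>\<close> along the curve.\<close>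

lemma has_vector_derivative_wv:
  assumes T: "(T has_real_derivative T') (at \<sigma>)" and S: "(S has_real_derivative S') (at \<sigma>)"
    and "0 < a" "0 \<le> S \<sigma>"
  defines "z \<equiv> Complex a (T \<sigma>)" and "\<zeta> \<equiv> zeta a (T \<sigma>) (S \<sigma>)"
  assumes d2: "of_real S' + 2 * \<i> * of_real T' * z = 2 * \<zeta>\<^sup>2 * d2"
    and d1: "\<i> * of_real T' + d2 * \<zeta> = d1 * (z + \<zeta>)"
  shows "((\<lambda>\<sigma>. wv m k a (T \<sigma>) (S \<sigma>)) has_vector_derivative
      - (of_nat m * d1 + of_nat k * d2) * wv m k a (T \<sigma>) (S \<sigma>)) (at \<sigma>)"
proof -
  define Z where "Z \<sigma> = zeta a (T \<sigma>) (S \<sigma>)" for \<sigma>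
  define p where "p \<sigma> = Complex a (T \<sigma>) + Z \<sigma>" for \<sigma>
  have \<zeta>: "\<zeta> = Z \<sigma>" and z: "z + Z \<sigma> = p \<sigma>"
    by (simp_all add: \<zeta>_def Z_def p_def z_def)
  have nz: "Z \<sigma> \<noteq> 0" "p \<sigma> \<noteq> 0"
    unfolding Z_def p_def by (intro zeta_nonzero add_zeta_nonzero assms)+
  have "(of_real S' + 2 * \<i> * of_real T' * z) / (2 * Z \<sigma>) = d2 * Z \<sigma>"
    unfolding d2 \<zeta> using nz by (simp add: power2_eq_square)
  then have dZ: "(Z has_vector_derivative d2 * Z \<sigma>) (at \<sigma>)"
    using has_vector_derivative_zeta[OF T S assms(3,4)] by (simp add: Z_def[abs_def] z_def)
  have dp: "(p has_vector_derivative d1 * p \<sigma>) (at \<sigma>)"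
    using has_vector_derivative_add[OF has_vector_derivative_Complex[OF T, of a] dZ]
    unfolding d1[unfolded \<zeta> z] p_def[symmetric] .
  have pow: "((\<lambda>\<sigma>. f \<sigma> ^ j) has_vector_derivative (of_nat j * d) * f \<sigma> ^ j) (at \<sigma>)"
    if "(f has_vector_derivative d * f \<sigma>) (at \<sigma>)" "f \<sigma> \<noteq> 0" for f :: "real \<Rightarrow> complex" and d j
  proof -
    have "((\<lambda>w. w ^ j) has_field_derivative of_nat j * f \<sigma> ^ j / f \<sigma>) (at (f \<sigma>))"
      using DERIV_power[OF DERIV_ident, of j "f \<sigma>" UNIV] that(2) by (cases j) simp_all
    from field_vector_diff_chain_at[OF that(1) this] show ?thesis
      using that(2) by (simp add: o_def mult_ac)
  qed
  define P where "P = p \<sigma> ^ m * Z \<sigma> ^ k"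
  have P: "P \<noteq> 0"
    using nz by (simp add: P_def)
  have "p \<sigma> ^ m * (of_nat k * d2 * Z \<sigma> ^ k) + of_nat m * d1 * p \<sigma> ^ m * Z \<sigma> ^ k
      = (of_nat m * d1 + of_nat k * d2) * P"
    by (simp add: P_def algebra_simps)
  with has_vector_derivative_mult[OF pow[OF dp nz(2)] pow[OF dZ nz(1)], of m k]
  have "((\<lambda>\<sigma>. p \<sigma> ^ m * Z \<sigma> ^ k) has_vector_derivative (of_nat m * d1 + of_nat k * d2) * P) (at \<sigma>)"
    by (simp only:)
  moreover have "(inverse has_field_derivative - (inverse P * inverse P)) (at (p \<sigma> ^ m * Z \<sigma> ^ k))"
    using DERIV_inverse[OF P] by (simp only: P_def power2_eq_square numeral_2_eq_2 power_Suc power_0 mult_1_right)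
  ultimately have "(inverse \<circ> (\<lambda>\<sigma>. p \<sigma> ^ m * Z \<sigma> ^ k) has_vector_derivative
      (of_nat m * d1 + of_nat k * d2) * P * - (inverse P * inverse P)) (at \<sigma>)"
    by (rule field_vector_diff_chain_at)
  moreover have "E * P * - (inverse P * inverse P) = - E * inverse P" for E
    using P by (simp add: field_simps)
  ultimately have "(inverse \<circ> (\<lambda>\<sigma>. p \<sigma> ^ m * Z \<sigma> ^ k) has_vector_derivative
      - (of_nat m * d1 + of_nat k * d2) * inverse P) (at \<sigma>)"
    by (simp only:)
  then show ?thesis
    unfolding wv_def o_def P_def p_def Z_def .
qed

lemma has_real_derivative_Re:
  "(f has_vector_derivative D) (at x) \<Longrightarrow> ((\<lambda>\<sigma>. Re (f \<sigma>)) has_real_derivative Re D) (at x)"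
  by (simp add: has_real_derivative_iff_has_vector_derivative has_vector_derivative_complex_iff)

lemma has_real_derivative_Im:
  "(f has_vector_derivative D) (at x) \<Longrightarrow> ((\<lambda>\<sigma>. Im (f \<sigma>)) has_real_derivative Im D) (at x)"
  by (simp add: has_real_derivative_iff_has_vector_derivative has_vector_derivative_complex_iff)

lemma wv_Suc: "zeta a t s \<noteq> 0 \<Longrightarrow> wv m k a t s / zeta a t s = wv m (Suc k) a t s"
  by (simp add: wv_def divide_inverse mult_ac)

lemma wv_Suc': "wv m k a t s / (Complex a t + zeta a t s) = wv (Suc m) k a t s"
  by (simp add: wv_def divide_inverse mult_ac)

text \<open>Here dz/dt = \<i> and d\<zeta>/dt = \<i>z/\<zeta>, so z + \<zeta> has the simple
  logarithmic derivative \<i>/\<zeta>. The factor \<i> exchanges real and imaginary parts at each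
  differentiation.\<close>

lemma wv_t_derivative:
  assumes "0 < a" "0 \<le> s"
  shows "((\<lambda>t. Re (wv 2 0 a t s)) has_real_derivative 2 * Im (wv 2 1 a t s)) (at t)"
    and "((\<lambda>t. 2 * Im (wv 2 1 a t s)) has_real_derivative
       - 2 * Re ((2 / zeta a t s + Complex a t / (zeta a t s)\<^sup>2) * wv 2 1 a t s)) (at t)"
proof -
  let ?z = "Complex a t" and ?\<zeta> = "zeta a t s"
  have nz: "?\<zeta> \<noteq> 0"
    by (intro zeta_nonzero assms)
  have D: "((\<lambda>t. wv m k a t s) has_vector_derivative
      - (of_nat m * (\<i> / ?\<zeta>) + of_nat k * (\<i> * ?z / ?\<zeta>\<^sup>2)) * wv m k a t s) (at t)" for m k
  proof (rule has_vector_derivative_wv[where T="\<lambda>t. t" and S="\<lambda>_. s" and T'=1 and S'=0])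
    show "\<i> * of_real 1 + \<i> * ?z / ?\<zeta>\<^sup>2 * ?\<zeta> = \<i> / ?\<zeta> * (?z + ?\<zeta>)"
      using nz by (simp add: field_simps power2_eq_square)
  qed (use assms nz in auto)
  have w: "wv 2 1 a t s = wv 2 0 a t s / ?\<zeta>"
    using wv_Suc[OF nz, of 2 0] by simp
  have "- (of_nat 2 * (\<i> / ?\<zeta>) + of_nat 0 * (\<i> * ?z / ?\<zeta>\<^sup>2)) * wv 2 0 a t s = - 2 * \<i> * wv 2 1 a t s"
    unfolding w by simp
  from has_real_derivative_Re[OF D[of 2 0, unfolded this]]
  show "((\<lambda>t. Re (wv 2 0 a t s)) has_real_derivative 2 * Im (wv 2 1 a t s)) (at t)"
    by simp
  have "- (of_nat 2 * (\<i> / ?\<zeta>) + of_nat 1 * (\<i> * ?z / ?\<zeta>\<^sup>2)) * wv 2 1 a t s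
    = - \<i> * ((2 / ?\<zeta> + ?z / ?\<zeta>\<^sup>2) * wv 2 1 a t s)"
    by (simp add: algebra_simps)
  from DERIV_cmult[OF has_real_derivative_Im[OF D[of 2 1, unfolded this]], of 2]
  show "((\<lambda>t. 2 * Im (wv 2 1 a t s)) has_real_derivative
       - 2 * Re ((2 / ?\<zeta> + ?z / ?\<zeta>\<^sup>2) * wv 2 1 a t s)) (at t)"
    by simp
qed

text \<open>Now z is fixed and d\<zeta>/ds = 1/(2\<zeta>), which gives z + \<zeta> the logarithmic
  derivative 1/(2(z + \<zeta>)\<zeta>) in \<open>s\<close>.\<close>

lemma wv_s_derivative:
  assumes "0 < a" "0 \<le> S \<sigma>" "(S has_real_derivative S') (at \<sigma>)"
  shows "((\<lambda>\<sigma>. Re (wv 2 0 a t (S \<sigma>))) has_real_derivative - S' * Re (wv 3 1 a t (S \<sigma>))) (at \<sigma>)"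
    and "((\<lambda>\<sigma>. Re (wv 3 1 a t (S \<sigma>))) has_real_derivative
       - S' / 2 * Re ((3 / ((Complex a t + zeta a t (S \<sigma>)) * zeta a t (S \<sigma>)) + 1 / (zeta a t (S \<sigma>))\<^sup>2)
         * wv 3 1 a t (S \<sigma>))) (at \<sigma>)"
proof -
  let ?z = "Complex a t" and ?\<zeta> = "zeta a t (S \<sigma>)"
  define q where "q = ?z + ?\<zeta>"
  have nz: "?\<zeta> \<noteq> 0" "q \<noteq> 0"
    unfolding q_def by (intro zeta_nonzero add_zeta_nonzero assms)+
  have D: "((\<lambda>\<sigma>. wv m k a t (S \<sigma>)) has_vector_derivative
      - (of_nat m * (of_real S' / (2 * q * ?\<zeta>)) + of_nat k * (of_real S' / (2 * ?\<zeta>\<^sup>2))) * wv m k a t (S \<sigma>)) (at \<sigma>)" for m k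
  proof (rule has_vector_derivative_wv[where T="\<lambda>_. t" and S=S and T'=0 and S'=S'])
    show "\<i> * of_real 0 + of_real S' / (2 * ?\<zeta>\<^sup>2) * ?\<zeta> = of_real S' / (2 * q * ?\<zeta>) * (?z + ?\<zeta>)"
      using nz by (simp add: q_def[symmetric] power2_eq_square)
  qed (use assms nz in auto)
  have "- (of_nat 2 * (of_real S' / (2 * q * ?\<zeta>)) + of_nat 0 * (of_real S' / (2 * ?\<zeta>\<^sup>2))) * wv 2 0 a t (S \<sigma>)
    = - of_real S' * (wv 2 0 a t (S \<sigma>) / q / ?\<zeta>)"
    by simp
  also have "\<dots> = of_real (- S') * wv 3 1 a t (S \<sigma>)"
    using wv_Suc[OF nz(1), of 3 0] wv_Suc'[of 2 0 a t "S \<sigma>", folded q_def] by (simp add: numeral_3_eq_3)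
  finally have "- (of_nat 2 * (of_real S' / (2 * q * ?\<zeta>)) + of_nat 0 * (of_real S' / (2 * ?\<zeta>\<^sup>2))) * wv 2 0 a t (S \<sigma>)
    = of_real (- S') * wv 3 1 a t (S \<sigma>)" .
  from has_real_derivative_Re[OF D[of 2 0, unfolded this]]
  show "((\<lambda>\<sigma>. Re (wv 2 0 a t (S \<sigma>))) has_real_derivative - S' * Re (wv 3 1 a t (S \<sigma>))) (at \<sigma>)"
    by simp
  have "- (of_nat 3 * (of_real S' / (2 * q * ?\<zeta>)) + of_nat 1 * (of_real S' / (2 * ?\<zeta>\<^sup>2))) * wv 3 1 a t (S \<sigma>)
    = of_real (- S' / 2) * ((3 / (q * ?\<zeta>) + 1 / ?\<zeta>\<^sup>2) * wv 3 1 a t (S \<sigma>))"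
    by (simp add: algebra_simps)
  from has_real_derivative_Re[OF D[of 3 1, unfolded this]]
  show "((\<lambda>\<sigma>. Re (wv 3 1 a t (S \<sigma>))) has_real_derivative
       - S' / 2 * Re ((3 / ((?z + ?\<zeta>) * ?\<zeta>) + 1 / ?\<zeta>\<^sup>2) * wv 3 1 a t (S \<sigma>))) (at \<sigma>)"
    unfolding q_def times_complex.sel by simp
qed

text \<open>For a function f of s = |x|^2 the Laplacian on R^6 is 12 f' + 4 s f'', with 12 = 2 * 6;
  the right side is this expression for \<open>wv 2 0\<close>, the left side its second time
  derivative. With s = (z + \<zeta>)(\<zeta> - z) the claim is an identity between rational
  functions of \<zeta> and z + \<zeta>.\<close>

lemma wv_wave_equation:
  assumes "0 < a" "0 \<le> s"
  shows "- 2 * ((2 / zeta a t s + Complex a t / (zeta a t s)\<^sup>2) * wv 2 1 a t s) =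
    - 12 * wv 3 1 a t s + 2 * of_real s *
      ((3 / ((Complex a t + zeta a t s) * zeta a t s) + 1 / (zeta a t s)\<^sup>2) * wv 3 1 a t s)"
proof -
  define z \<zeta> p where "z = Complex a t" and "\<zeta> = zeta a t s" and "p = z + \<zeta>"
  have nz: "\<zeta> \<noteq> 0" "p \<noteq> 0"
    unfolding p_def z_def \<zeta>_def by (intro zeta_nonzero add_zeta_nonzero assms)+
  have s: "of_real s = p * (\<zeta> - z)"
    using zeta_squared[of a t s] by (simp add: p_def z_def \<zeta>_def power2_eq_square algebra_simps)
  have z: "z = p - \<zeta>" by (simp add: p_def)
  have w: "wv 2 1 a t s = p * wv 3 1 a t s"
    using nz unfolding wv_def z_def[symmetric] \<zeta>_def[symmetric] p_def[symmetric]
    by (simp add: power3_eq_cube power2_eq_square)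
  have "- 2 * ((2 / \<zeta> + z / \<zeta>\<^sup>2) * p) = - 12 + 2 * (p * (\<zeta> - z)) * (3 / (p * \<zeta>) + 1 / \<zeta>\<^sup>2)"
    unfolding z using nz by (simp add: divide_simps power2_eq_square) (simp add: algebra_simps)
  note eq = this
  have "- 2 * (A * (p * W)) = - 12 * W + 2 * S * (B * W)" if "- 2 * (A * p) = - 12 + 2 * S * B" for A B S W
  proof -
    have "- 2 * (A * (p * W)) = - 2 * (A * p) * W" by (simp add: mult_ac)
    also have "\<dots> = - 12 * W + 2 * S * (B * W)" unfolding that by (simp add: algebra_simps)
    finally show ?thesis .
  qed
  from this[OF eq] show ?thesis
    unfolding w s z_def[symmetric] \<zeta>_def[symmetric] p_def[symmetric] .
qed

section \<open>Decay of the explicit solutions\<close>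

lemma zeta_parts:
  "(Re (zeta a t s))\<^sup>2 - (Im (zeta a t s))\<^sup>2 = s + a\<^sup>2 - t\<^sup>2"
  "Re (zeta a t s) * Im (zeta a t s) = a * t"
proof -
  have "Re ((zeta a t s)\<^sup>2) = s + a\<^sup>2 - t\<^sup>2" "Im ((zeta a t s)\<^sup>2) = 2 * (a * t)"
    unfolding zeta_squared by (simp_all add: Re_power2 Im_power2)
  then show "(Re (zeta a t s))\<^sup>2 - (Im (zeta a t s))\<^sup>2 = s + a\<^sup>2 - t\<^sup>2"
    "Re (zeta a t s) * Im (zeta a t s) = a * t"
    by (simp_all add: Re_power2 Im_power2)
qed

text \<open>Write x = Re \<zeta> and y = |Im \<zeta>|. On and outside the light cone x^2 - y^2 = r^2
  + a^2 - t^2 is nonnegative, so y \<le> x; together with xy = a|t| this makes x^2 + y^2 comparable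
  to (x^2 - y^2) + 2xy.\<close>

lemma norm_zeta_squared:
  assumes "0 < a" "\<bar>t\<bar> \<le> r"
  shows "(cmod (zeta a t (r\<^sup>2)))\<^sup>2 \<le> r\<^sup>2 - t\<^sup>2 + a\<^sup>2 + 2 * a * \<bar>t\<bar>"
    and "r\<^sup>2 - t\<^sup>2 + a\<^sup>2 + 2 * a * \<bar>t\<bar> \<le> 2 * (cmod (zeta a t (r\<^sup>2)))\<^sup>2"
    and "cmod (zeta a t (r\<^sup>2)) \<le> 2 * Re (zeta a t (r\<^sup>2))"
proof -
  define x y where "x = Re (zeta a t (r\<^sup>2))" and "y = \<bar>Im (zeta a t (r\<^sup>2))\<bar>"
  have x: "0 < x" "0 \<le> y"
    unfolding x_def y_def using Re_zeta_pos[OF assms(1)] by auto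
  have 1: "x\<^sup>2 - y\<^sup>2 = r\<^sup>2 + a\<^sup>2 - t\<^sup>2"
    using zeta_parts(1)[of a t "r\<^sup>2"] by (simp add: x_def y_def)
  have 2: "x * y = a * \<bar>t\<bar>"
    using zeta_parts(2)[of a t "r\<^sup>2"] assms(1) x(1)
    by (metis abs_mult abs_of_pos x_def y_def)
  have n: "(cmod (zeta a t (r\<^sup>2)))\<^sup>2 = x\<^sup>2 + y\<^sup>2"
    by (simp add: cmod_power2 x_def y_def)
  have "t\<^sup>2 \<le> r\<^sup>2"
    using assms(2) by (metis abs_ge_zero power2_abs power_mono)
  then have "y\<^sup>2 \<le> x\<^sup>2"
    using 1 zero_le_power2[of a] by linarith
  then have yx: "y \<le> x" using x by (simp add: power2_le_iff_abs_le abs_le_square_iff)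
  have "y * y \<le> x * y" using yx x by (intro mult_right_mono) auto
  then show "(cmod (zeta a t (r\<^sup>2)))\<^sup>2 \<le> r\<^sup>2 - t\<^sup>2 + a\<^sup>2 + 2 * a * \<bar>t\<bar>"
    using n 1 2 by (simp add: power2_eq_square)
  have "0 \<le> (x - y)\<^sup>2" by simp
  then have "2 * (x * y) \<le> x\<^sup>2 + y\<^sup>2" by (simp add: power2_diff)
  then show "r\<^sup>2 - t\<^sup>2 + a\<^sup>2 + 2 * a * \<bar>t\<bar> \<le> 2 * (cmod (zeta a t (r\<^sup>2)))\<^sup>2"
    using n 1 2 zero_le_power2[of y] by linarith
  have "cmod (zeta a t (r\<^sup>2)) \<le> x + y"
    using cmod_le[of "zeta a t (r\<^sup>2)"] x unfolding x_def y_def by linarith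
  then show "cmod (zeta a t (r\<^sup>2)) \<le> 2 * Re (zeta a t (r\<^sup>2))"
    using yx by (simp add: x_def)
qed

text \<open>Every \<open>Re (wv 2 0 a t (r\<^sup>2))\<close> has the same non-decaying part \<open>1 / r\<^sup>2 - 2 * t\<^sup>2 / r ^ 4\<close>; \<open>rem\<close>
  is what remains, and \<open>rem_t\<close> and \<open>rem_r\<close> are its derivatives.\<close>

definition rem :: "real \<Rightarrow> real \<Rightarrow> real \<Rightarrow> real" where
  "rem a t r = (2 * a\<^sup>2 - 2 * Re (Complex a t * zeta a t (r\<^sup>2))) / r ^ 4"

definition rem_t :: "real \<Rightarrow> real \<Rightarrow> real \<Rightarrow> real" where
  "rem_t a t r = 2 * Im ((of_real (r\<^sup>2) + 2 * (Complex a t)\<^sup>2) / zeta a t (r\<^sup>2)) / r ^ 4"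

definition rem_r :: "real \<Rightarrow> real \<Rightarrow> real \<Rightarrow> real" where
  "rem_r a t r = (8 * Re (Complex a t * zeta a t (r\<^sup>2)) - 8 * a\<^sup>2) / r ^ 5
     - 2 * Re (Complex a t / zeta a t (r\<^sup>2)) / r ^ 3"

text \<open>Difference of squares: (\<zeta> + z)(\<zeta> - z) = r^2. This clears z + \<zeta> from
  the denominators and exposes the powers of 1/r.\<close>

lemma inverse_add_zeta:
  assumes "0 < a" "0 < r"
  shows "inverse (Complex a t + zeta a t (r\<^sup>2)) = (zeta a t (r\<^sup>2) - Complex a t) / of_real (r\<^sup>2)"
proof -
  have "(Complex a t + zeta a t (r\<^sup>2)) * (zeta a t (r\<^sup>2) - Complex a t) = of_real (r\<^sup>2)"
    using zeta_squared[of a t "r\<^sup>2"] by (simp add: power2_eq_square algebra_simps)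
  moreover have "Complex a t + zeta a t (r\<^sup>2) \<noteq> 0"
    by (rule add_zeta_nonzero) (use assms in auto)
  moreover have "of_real (r\<^sup>2) \<noteq> (0 :: complex)" using assms by simp
  ultimately show ?thesis
    by (metis inverse_unique nonzero_mult_div_cancel_left times_divide_eq_right right_inverse divide_self_if)
qed

lemma Re_divide_of_real': "Re (w / of_real b) = Re w / b" and Im_divide_of_real': "Im (w / of_real b) = Im w / b"
  by (simp_all add: Re_divide_of_real Im_divide_of_real)

text \<open>Expand the powers of \<zeta> - z and substitute \<zeta>^2 = r^2 + z^2 and Re(z^2) = a^2
  - t^2. The terms free of \<open>a\<close> are those of the exact solution 1/r^2 - 2t^2/r^4; all
  others go into the remainder.\<close>

lemma wv_remainder:
  assumes "0 < a" "0 < r"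
  shows "Re (wv 2 0 a t (r\<^sup>2)) = 1 / r\<^sup>2 - 2 * t\<^sup>2 / r ^ 4 + rem a t r" (is ?A)
    and "2 * Im (wv 2 1 a t (r\<^sup>2)) = - 4 * t / r ^ 4 + rem_t a t r" (is ?B)
    and "- 2 * r * Re (wv 3 1 a t (r\<^sup>2)) = - 2 / r ^ 3 + 8 * t\<^sup>2 / r ^ 5 + rem_r a t r" (is ?C)
proof -
  define z \<zeta> where "z = Complex a t" and "\<zeta> = zeta a t (r\<^sup>2)"
  have nz: "\<zeta> \<noteq> 0" unfolding \<zeta>_def by (rule zeta_nonzero) (use assms in auto)
  have sq: "\<zeta>\<^sup>2 = of_real (r\<^sup>2) + z\<^sup>2"
    unfolding \<zeta>_def z_def by (rule zeta_squared)
  have inv: "inverse (z + \<zeta>) = (\<zeta> - z) / of_real (r\<^sup>2)"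
    unfolding z_def \<zeta>_def by (rule inverse_add_zeta[OF assms])
  have Rz2: "Re (z\<^sup>2) = a\<^sup>2 - t\<^sup>2" by (simp add: z_def Re_power2)
  have r4: "1 / r\<^sup>2 = r\<^sup>2 / r ^ 4"
    using assms by (simp add: eval_nat_numeral)
  have Re_num: "Re (2 * w) = 2 * Re w" "Re (4 * w) = 4 * Re w" for w by simp_all
  have w: "wv m k a t (r\<^sup>2) = ((\<zeta> - z) ^ m / \<zeta> ^ k) / of_real (r ^ (2 * m))" for m k
  proof -
    have "wv m k a t (r\<^sup>2) = inverse (z + \<zeta>) ^ m / \<zeta> ^ k"
      by (simp add: wv_def z_def \<zeta>_def power_inverse divide_inverse)
    also have "inverse (z + \<zeta>) ^ m = (\<zeta> - z) ^ m / of_real (r ^ (2 * m))"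
      unfolding inv power_divide power_mult of_real_power ..
    finally show ?thesis by (simp add: mult.commute)
  qed
  have "(\<zeta> - z)\<^sup>2 = \<zeta>\<^sup>2 + z\<^sup>2 - 2 * (z * \<zeta>)"
    by (simp add: power2_eq_square algebra_simps)
  then have "Re ((\<zeta> - z)\<^sup>2) = r\<^sup>2 + 2 * (a\<^sup>2 - t\<^sup>2) - 2 * Re (z * \<zeta>)"
    unfolding sq using Rz2 by (simp add: Re_num del: times_complex.sel)
  then have "Re (wv 2 0 a t (r\<^sup>2)) = (r\<^sup>2 + 2 * (a\<^sup>2 - t\<^sup>2) - 2 * Re (z * \<zeta>)) / r ^ 4"
    unfolding w Re_divide_of_real' by simp
  also have "\<dots> = 1 / r\<^sup>2 - 2 * t\<^sup>2 / r ^ 4 + (2 * a\<^sup>2 - 2 * Re (z * \<zeta>)) / r ^ 4"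
    unfolding r4 by (simp add: add_divide_distrib diff_divide_distrib del: times_complex.sel)
  finally show ?A
    unfolding rem_def z_def \<zeta>_def .
  have "(\<zeta> - z)\<^sup>2 / \<zeta> ^ 1 = (of_real (r\<^sup>2) + 2 * z\<^sup>2) / \<zeta> - 2 * z"
    using nz unfolding \<open>(\<zeta> - z)\<^sup>2 = \<zeta>\<^sup>2 + z\<^sup>2 - 2 * (z * \<zeta>)\<close> sq by (simp add: field_simps)
  then have "Im ((\<zeta> - z)\<^sup>2 / \<zeta> ^ 1) = Im ((of_real (r\<^sup>2) + 2 * z\<^sup>2) / \<zeta>) - 2 * t"
    by (simp add: z_def del: Im_divide)
  then have "2 * Im (wv 2 1 a t (r\<^sup>2)) = 2 * (Im ((of_real (r\<^sup>2) + 2 * z\<^sup>2) / \<zeta>) - 2 * t) / r ^ 4"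
    unfolding w Im_divide_of_real' by simp
  then show ?B
    using assms unfolding rem_t_def z_def[symmetric] \<zeta>_def[symmetric]
    by (simp add: field_simps del: Im_divide)
  have r2: "of_real (r\<^sup>2) = \<zeta>\<^sup>2 - z\<^sup>2" by (simp add: sq)
  have "(\<zeta> - z) ^ 3 / \<zeta> ^ 1 = of_real (r\<^sup>2) + 4 * z\<^sup>2 - 4 * (z * \<zeta>) + of_real (r\<^sup>2) * (z / \<zeta>)"
    using nz unfolding r2 by (simp add: field_simps power2_eq_square power3_eq_cube)
  then have "Re ((\<zeta> - z) ^ 3 / \<zeta> ^ 1) = r\<^sup>2 + 4 * (a\<^sup>2 - t\<^sup>2) - 4 * Re (z * \<zeta>) + r\<^sup>2 * Re (z / \<zeta>)"
    using Rz2 by (simp only: plus_complex.sel minus_complex.sel Re_complex_of_real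
        times_complex.sel(1)[of "of_real _"] Im_complex_of_real mult_zero_left diff_zero)
       (simp add: Re_num del: times_complex.sel Re_divide)
  then have "- 2 * r * Re (wv 3 1 a t (r\<^sup>2)) =
      - 2 * r * (r\<^sup>2 + 4 * (a\<^sup>2 - t\<^sup>2) - 4 * Re (z * \<zeta>) + r\<^sup>2 * Re (z / \<zeta>)) / r ^ 6"
    unfolding w Re_divide_of_real' by simp
  also have "\<dots> = - 2 / r ^ 3 + 8 * t\<^sup>2 / r ^ 5 +
      ((8 * Re (z * \<zeta>) - 8 * a\<^sup>2) / r ^ 5 - 2 * Re (z / \<zeta>) / r ^ 3)"
  proof -
    have "- 2 * r * (r\<^sup>2 + 4 * (a\<^sup>2 - t\<^sup>2) - 4 * R + r\<^sup>2 * S) / r ^ 6 =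
      - 2 / r ^ 3 + 8 * t\<^sup>2 / r ^ 5 + ((8 * R - 8 * a\<^sup>2) / r ^ 5 - 2 * S / r ^ 3)" for R S
      using assms by (simp add: field_simps eval_nat_numeral)
    then show ?thesis .
  qed
  finally show ?C
    unfolding rem_r_def z_def \<zeta>_def .
qed

section \<open>Bounds for the remainder and its derivatives\<close>

text \<open>The parameter \<open>l\<close> is any length comparable to |\<zeta>|, so that one
  computation covers bounded times (\<open>l\<close> = r) and the exterior of the light cone
  (\<open>l\<close> a geometric mean). The point is the factor \<open>a\<close> in every
  bound.\<close>

lemma rem_bounds:
  assumes a: "0 < a" "a \<le> r" and t: "\<bar>t\<bar> \<le> r" and l: "0 < l" "l \<le> r"
    and \<zeta>: "l / 2 \<le> cmod (zeta a t (r\<^sup>2))" "cmod (zeta a t (r\<^sup>2)) \<le> 2 * l"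
  shows "\<bar>rem_t a t r\<bar> \<le> 160 * a / (l ^ 3 * r)" (is ?A)
    and "\<bar>rem_r a t r\<bar> \<le> 160 * a / (l ^ 3 * r)" (is ?B)
    and "\<bar>rem a t r\<bar> \<le> 14 * a / (l * r\<^sup>2)" (is ?C)
proof -
  define N X Y where "N = cmod (zeta a t (r\<^sup>2))" and "X = Re (zeta a t (r\<^sup>2))" and "Y = Im (zeta a t (r\<^sup>2))"
  have r: "0 < r" using a by simp
  have N: "l / 2 \<le> N" "N \<le> 2 * l" "0 < N" using \<zeta> l by (auto simp: N_def)
  have X: "0 < X" "N \<le> 2 * X" "\<bar>X\<bar> \<le> 2 * l"
    using Re_zeta_pos[OF a(1), of "r\<^sup>2" t] norm_zeta_squared(3)[OF a(1) t] abs_Re_le_cmod[of "zeta a t (r\<^sup>2)"] \<zeta>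
    by (auto simp: X_def N_def)
  have XY: "X * Y = a * t" unfolding X_def Y_def by (rule zeta_parts(2))
  \<comment> \<open>Re \<zeta> is at least l/4 and Re \<zeta> times Im \<zeta> is at, so the
    imaginary part is small with a factor \<open>a\<close>; this is how terms without an explicit
    \<open>a\<close> acquire one.\<close>
  have Y: "\<bar>Y\<bar> \<le> 4 * a * r / l"
  proof -
    have "l / 4 * \<bar>Y\<bar> \<le> X * \<bar>Y\<bar>" using X N by (intro mult_right_mono) auto
    also have "\<dots> = a * \<bar>t\<bar>" using XY X(1) a(1) by (metis abs_mult abs_of_pos)
    also have "\<dots> \<le> a * r" using t a by simp
    finally show ?thesis using l by (simp add: field_simps)
  qed
  have ll: "l\<^sup>2 \<le> r\<^sup>2" using l by (intro power_mono) auto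
  have lr: "l \<le> r\<^sup>2 / l" using ll l by (simp add: field_simps power2_eq_square)
  have tt: "t\<^sup>2 \<le> r\<^sup>2" using power_mono[OF t, of 2] by simp
  have aa: "a\<^sup>2 \<le> r\<^sup>2" using a by (intro power_mono) auto
  have N2: "l\<^sup>2 / 4 \<le> N\<^sup>2" using power_mono[OF N(1), of 2] l by (simp add: power_divide)
  \<comment> \<open>One bound for both z\<zeta> and z/\<zeta>, whose real parts are aX - tY and (aX
    + tY)/N^2.\<close>
  have cmp: "\<bar>a * X\<bar> + \<bar>t * Y\<bar> \<le> 6 * (a * r\<^sup>2 / l)"
  proof -
    have "\<bar>a * X\<bar> \<le> a * (2 * (r\<^sup>2 / l))"
      unfolding abs_mult using a X(3) lr by (intro mult_mono) auto
    moreover have "\<bar>t * Y\<bar> \<le> r * (4 * a * r / l)"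
      unfolding abs_mult using t Y r by (intro mult_mono) auto
    moreover have "a * (2 * (r\<^sup>2 / l)) + r * (4 * a * r / l) = 6 * (a * r\<^sup>2 / l)"
      by (simp add: power2_eq_square)
    ultimately show ?thesis by linarith
  qed
  have quot: "B / N\<^sup>2 \<le> 4 * B / l\<^sup>2" if "0 \<le> B" for B
  proof -
    have "B / N\<^sup>2 \<le> B / (l\<^sup>2 / 4)"
      using N2 l that by (intro divide_left_mono mult_pos_pos) auto
    then show ?thesis by (simp add: mult.commute)
  qed
  have l3r: "1 / (l * r ^ 3) \<le> 1 / (l ^ 3 * r)" "1 / r ^ 4 \<le> 1 / (l ^ 3 * r)"
  proof -
    have "l ^ 3 * r = l * (l\<^sup>2 * r)" "l * r ^ 3 = l * (r\<^sup>2 * r)" "r ^ 4 = r ^ 3 * r"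
      by (simp_all add: eval_nat_numeral)
    moreover have "l ^ 3 \<le> r ^ 3" using l by (intro power_mono) auto
    ultimately show "1 / (l * r ^ 3) \<le> 1 / (l ^ 3 * r)" "1 / r ^ 4 \<le> 1 / (l ^ 3 * r)"
      using l r ll by (auto intro!: divide_left_mono mult_left_mono mult_right_mono)
  qed

  have z\<zeta>: "\<bar>Re (Complex a t * zeta a t (r\<^sup>2))\<bar> \<le> 6 * (a * r\<^sup>2 / l)"
  proof -
    have "Re (Complex a t * zeta a t (r\<^sup>2)) = a * X - t * Y" by (simp add: X_def Y_def)
    then show ?thesis using cmp by linarith
  qed
  have "\<bar>Re (Complex a t / zeta a t (r\<^sup>2))\<bar> \<le> 6 * (a * r\<^sup>2 / l) / N\<^sup>2"
  proof -
    have "Re (Complex a t / zeta a t (r\<^sup>2)) = (a * X + t * Y) / N\<^sup>2"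
      by (simp add: X_def Y_def N_def Re_divide cmod_power2)
    moreover have "\<bar>a * X + t * Y\<bar> \<le> 6 * (a * r\<^sup>2 / l)" using cmp by linarith
    ultimately show ?thesis
      using divide_right_mono[of "\<bar>a * X + t * Y\<bar>" _ "N\<^sup>2"] by (simp only: abs_divide abs_power2 zero_le_power2)
  qed
  also have "\<dots> \<le> 4 * (6 * (a * r\<^sup>2 / l)) / l\<^sup>2"
    using a l by (intro quot) simp
  finally have zd: "\<bar>Re (Complex a t / zeta a t (r\<^sup>2))\<bar> \<le> 24 * (a * r\<^sup>2 / l ^ 3)"
    by (simp add: power2_eq_square power3_eq_cube)
  let ?u = "of_real (r\<^sup>2) + 2 * (Complex a t)\<^sup>2"
  have u: "Re ?u = r\<^sup>2 + 2 * (a\<^sup>2 - t\<^sup>2)" "Im ?u = 4 * (a * t)"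
    by (simp_all add: Re_power2 Im_power2)
  have "\<bar>Im (?u / zeta a t (r\<^sup>2))\<bar> \<le> (20 * (a * r ^ 3 / l)) / N\<^sup>2"
  proof -
    have "Im (?u / zeta a t (r\<^sup>2)) = (Im ?u * X - Re ?u * Y) / N\<^sup>2"
      by (simp add: X_def Y_def N_def Im_divide cmod_power2)
    moreover have "\<bar>Im ?u * X\<bar> \<le> (4 * (a * r)) * (2 * (r\<^sup>2 / l))"
      unfolding abs_mult u using a X(3) lr t by (intro mult_mono) auto
    moreover have "\<bar>Re ?u * Y\<bar> \<le> (3 * r\<^sup>2) * (4 * a * r / l)"
    proof -
      have "\<bar>r\<^sup>2 + 2 * (a\<^sup>2 - t\<^sup>2)\<bar> \<le> 3 * r\<^sup>2"
      proof -
        have "\<bar>R + 2 * (A - B)\<bar> \<le> 3 * R" if "0 \<le> A" "0 \<le> B" "A \<le> R" "B \<le> R" for R A B :: real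
          using that by (simp add: abs_le_iff)
        from this[OF _ _ aa tt] show ?thesis by simp
      qed
      then show ?thesis
        unfolding abs_mult u using Y by (intro mult_mono) auto
    qed
    moreover have "(4 * (a * r)) * (2 * (r\<^sup>2 / l)) + (3 * r\<^sup>2) * (4 * a * r / l) = 20 * (a * r ^ 3 / l)"
      by (simp add: power2_eq_square power3_eq_cube)
    ultimately have "\<bar>Im ?u * X - Re ?u * Y\<bar> \<le> 20 * (a * r ^ 3 / l)" by linarith
    then show ?thesis
      unfolding \<open>Im (?u / zeta a t (r\<^sup>2)) = (Im ?u * X - Re ?u * Y) / N\<^sup>2\<close> abs_divide
      using divide_right_mono[of "\<bar>Im ?u * X - Re ?u * Y\<bar>" _ "N\<^sup>2"] by (simp only: abs_power2 zero_le_power2)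
  qed
  also have "\<dots> \<le> 4 * (20 * (a * r ^ 3 / l)) / l\<^sup>2"
    using a l r by (intro quot) simp
  finally have ud: "\<bar>Im (?u / zeta a t (r\<^sup>2))\<bar> \<le> 80 * (a * r ^ 3 / l ^ 3)"
    by (simp add: power2_eq_square power3_eq_cube)

  have "\<bar>rem_t a t r\<bar> = 2 * \<bar>Im (?u / zeta a t (r\<^sup>2))\<bar> / r ^ 4"
    using r by (simp add: rem_t_def abs_mult abs_divide del: Im_divide)
  also have "\<dots> \<le> 2 * (80 * (a * r ^ 3 / l ^ 3)) / r ^ 4"
    using ud r by (intro divide_right_mono mult_left_mono) auto
  also have "\<dots> = 160 * a / (l ^ 3 * r)"
    using r by (simp add: eval_nat_numeral)
  finally show ?A .

  have a2: "a\<^sup>2 \<le> a * r" using a by (simp add: power2_eq_square)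
  have "\<bar>8 * Re (Complex a t * zeta a t (r\<^sup>2)) - 8 * a\<^sup>2\<bar> \<le> 48 * (a * r\<^sup>2 / l) + 8 * (a * r)"
    using z\<zeta> a2 zero_le_power2[of a] by linarith
  moreover have "\<bar>rem_r a t r\<bar> \<le> \<bar>8 * Re (Complex a t * zeta a t (r\<^sup>2)) - 8 * a\<^sup>2\<bar> / r ^ 5
      + 2 * \<bar>Re (Complex a t / zeta a t (r\<^sup>2))\<bar> / r ^ 3"
    using r abs_triangle_ineq4[of "(8 * Re (Complex a t * zeta a t (r\<^sup>2)) - 8 * a\<^sup>2) / r ^ 5"
        "2 * Re (Complex a t / zeta a t (r\<^sup>2)) / r ^ 3"]
    by (simp add: rem_r_def abs_mult abs_divide del: times_complex.sel Re_divide)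
  ultimately have "\<bar>rem_r a t r\<bar> \<le> (48 * (a * r\<^sup>2 / l) + 8 * (a * r)) / r ^ 5 + 2 * (24 * (a * r\<^sup>2 / l ^ 3)) / r ^ 3"
    using zd r by (elim order_trans) (intro add_mono divide_right_mono mult_left_mono, auto)
  also have "\<dots> = 48 * a * (1 / (l * r ^ 3)) + 8 * a * (1 / r ^ 4) + 48 * (a / (l ^ 3 * r))"
    using r by (simp add: add_divide_distrib eval_nat_numeral)
  also have "\<dots> \<le> 48 * a * (1 / (l ^ 3 * r)) + 8 * a * (1 / (l ^ 3 * r)) + 48 * (a / (l ^ 3 * r))"
    using l3r a by (intro add_mono mult_left_mono) auto
  also have "\<dots> = 104 * (a / (l ^ 3 * r))" by simp
  also have "\<dots> \<le> 160 * (a / (l ^ 3 * r))"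
    using a l r by (intro mult_right_mono) auto
  also have "\<dots> = 160 * a / (l ^ 3 * r)" by simp
  finally show ?B .

  have "a * r \<le> a * (r\<^sup>2 / l)"
    using a l r by (intro mult_left_mono) (simp_all add: field_simps power2_eq_square)
  then have "\<bar>2 * a\<^sup>2 - 2 * Re (Complex a t * zeta a t (r\<^sup>2))\<bar> \<le> 14 * (a * r\<^sup>2 / l)"
    using z\<zeta> a2 zero_le_power2[of a] by (simp only: times_divide_eq_right)
  then have "\<bar>rem a t r\<bar> \<le> 14 * (a * r\<^sup>2 / l) / r ^ 4"
    using divide_right_mono[of "\<bar>2 * a\<^sup>2 - 2 * Re (Complex a t * zeta a t (r\<^sup>2))\<bar>" _ "r ^ 4"] r
    unfolding rem_def abs_divide by (simp only: power_abs abs_of_pos zero_le_power less_imp_le)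
  also have "\<dots> = 14 * a / (l * r\<^sup>2)"
    using r by (simp add: eval_nat_numeral)
  finally show ?C .
qed

text \<open>Far outside the cone |\<zeta>| is comparable to r, so \<open>l\<close> = r. The
  resulting orders 4, 4 and 3 are those required of finite-energy solutions.\<close>

lemma rem_bounds_bounded_time:
  assumes "0 < a" "\<bar>t\<bar> \<le> T" "2 * (T + a) \<le> r"
  shows "\<bar>rem_t a t r\<bar> \<le> 160 * a / r ^ 4" "\<bar>rem_r a t r\<bar> \<le> 160 * a / r ^ 4" "\<bar>rem a t r\<bar> \<le> 14 * a / r ^ 3"
proof -
  have r: "0 < r" "a \<le> r" "\<bar>t\<bar> \<le> r" "\<bar>t\<bar> \<le> r / 2" "a \<le> r / 2"
    using assms by auto
  have t2: "t\<^sup>2 \<le> r\<^sup>2 / 4" using power_mono[OF r(4), of 2] by (simp add: power_divide)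
  have a2: "a\<^sup>2 \<le> r\<^sup>2 / 4" using power_mono[OF r(5), of 2] assms(1) by (simp add: power_divide)
  have at: "a * \<bar>t\<bar> \<le> r / 2 * (r / 2)" using r assms(1) by (intro mult_mono) auto
  have at0: "0 \<le> a * \<bar>t\<bar>" using assms(1) by simp
  note n = norm_zeta_squared[OF assms(1) r(3)]
  have "(r / 2)\<^sup>2 \<le> (cmod (zeta a t (r\<^sup>2)))\<^sup>2"
  proof -
    have "R / 4 \<le> M" if "R - B + A + D \<le> 2 * M" "B \<le> R / 4" "0 \<le> A" "0 \<le> D" "0 \<le> R" for R A B D M :: real
      using that by linarith
    from this[OF n(2) t2] at0 show ?thesis by (simp add: power_divide)
  qed
  then have 1: "r / 2 \<le> cmod (zeta a t (r\<^sup>2))"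
    by (rule power2_le_imp_le) simp
  have "(cmod (zeta a t (r\<^sup>2)))\<^sup>2 \<le> (2 * r)\<^sup>2"
  proof -
    have "M \<le> 4 * R" if "M \<le> R - B + A + D" "0 \<le> B" "0 \<le> R" "A \<le> R / 4" "D \<le> R / 2" for R B A D M :: real
      using that by linarith
    from this[OF n(1) _ _ a2] at show ?thesis by (simp add: power2_eq_square)
  qed
  then have 2: "cmod (zeta a t (r\<^sup>2)) \<le> 2 * r"
    by (rule power2_le_imp_le) (use r in simp)
  from rem_bounds[OF assms(1) r(2,3,1) order_refl 1 2]
  show "\<bar>rem_t a t r\<bar> \<le> 160 * a / r ^ 4" "\<bar>rem_r a t r\<bar> \<le> 160 * a / r ^ 4" "\<bar>rem a t r\<bar> \<le> 14 * a / r ^ 3"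
    by (simp_all add: eval_nat_numeral mult_ac)
qed

text \<open>Take \<open>l\<close> as the geometric mean of \<eta> + a and r. Then l^3 r = (\<eta> +
  a)^(3/2) r^(5/2), and r^(5/2) is the square root of the weight r^5 of polar coordinates.\<close>

lemma rem_bounds_exterior:
  assumes "0 < a" "a \<le> t" "0 \<le> \<eta>"
  defines "r \<equiv> t + \<eta>"
  shows "\<bar>rem_t a t r\<bar> \<le> 160 * (a / ((\<eta> + a) * sqrt (\<eta> + a))) / (r\<^sup>2 * sqrt r)" (is ?A)
    and "\<bar>rem_r a t r\<bar> \<le> 160 * (a / ((\<eta> + a) * sqrt (\<eta> + a))) / (r\<^sup>2 * sqrt r)" (is ?B)
proof -
  have r: "0 < r" "a \<le> r" "\<bar>t\<bar> \<le> r" "\<eta> + a \<le> r" using assms by (auto simp: r_def)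
  define l where "l = sqrt ((\<eta> + a) * r)"
  have pos: "0 < (\<eta> + a) * r" using assms r by simp
  have l2: "l\<^sup>2 = (\<eta> + a) * r" using pos by (simp add: l_def)
  have l: "0 < l" using pos by (simp add: l_def)
  have "l\<^sup>2 \<le> r\<^sup>2" unfolding l2 power2_eq_square using r assms(1,3) l2 by (simp add: power2_eq_square)
  then have lr: "l \<le> r" by (rule power2_le_imp_le) (use r in simp)
  \<comment> \<open>With r^2 - t^2 = \<eta>(r + t), both this sum and (\<eta> + a) r = \<eta>r + at
    + a\<eta> consist of terms that a \<le> t \<le> r makes comparable.\<close>
  have key: "r\<^sup>2 - t\<^sup>2 + a\<^sup>2 + 2 * a * \<bar>t\<bar> = \<eta> * r + \<eta> * t + a * a + 2 * (a * t)"
    using assms by (simp add: r_def power2_eq_square algebra_simps)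
  have k1: "a * \<eta> \<le> t * \<eta>" "0 \<le> a * t" "0 \<le> a * a" "a * a \<le> a * t" "t * \<eta> \<le> r * \<eta>"
    using assms by (auto intro!: mult_right_mono mult_left_mono)
  have k2: "(\<eta> + a) * r = \<eta> * r + a * t + a * \<eta>" by (simp add: r_def algebra_simps)
  note n = norm_zeta_squared[OF assms(1) r(3)]
  have "(l / 2)\<^sup>2 \<le> (cmod (zeta a t (r\<^sup>2)))\<^sup>2"
  proof -
    have "k / 4 \<le> M" if "k \<le> 2 * M" "0 < k" for k M :: real
      using that by linarith
    moreover have "(\<eta> + a) * r \<le> 2 * (cmod (zeta a t (r\<^sup>2)))\<^sup>2"
    proof -
      have "u + v + w \<le> M" if "u + w' + b + 2 * v \<le> M" "w \<le> w'" "0 \<le> v" "0 \<le> b" for u v w w' b M :: real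
        using that by linarith
      from this[OF n(2)[unfolded key] _ k1(2,3), of "a * \<eta>"] k1(1) show ?thesis
        unfolding k2 by (simp add: mult.commute)
    qed
    ultimately show ?thesis
      using pos unfolding power_divide l2 by simp
  qed
  then have 1: "l / 2 \<le> cmod (zeta a t (r\<^sup>2))"
    by (rule power2_le_imp_le) simp
  have "(cmod (zeta a t (r\<^sup>2)))\<^sup>2 \<le> (2 * l)\<^sup>2"
  proof -
    have "M \<le> 4 * (u + v + w)" if "M \<le> u + w' + b + 2 * v" "w' \<le> u" "b \<le> v" "0 \<le> u" "0 \<le> v" "0 \<le> w"
      for u v w w' b M :: real
      using that by simp
    from this[OF n(1)[unfolded key] _ k1(4) _ k1(2), of "a * \<eta>"] k1(5) show ?thesis
      unfolding power_mult_distrib l2 k2 using assms(1,3) r(1) by (simp add: mult.commute)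
  qed
  then have 2: "cmod (zeta a t (r\<^sup>2)) \<le> 2 * l"
    by (rule power2_le_imp_le) (use l in simp)
  have "l ^ 3 * r = ((\<eta> + a) * sqrt (\<eta> + a)) * (r\<^sup>2 * sqrt r)"
  proof -
    have "l ^ 3 * r = l\<^sup>2 * l * r" by (simp add: eval_nat_numeral)
    then show ?thesis unfolding l2 by (simp add: l_def real_sqrt_mult power2_eq_square mult_ac)
  qed
  then show ?A ?B
    using rem_bounds(1,2)[OF assms(1) r(2,3) l lr 1 2] by simp_all
qed

section \<open>Superpositions\<close>

text \<open>The zero sum cancels the part shared by all scales, whose r^(-2) tail violates the
  finite-energy requirements.\<close>

locale superposition =
  fixes n :: nat and c a :: "nat \<Rightarrow> real"
  assumes a_pos: "j < n \<Longrightarrow> 0 < a j"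
    and c_sum: "(\<Sum>j<n. c j) = 0"
begin

definition v :: "real \<Rightarrow> R6 \<Rightarrow> real" where
  "v t x = (\<Sum>j<n. c j * Re (wv 2 0 (a j) t ((norm x)\<^sup>2)))"

definition v_t :: "real \<Rightarrow> R6 \<Rightarrow> real" where
  "v_t t x = (\<Sum>j<n. c j * (2 * Im (wv 2 1 (a j) t ((norm x)\<^sup>2))))"

text \<open>Twice the derivative in s = |x|^2: the factor 2 of the chain rule is absorbed, so that
  the gradient is \<open>v_s\<close> times x.\<close>

definition v_s :: "real \<Rightarrow> R6 \<Rightarrow> real" where
  "v_s t x = (\<Sum>j<n. c j * (- 2 * Re (wv 3 1 (a j) t ((norm x)\<^sup>2))))"

definition Dv :: "real \<Rightarrow> R6 \<Rightarrow> R6" where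
  "Dv t x = v_s t x *\<^sub>R x"

definition v_tt :: "real \<Rightarrow> R6 \<Rightarrow> real" where
  "v_tt t x = (\<Sum>j<n. c j * (- 2 * Re ((2 / zeta (a j) t ((norm x)\<^sup>2)
     + Complex (a j) t / (zeta (a j) t ((norm x)\<^sup>2))\<^sup>2) * wv 2 1 (a j) t ((norm x)\<^sup>2))))"

text \<open>Four times the second derivative in s = |x|^2, again absorbing the factors of the chain
  rule.\<close>

definition v_ss :: "real \<Rightarrow> R6 \<Rightarrow> real" where
  "v_ss t x = (\<Sum>j<n. c j * (2 * Re ((3 / ((Complex (a j) t + zeta (a j) t ((norm x)\<^sup>2)) * zeta (a j) t ((norm x)\<^sup>2))
     + 1 / (zeta (a j) t ((norm x)\<^sup>2))\<^sup>2) * wv 3 1 (a j) t ((norm x)\<^sup>2))))"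

definition v_xx :: "R6 \<Rightarrow> real \<Rightarrow> R6 \<Rightarrow> real" where
  "v_xx e t x = v_s t x + (x \<bullet> e)\<^sup>2 * v_ss t x"

lemma continuous_v:
  "continuous_on UNIV (\<lambda>(t, x). v t x)" "continuous_on UNIV (\<lambda>(t, x). v_t t x)"
  "continuous_on UNIV (\<lambda>(t, x). v_tt t x)" "continuous_on UNIV (\<lambda>(t, x). Dv t x)"
  "continuous_on UNIV (\<lambda>(t, x). v_xx e t x)" "continuous_on UNIV (\<lambda>(t, x). v_s t x)"
proof -
  have sq: "continuous_on UNIV (\<lambda>z :: real \<times> R6. (norm (snd z))\<^sup>2)"
    by (intro continuous_intros)
  have W: "continuous_on UNIV (\<lambda>z :: real \<times> R6. wv m k (a j) (fst z) ((norm (snd z))\<^sup>2))" if "j < n" for j m k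
    by (intro continuous_on_wv continuous_on_fst continuous_on_id sq a_pos that) simp
  have Z: "continuous_on UNIV (\<lambda>z :: real \<times> R6. zeta (a j) (fst z) ((norm (snd z))\<^sup>2))" if "j < n" for j
    by (intro continuous_on_zeta continuous_on_fst continuous_on_id sq a_pos that) simp
  have C: "continuous_on UNIV (\<lambda>z :: real \<times> R6. Complex (a j) (fst z))" for j
    unfolding Complex_eq by (intro continuous_intros)
  have nz: "zeta (a j) t ((norm x)\<^sup>2) \<noteq> 0" "Complex (a j) t + zeta (a j) t ((norm x)\<^sup>2) \<noteq> 0"
    if "j < n" for j t and x :: R6
    by (intro zeta_nonzero add_zeta_nonzero a_pos that zero_le_power2)+
  show "continuous_on UNIV (\<lambda>(t, x). v t x)" "continuous_on UNIV (\<lambda>(t, x). v_t t x)"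
    unfolding v_def v_t_def case_prod_unfold
    by (intro continuous_on_sum continuous_on_mult continuous_on_const continuous_on_Re continuous_on_Im W, simp)+
  show s: "continuous_on UNIV (\<lambda>(t, x). v_s t x)"
    unfolding v_s_def case_prod_unfold
    by (intro continuous_on_sum continuous_on_mult continuous_on_const continuous_on_Re W, simp)
  show "continuous_on UNIV (\<lambda>(t, x). v_tt t x)"
    unfolding v_tt_def case_prod_unfold
    by (intro continuous_on_sum continuous_on_mult continuous_on_const continuous_on_Re continuous_on_add
        continuous_on_divide continuous_on_power W Z C ballI) (simp_all add: nz)
  have ss: "continuous_on UNIV (\<lambda>(t, x). v_ss t x)"
    unfolding v_ss_def case_prod_unfold
    by (intro continuous_on_sum continuous_on_mult continuous_on_const continuous_on_Re continuous_on_add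
        continuous_on_divide continuous_on_power W Z C ballI) (simp_all add: nz)
  show "continuous_on UNIV (\<lambda>(t, x). Dv t x)"
    using s unfolding Dv_def case_prod_unfold
    by (intro continuous_on_scaleR continuous_on_snd continuous_on_id)
  show "continuous_on UNIV (\<lambda>(t, x). v_xx e t x)"
    using s ss unfolding v_xx_def case_prod_unfold
    by (intro continuous_on_add continuous_on_mult continuous_on_power continuous_on_inner continuous_on_const
        continuous_on_snd continuous_on_id)
qed

lemma v_derivatives:
  "((\<lambda>s. v s x) has_real_derivative v_t t x) (at t)"
  "((\<lambda>s. v_t s x) has_real_derivative v_tt t x) (at t)"
  "((\<lambda>s. v t (x + s *\<^sub>R e)) has_real_derivative Dv t x \<bullet> e) (at 0)"
  "e \<in> Basis \<Longrightarrow> ((\<lambda>s. Dv t (x + s *\<^sub>R e) \<bullet> e) has_real_derivative v_xx e t x) (at 0)"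
proof -
  show "((\<lambda>s. v s x) has_real_derivative v_t t x) (at t)"
    "((\<lambda>s. v_t s x) has_real_derivative v_tt t x) (at t)"
    unfolding v_def v_t_def v_tt_def
    by (intro DERIV_sum DERIV_cmult wv_t_derivative a_pos zero_le_power2; simp)+
  have line: "((\<lambda>s. (norm (x + s *\<^sub>R e))\<^sup>2) has_real_derivative 2 * (x \<bullet> e)) (at 0)" for e :: R6
  proof -
    have "(norm (x + s *\<^sub>R e))\<^sup>2 = (norm x)\<^sup>2 + (2 * (x \<bullet> e) * s + (e \<bullet> e) * s\<^sup>2)" for s
      unfolding power2_norm_eq_inner
      by (simp add: inner_add_left inner_add_right inner_commute power2_eq_square algebra_simps)
    moreover have "((\<lambda>s. (norm x)\<^sup>2 + (2 * (x \<bullet> e) * s + (e \<bullet> e) * s\<^sup>2)) has_real_derivative 2 * (x \<bullet> e)) (at 0)"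
      by (auto intro!: derivative_eq_intros)
    ultimately show ?thesis by simp
  qed
  have D1: "((\<lambda>s. Re (wv 2 0 (a j) t ((norm (x + s *\<^sub>R e))\<^sup>2))) has_real_derivative
      - (2 * (x \<bullet> e)) * Re (wv 3 1 (a j) t ((norm x)\<^sup>2))) (at 0)" if "j < n" for j e
    using wv_s_derivative(1)[OF a_pos[OF that] _ line[of e], of t] by simp
  have D2: "((\<lambda>s. Re (wv 3 1 (a j) t ((norm (x + s *\<^sub>R e))\<^sup>2))) has_real_derivative
       - (x \<bullet> e) * Re ((3 / ((Complex (a j) t + zeta (a j) t ((norm x)\<^sup>2)) * zeta (a j) t ((norm x)\<^sup>2))
     + 1 / (zeta (a j) t ((norm x)\<^sup>2))\<^sup>2) * wv 3 1 (a j) t ((norm x)\<^sup>2))) (at 0)" if "j < n" for j e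
    using wv_s_derivative(2)[OF a_pos[OF that] _ line[of e], of t] by simp
  have "((\<lambda>s. v t (x + s *\<^sub>R e)) has_real_derivative
      (\<Sum>j<n. c j * (- (2 * (x \<bullet> e)) * Re (wv 3 1 (a j) t ((norm x)\<^sup>2))))) (at 0)"
    unfolding v_def by (intro DERIV_sum DERIV_cmult D1) simp
  also have "(\<Sum>j<n. c j * (- (2 * (x \<bullet> e)) * Re (wv 3 1 (a j) t ((norm x)\<^sup>2)))) = Dv t x \<bullet> e"
    unfolding Dv_def v_s_def inner_scaleR_left sum_distrib_right by (intro sum.cong) simp_all
  finally show "((\<lambda>s. v t (x + s *\<^sub>R e)) has_real_derivative Dv t x \<bullet> e) (at 0)" .
  assume e: "e \<in> Basis"
  have "((\<lambda>s. v_s t (x + s *\<^sub>R e)) has_real_derivative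
      (\<Sum>j<n. c j * (- 2 * (- (x \<bullet> e) * Re ((3 / ((Complex (a j) t + zeta (a j) t ((norm x)\<^sup>2)) * zeta (a j) t ((norm x)\<^sup>2))
     + 1 / (zeta (a j) t ((norm x)\<^sup>2))\<^sup>2) * wv 3 1 (a j) t ((norm x)\<^sup>2)))))) (at 0)"
    unfolding v_s_def by (intro DERIV_sum DERIV_cmult D2) simp
  also have "(\<Sum>j<n. c j * (- 2 * (- (x \<bullet> e) * Re ((3 / ((Complex (a j) t + zeta (a j) t ((norm x)\<^sup>2)) * zeta (a j) t ((norm x)\<^sup>2))
     + 1 / (zeta (a j) t ((norm x)\<^sup>2))\<^sup>2) * wv 3 1 (a j) t ((norm x)\<^sup>2))))) = (x \<bullet> e) * v_ss t x"
    unfolding v_ss_def sum_distrib_left by (intro sum.cong) (simp_all del: times_complex.sel)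
  finally have s: "((\<lambda>s. v_s t (x + s *\<^sub>R e)) has_real_derivative (x \<bullet> e) * v_ss t x) (at 0)" .
  have "((\<lambda>s. (x + s *\<^sub>R e) \<bullet> e) has_real_derivative 1) (at 0)"
    using e by (auto simp: inner_add_left intro!: derivative_eq_intros)
  from DERIV_mult[OF s this]
  show "((\<lambda>s. Dv t (x + s *\<^sub>R e) \<bullet> e) has_real_derivative v_xx e t x) (at 0)"
    by (simp add: Dv_def v_xx_def power2_eq_square algebra_simps)
qed

text \<open>Summation over the six basis vectors gives
  \<open>6 * v_s + (norm x)\<^sup>2 * v_ss\<close>, which is the radial identity
  \<open>wv_wave_equation\<close> term by term.\<close>

lemma v_wave: "v_tt t x = (\<Sum>e\<in>Basis. v_xx e t x)"
proof -
  have "v_tt t x = 6 * v_s t x + (norm x)\<^sup>2 * v_ss t x"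
    unfolding v_tt_def v_s_def v_ss_def sum_distrib_left sum.distrib[symmetric]
  proof (intro sum.cong refl)
    fix j assume "j \<in> {..<n}"
    then have "0 < a j" using a_pos by simp
    have *: "- 2 * Re ((2 / zeta (a j) t ((norm x)\<^sup>2) + Complex (a j) t / (zeta (a j) t ((norm x)\<^sup>2))\<^sup>2) * wv 2 1 (a j) t ((norm x)\<^sup>2))
      = - 12 * Re (wv 3 1 (a j) t ((norm x)\<^sup>2)) + 2 * (norm x)\<^sup>2 *
        Re ((3 / ((Complex (a j) t + zeta (a j) t ((norm x)\<^sup>2)) * zeta (a j) t ((norm x)\<^sup>2)) + 1 / (zeta (a j) t ((norm x)\<^sup>2))\<^sup>2) * wv 3 1 (a j) t ((norm x)\<^sup>2))"
    proof -
      have "Re (- 2 * u) = - 2 * Re u" "Re (- 12 * u + 2 * of_real q * w) = - 12 * Re u + 2 * q * Re w" for u w q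
        by simp_all
      then show ?thesis
        using arg_cong[OF wv_wave_equation[OF \<open>0 < a j\<close>, of "(norm x)\<^sup>2" t], of Re] by (simp only: zero_le_power2)
    qed
    show "c j * (- 2 * Re ((2 / zeta (a j) t ((norm x)\<^sup>2) + Complex (a j) t / (zeta (a j) t ((norm x)\<^sup>2))\<^sup>2) * wv 2 1 (a j) t ((norm x)\<^sup>2)))
      = 6 * (c j * (- 2 * Re (wv 3 1 (a j) t ((norm x)\<^sup>2)))) + (norm x)\<^sup>2 * (c j * (2 *
        Re ((3 / ((Complex (a j) t + zeta (a j) t ((norm x)\<^sup>2)) * zeta (a j) t ((norm x)\<^sup>2)) + 1 / (zeta (a j) t ((norm x)\<^sup>2))\<^sup>2) * wv 3 1 (a j) t ((norm x)\<^sup>2))))"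
      unfolding * by (simp add: algebra_simps del: times_complex.sel plus_complex.sel)
  qed
  also have "\<dots> = (\<Sum>e\<in>Basis. v_xx e t x)"
  proof -
    have "(norm x)\<^sup>2 = (\<Sum>e\<in>Basis. (x \<bullet> e)\<^sup>2)"
      unfolding power2_norm_eq_inner euclidean_inner[of x x] by (simp add: power2_eq_square)
    then show ?thesis
      by (simp add: v_xx_def sum.distrib sum_distrib_right)
  qed
  finally show ?thesis .
qed

lemma v_remainder:
  assumes "x \<noteq> 0"
  shows "v t x = (\<Sum>j<n. c j * rem (a j) t (norm x))"
    and "v_t t x = (\<Sum>j<n. c j * rem_t (a j) t (norm x))"
    and "norm (Dv t x) = \<bar>\<Sum>j<n. c j * rem_r (a j) t (norm x)\<bar>"
proof -
  let ?r = "norm x"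
  have r: "0 < ?r" using assms by simp
  \<comment> \<open>The use of \<open>c_sum\<close>: whatever does not depend on the index
    \<open>j\<close> drops out.\<close>
  have cancel: "(\<Sum>j<n. c j * (k + f j)) = (\<Sum>j<n. c j * f j)" for k and f :: "nat \<Rightarrow> real"
  proof -
    have "(\<Sum>j<n. c j * (k + f j)) = (\<Sum>j<n. c j) * k + (\<Sum>j<n. c j * f j)"
      by (simp add: distrib_left sum.distrib sum_distrib_right)
    then show ?thesis by (simp add: c_sum)
  qed
  have "v t x = (\<Sum>j<n. c j * ((1 / ?r\<^sup>2 - 2 * t\<^sup>2 / ?r ^ 4) + rem (a j) t ?r))"
    unfolding v_def using wv_remainder(1)[OF a_pos r] by (intro sum.cong) simp_all
  then show "v t x = (\<Sum>j<n. c j * rem (a j) t ?r)" unfolding cancel .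
  have "v_t t x = (\<Sum>j<n. c j * (- 4 * t / ?r ^ 4 + rem_t (a j) t ?r))"
    unfolding v_t_def using wv_remainder(2)[OF a_pos r] by (intro sum.cong) simp_all
  then show "v_t t x = (\<Sum>j<n. c j * rem_t (a j) t ?r)" unfolding cancel .
  have "?r * v_s t x = (\<Sum>j<n. c j * (- 2 * ?r * Re (wv 3 1 (a j) t (?r\<^sup>2))))"
    unfolding v_s_def sum_distrib_left by (intro sum.cong) simp_all
  also have "\<dots> = (\<Sum>j<n. c j * ((- 2 / ?r ^ 3 + 8 * t\<^sup>2 / ?r ^ 5) + rem_r (a j) t ?r))"
    using wv_remainder(3)[OF a_pos r] by (intro sum.cong) simp_all
  finally have "?r * v_s t x = (\<Sum>j<n. c j * rem_r (a j) t ?r)" unfolding cancel .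
  moreover have "norm (Dv t x) = \<bar>?r * v_s t x\<bar>"
    by (simp add: Dv_def abs_mult mult.commute)
  ultimately show "norm (Dv t x) = \<bar>\<Sum>j<n. c j * rem_r (a j) t ?r\<bar>" by simp
qed

end

text \<open>The remainder formulas carry negative powers of r and say nothing near the origin. There
  continuity on a compact set gives the bound; farther out 1 + |x| \<le> 2|x| converts one form of
  decay into the other.\<close>

lemma decay_bound:
  fixes f :: "real \<Rightarrow> R6 \<Rightarrow> 'b::real_normed_vector"
  assumes cont: "continuous_on UNIV (\<lambda>(t, x). f t x)" and "1 \<le> R" "0 \<le> B"
    and far: "\<And>t x. \<bar>t\<bar> \<le> T \<Longrightarrow> R \<le> norm x \<Longrightarrow> norm (f t x) \<le> B / norm x ^ k"
  shows "\<exists>C. \<forall>t x. \<bar>t\<bar> \<le> T \<longrightarrow> norm (f t x) \<le> C / (1 + norm x) ^ k"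
proof -
  have "compact ((\<lambda>(t, x). f t x) ` ({- T..T} \<times> cball 0 R))"
    by (intro compact_continuous_image continuous_on_subset[OF cont] compact_Times) auto
  then obtain M where M: "\<And>t x. \<bar>t\<bar> \<le> T \<Longrightarrow> norm x \<le> R \<Longrightarrow> norm (f t x) \<le> M"
    using compact_imp_bounded[of "(\<lambda>(t, x). f t x) ` ({- T..T} \<times> cball 0 R)"]
    unfolding bounded_iff by (force simp: abs_le_iff)
  define C where "C = max (2 ^ k * B) (max M 0 * (1 + R) ^ k)"
  have "norm (f t x) \<le> C / (1 + norm x) ^ k" if t: "\<bar>t\<bar> \<le> T" for t x
  proof (cases "norm x \<le> R")
    case True
    have "norm (f t x) * (1 + norm x) ^ k \<le> max M 0 * (1 + R) ^ k"
      using M[OF t True] True by (intro mult_mono power_mono) auto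
    then have "norm (f t x) * (1 + norm x) ^ k \<le> C" by (simp add: C_def)
    moreover have "0 < (1 + norm x) ^ k" by (simp add: add_pos_nonneg)
    ultimately show ?thesis by (simp add: pos_le_divide_eq)
  next
    case False
    then have x: "1 \<le> norm x" using assms(2) by simp
    have "(1 + norm x) ^ k \<le> (2 * norm x) ^ k" using x by (intro power_mono) auto
    then have "(1 + norm x) ^ k / 2 ^ k \<le> norm x ^ k"
      by (simp add: power_mult_distrib pos_divide_le_eq mult.commute)
    moreover have "0 < (1 + norm x) ^ k" by (simp add: add_pos_nonneg)
    moreover have "0 < norm x ^ k" by (rule zero_less_power) (use x in linarith)
    ultimately have "B / norm x ^ k \<le> B / ((1 + norm x) ^ k / 2 ^ k)"
      using assms(3) by (intro divide_left_mono mult_pos_pos) auto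
    also have "\<dots> = 2 ^ k * B / (1 + norm x) ^ k" by simp
    also have "\<dots> \<le> C / (1 + norm x) ^ k"
      by (intro divide_right_mono) (auto simp: C_def)
    finally show ?thesis using far[OF t, of x] False by simp
  qed
  then show ?thesis by blast
qed

context superposition begin

lemma v_decay:
  "\<exists>C. \<forall>t x. \<bar>t\<bar> \<le> T \<longrightarrow> \<bar>v t x\<bar> \<le> C / (1 + norm x) ^ 3 \<and>
     \<bar>v_t t x\<bar> \<le> C / (1 + norm x) ^ 4 \<and> norm (Dv t x) \<le> C / (1 + norm x) ^ 4"
proof -
  \<comment> \<open>Large enough for \<open>rem_bounds_bounded_time\<close> at all scales at once;
    the absolute value keeps \<open>R\<close> at least 1 when \<open>T\<close> is negative.\<close>
  define R where "R = 1 + 2 * (\<bar>T\<bar> + (\<Sum>j<n. a j))"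
  define B where "B = 160 * (\<Sum>j<n. \<bar>c j\<bar> * a j)"
  have a0: "j < n \<Longrightarrow> 0 \<le> a j" for j using a_pos[of j] by simp
  have R: "1 \<le> R" unfolding R_def using sum_nonneg[of "{..<n}" a] a0 by simp
  have B: "0 \<le> B" unfolding B_def using a0 by (intro mult_nonneg_nonneg sum_nonneg) auto
  have Rj: "2 * (T + a j) \<le> R" if "j < n" for j
  proof -
    have "a j \<le> (\<Sum>j<n. a j)" using that a0 by (intro member_le_sum) auto
    then show ?thesis unfolding R_def by simp
  qed
  have S: "\<bar>\<Sum>j<n. c j * f j\<bar> \<le> B / y"
    if "\<And>j. j < n \<Longrightarrow> \<bar>f j\<bar> \<le> 160 * a j / y" for f :: "nat \<Rightarrow> real" and y
  proof -
    have "\<bar>\<Sum>j<n. c j * f j\<bar> \<le> (\<Sum>j<n. \<bar>c j\<bar> * (160 * a j / y))"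
    proof (rule order_trans[OF sum_abs], rule sum_mono)
      fix j assume "j \<in> {..<n}"
      then show "\<bar>c j * f j\<bar> \<le> \<bar>c j\<bar> * (160 * a j / y)"
        unfolding abs_mult by (intro mult_left_mono that) auto
    qed
    also have "\<dots> = B / y" by (simp add: B_def sum_distrib_left sum_divide_distrib mult_ac)
    finally show ?thesis .
  qed
  have far: "\<bar>v t x\<bar> \<le> B / norm x ^ 3" "\<bar>v_t t x\<bar> \<le> B / norm x ^ 4" "norm (Dv t x) \<le> B / norm x ^ 4"
    if "\<bar>t\<bar> \<le> T" "R \<le> norm x" for t x
  proof -
    have x: "x \<noteq> 0" using that(2) R by auto
    have b: "\<bar>rem_t (a j) t (norm x)\<bar> \<le> 160 * a j / norm x ^ 4" "\<bar>rem_r (a j) t (norm x)\<bar> \<le> 160 * a j / norm x ^ 4"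
        "\<bar>rem (a j) t (norm x)\<bar> \<le> 160 * a j / norm x ^ 3" if "j < n" for j
    proof -
      note r = rem_bounds_bounded_time[OF a_pos[OF \<open>j < n\<close>] \<open>\<bar>t\<bar> \<le> T\<close> order_trans[OF Rj[OF \<open>j < n\<close>] \<open>R \<le> norm x\<close>]]
      show "\<bar>rem_t (a j) t (norm x)\<bar> \<le> 160 * a j / norm x ^ 4" "\<bar>rem_r (a j) t (norm x)\<bar> \<le> 160 * a j / norm x ^ 4"
        by (rule r)+
      have "14 * a j / norm x ^ 3 \<le> 160 * a j / norm x ^ 3"
        using a0[OF \<open>j < n\<close>] by (intro divide_right_mono) auto
      with r(3) show "\<bar>rem (a j) t (norm x)\<bar> \<le> 160 * a j / norm x ^ 3" by (rule order_trans)
    qed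
    show "\<bar>v t x\<bar> \<le> B / norm x ^ 3" "\<bar>v_t t x\<bar> \<le> B / norm x ^ 4" "norm (Dv t x) \<le> B / norm x ^ 4"
      unfolding v_remainder[OF x] by (intro S b; assumption)+
  qed
  obtain C1 where C1: "\<forall>t x. \<bar>t\<bar> \<le> T \<longrightarrow> norm (v t x) \<le> C1 / (1 + norm x) ^ 3"
    using decay_bound[OF continuous_v(1) R B, of T 3] far(1) unfolding real_norm_def by blast
  obtain C2 where C2: "\<forall>t x. \<bar>t\<bar> \<le> T \<longrightarrow> norm (v_t t x) \<le> C2 / (1 + norm x) ^ 4"
    using decay_bound[OF continuous_v(2) R B, of T 4] far(2) unfolding real_norm_def by blast
  obtain C3 where C3: "\<forall>t x. \<bar>t\<bar> \<le> T \<longrightarrow> norm (Dv t x) \<le> C3 / (1 + norm x) ^ 4"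
    using decay_bound[OF continuous_v(4) R B, of T 4] far(3) by blast
  define C where "C = max C1 (max C2 C3)"
  have "C1 / (1 + norm x) ^ 3 \<le> C / (1 + norm x) ^ 3" "C2 / (1 + norm x) ^ 4 \<le> C / (1 + norm x) ^ 4"
    "C3 / (1 + norm x) ^ 4 \<le> C / (1 + norm x) ^ 4" for x :: R6
    by (intro divide_right_mono; simp add: C_def)+
  then show ?thesis
    using C1 C2 C3 unfolding real_norm_def by (intro exI[of _ C] allI impI conjI) (blast intro: order_trans)+
qed

text \<open>At time zero z = a is real, hence \<zeta> is a real square root and all factors of
  \<open>wv\<close> are real.\<close>

lemma v_t_0: "v_t 0 x = 0"
proof -
  have "Im (wv 2 1 (a j) 0 ((norm x)\<^sup>2)) = 0" if "j < n" for j
  proof -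
    have "zeta (a j) 0 ((norm x)\<^sup>2) = of_real (sqrt ((norm x)\<^sup>2 + (a j)\<^sup>2))"
      unfolding zeta_def Complex_eq using of_real_sqrt[of "(norm x)\<^sup>2 + (a j)\<^sup>2"] by simp
    then have "wv 2 1 (a j) 0 ((norm x)\<^sup>2) = of_real (inverse ((a j + sqrt ((norm x)\<^sup>2 + (a j)\<^sup>2)) ^ 2 * sqrt ((norm x)\<^sup>2 + (a j)\<^sup>2)))"
      unfolding wv_def Complex_eq by simp
    then show ?thesis by simp
  qed
  then show ?thesis by (simp add: v_t_def)
qed

lemma v_0: "v 0 x = (\<Sum>j<n. c j / (a j + sqrt ((norm x)\<^sup>2 + (a j)\<^sup>2))\<^sup>2)"
  unfolding v_def
proof (intro sum.cong refl)
  fix j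
  have "zeta (a j) 0 ((norm x)\<^sup>2) = of_real (sqrt ((norm x)\<^sup>2 + (a j)\<^sup>2))"
    unfolding zeta_def Complex_eq using of_real_sqrt[of "(norm x)\<^sup>2 + (a j)\<^sup>2"] by simp
  then have "wv 2 0 (a j) 0 ((norm x)\<^sup>2) = of_real (inverse ((a j + sqrt ((norm x)\<^sup>2 + (a j)\<^sup>2)) ^ 2))"
    unfolding wv_def Complex_eq by simp
  then show "c j * Re (wv 2 0 (a j) 0 ((norm x)\<^sup>2)) = c j / (a j + sqrt ((norm x)\<^sup>2 + (a j)\<^sup>2))\<^sup>2"
    by (simp only: Re_complex_of_real divide_inverse)
qed

lemma v_free_wave: "free_wave_solution (v 0) (\<lambda>x. 0) v v_t Dv"
  by (rule free_wave_solution_classical[OF continuous_v(1-5) v_derivatives v_wave v_decay v_t_0])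

lemma v_0_Hdot1: "v 0 \<in> Hdot1"
  using v_free_wave unfolding free_wave_solution_def by blast

end

section \<open>Radiation profiles\<close>

definition qprof :: "real \<Rightarrow> real \<Rightarrow> real" where
  "qprof a \<eta> = a / ((\<eta> + a) * sqrt (\<eta> + a))"

text \<open>The antiderivative is -2a / sqrt(\<eta> + a), which vanishes at infinity.\<close>

lemma integral_qprof:
  assumes "0 < a"
  shows "integrable lborel (\<lambda>\<eta>. indicator {0..} \<eta> * qprof a \<eta>)"
    and "(LINT \<eta>|lborel. indicator {0..} \<eta> * qprof a \<eta>) = 2 * sqrt a"
proof -
  have "(\<integral>\<^sup>+\<eta>. ennreal (qprof a \<eta>) * indicator {0..} \<eta> \<partial>lborel) = 0 - (- (2 * a / sqrt (0 + a)))"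
  proof (rule nn_integral_FTC_atLeast)
    show "((\<lambda>\<eta>. - (2 * a / sqrt (\<eta> + a))) has_real_derivative qprof a \<eta>) (at \<eta>)" if "0 \<le> \<eta>" for \<eta>
    proof -
      have "0 < \<eta> + a" using that assms by simp
      then show ?thesis
        by (auto intro!: derivative_eq_intros simp: qprof_def field_simps)
    qed
    show "((\<lambda>\<eta>. - (2 * a / sqrt (\<eta> + a))) \<longlongrightarrow> 0) at_top"
    proof -
      have "filterlim (\<lambda>\<eta>. a + \<eta>) at_top at_top"
        by (rule filterlim_tendsto_add_at_top[OF tendsto_const filterlim_ident])
      then have "filterlim (\<lambda>\<eta>. sqrt (\<eta> + a)) at_top at_top"
        unfolding add.commute[of a] by (rule filterlim_compose[OF sqrt_at_top])
      then have "((\<lambda>\<eta>. 2 * a / sqrt (\<eta> + a)) \<longlongrightarrow> 0) at_top"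
        by (intro tendsto_divide_0[OF tendsto_const] filterlim_at_top_imp_at_infinity)
      from tendsto_minus[OF this] show ?thesis by simp
    qed
  qed (use assms in \<open>auto simp: qprof_def\<close>)
  moreover have "ennreal (qprof a \<eta>) * indicator {0..} \<eta> = ennreal (indicator {0..} \<eta> * qprof a \<eta>)" for \<eta>
    by (simp split: split_indicator)
  moreover have "2 * a / sqrt a = 2 * sqrt a"
    using real_div_sqrt[of a] assms by (metis less_imp_le times_divide_eq_right)
  ultimately have nn: "(\<integral>\<^sup>+\<eta>. ennreal (indicator {0..} \<eta> * qprof a \<eta>) \<partial>lborel) = ennreal (2 * sqrt a)"
    by simp
  have meas: "(\<lambda>\<eta>. indicator {0..} \<eta> * qprof a \<eta>) \<in> borel_measurable lborel"
    unfolding qprof_def by measurable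
  have pos: "0 \<le> indicator {0..} \<eta> * qprof a \<eta>" for \<eta>
    using assms by (simp add: qprof_def indicator_def)
  show "integrable lborel (\<lambda>\<eta>. indicator {0..} \<eta> * qprof a \<eta>)"
    by (rule integrableI_nonneg[OF meas]) (simp_all add: pos nn)
  show "(LINT \<eta>|lborel. indicator {0..} \<eta> * qprof a \<eta>) = 2 * sqrt a"
    using integral_eq_nn_integral[OF meas] pos nn assms by simp
qed

text \<open>Supremum of one factor times the integral of the other: \<open>qprof b\<close> is at
  most its value 1/sqrt b at \<eta> = 0. The bound is useful when a is much smaller than b;
  exchanging the roles covers the opposite case.\<close>

lemma qprof_product:
  assumes "0 < a" "0 < b"
  shows "integrable lborel (\<lambda>\<eta>. indicator {0..} \<eta> * (qprof a \<eta> * qprof b \<eta>))" (is "integrable lborel ?f")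
    and "(LINT \<eta>|lborel. indicator {0..} \<eta> * (qprof a \<eta> * qprof b \<eta>)) \<le> 2 * sqrt (a / b)"
proof -
  have le: "indicator {0..} \<eta> * (qprof a \<eta> * qprof b \<eta>) \<le> (1 / sqrt b) * (indicator {0..} \<eta> * qprof a \<eta>)"
    and pos: "0 \<le> indicator {0..} \<eta> * (qprof a \<eta> * qprof b \<eta>)" for \<eta>
  proof -
    have "qprof a \<eta> * qprof b \<eta> \<le> qprof a \<eta> * (1 / sqrt b) \<and> 0 \<le> qprof a \<eta> * qprof b \<eta>" if "0 \<le> \<eta>"
    proof -
      have "b * sqrt b \<le> (\<eta> + b) * sqrt (\<eta> + b)"
        using assms that by (intro mult_mono) auto
      then have "qprof b \<eta> \<le> b / (b * sqrt b)"
        unfolding qprof_def using assms that by (intro divide_left_mono mult_pos_pos) auto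
      also have "\<dots> = 1 / sqrt b" using assms by simp
      finally show ?thesis
        using assms that by (intro conjI mult_left_mono mult_nonneg_nonneg) (simp_all add: qprof_def)
    qed
    then show "indicator {0..} \<eta> * (qprof a \<eta> * qprof b \<eta>) \<le> (1 / sqrt b) * (indicator {0..} \<eta> * qprof a \<eta>)"
      "0 \<le> indicator {0..} \<eta> * (qprof a \<eta> * qprof b \<eta>)"
      by (auto simp: indicator_def)
  qed
  note int = integrable_mult_right[OF integral_qprof(1)[OF assms(1)], of "1 / sqrt b"]
  show *: "integrable lborel ?f"
  proof (rule Bochner_Integration.integrable_bound[OF int])
    show "?f \<in> borel_measurable lborel"
      unfolding qprof_def by measurable
    have "norm (?f \<eta>) \<le> norm ((1 / sqrt b) * (indicator {0..} \<eta> * qprof a \<eta>))" for \<eta>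
      using le[of \<eta>] pos[of \<eta>] unfolding real_norm_def by linarith
    then show "AE \<eta> in lborel. norm (?f \<eta>) \<le> norm ((1 / sqrt b) * (indicator {0..} \<eta> * qprof a \<eta>))"
      by (rule AE_I2)
  qed
  have "(LINT \<eta>|lborel. ?f \<eta>) \<le> (LINT \<eta>|lborel. (1 / sqrt b) * (indicator {0..} \<eta> * qprof a \<eta>))"
    by (rule integral_mono[OF * int le])
  also have "\<dots> = (1 / sqrt b) * (2 * sqrt a)"
    unfolding integral_mult_right_zero integral_qprof(2)[OF assms(1)] ..
  also have "\<dots> = 2 * sqrt (a / b)" by (simp add: real_sqrt_divide)
  finally show "(LINT \<eta>|lborel. ?f \<eta>) \<le> 2 * sqrt (a / b)" .
qed

section \<open>Existence of the radiation limits\<close>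

text \<open>After division by sqrt r the radicand converges as t tends to infinity with r = t +
  \<eta>: its limit is 2\<eta> + 2a\<i>.\<close>

lemma zeta_div_sqrt:
  assumes "0 < a" "0 < r"
  shows "zeta a t (r\<^sup>2) = csqrt (Complex ((r\<^sup>2 - t\<^sup>2 + a\<^sup>2) / r) (2 * a * t / r)) * of_real (sqrt r)"
proof -
  have "csqrt (Complex ((r\<^sup>2 - t\<^sup>2 + a\<^sup>2) / r) (2 * a * t / r)) = zeta a t (r\<^sup>2) / of_real (sqrt r)"
  proof (rule csqrt_unique)
    have "(of_real (sqrt r) :: complex)\<^sup>2 = of_real r"
      using assms by (simp flip: of_real_power)
    then show "(zeta a t (r\<^sup>2) / of_real (sqrt r))\<^sup>2 = Complex ((r\<^sup>2 - t\<^sup>2 + a\<^sup>2) / r) (2 * a * t / r)"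
      unfolding power_divide zeta_squared
      by (intro complex_eqI) (simp_all add: Re_divide_of_real Im_divide_of_real Re_power2 Im_power2)
    show "0 < Re (zeta a t (r\<^sup>2) / of_real (sqrt r)) \<or> Re (zeta a t (r\<^sup>2) / of_real (sqrt r)) = 0 \<and> 0 \<le> Im (zeta a t (r\<^sup>2) / of_real (sqrt r))"
      using assms Re_zeta_pos[OF assms(1), of "r\<^sup>2" t] by (simp add: Re_divide_of_real)
  qed
  then show ?thesis using assms by simp
qed

text \<open>Everything is a continuous function of u = 1/(t + \<eta>), which tends to 0: z/r tends
  to \<i> and \<zeta>/sqrt r to a nonzero limit. The limits are needed only to exist, because their
  size is controlled by the majorants.\<close>

lemma rem_limits:
  assumes "0 < a"
  shows "\<exists>l. ((\<lambda>t. (t + \<eta>)\<^sup>2 * sqrt (t + \<eta>) * rem_t a t (t + \<eta>)) \<longlongrightarrow> l) at_top"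
    and "\<exists>l. ((\<lambda>t. (t + \<eta>)\<^sup>2 * sqrt (t + \<eta>) * rem_r a t (t + \<eta>)) \<longlongrightarrow> l) at_top"
proof -
  define u where "u t = 1 / (t + \<eta>)" for t
  define C where "C t = csqrt (Complex (2 * \<eta> + (a\<^sup>2 - \<eta>\<^sup>2) * u t) (2 * a - 2 * a * \<eta> * u t))" for t
  define Z where "Z t = Complex (a * u t) (1 - \<eta> * u t)" for t
  define C0 where "C0 = csqrt (Complex (2 * \<eta>) (2 * a))"
  have u0: "(u \<longlongrightarrow> 0) at_top"
    unfolding u_def[abs_def]
    by (intro tendsto_divide_0[OF tendsto_const] filterlim_at_top_imp_at_infinity)
       (subst add.commute, rule filterlim_tendsto_add_at_top[OF tendsto_const filterlim_ident])
  have Cplx: "((\<lambda>t. Complex (f t) (g t)) \<longlongrightarrow> Complex x y) at_top"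
    if "(f \<longlongrightarrow> x) at_top" "(g \<longlongrightarrow> y) at_top" for f g :: "real \<Rightarrow> real" and x y
    using that by (intro tendsto_Complex)
  have "((\<lambda>t. 2 * \<eta> + (a\<^sup>2 - \<eta>\<^sup>2) * u t) \<longlongrightarrow> 2 * \<eta> + (a\<^sup>2 - \<eta>\<^sup>2) * 0) at_top"
    "((\<lambda>t. 2 * a - 2 * a * \<eta> * u t) \<longlongrightarrow> 2 * a - 2 * a * \<eta> * 0) at_top"
    "((\<lambda>t. a * u t) \<longlongrightarrow> a * 0) at_top" "((\<lambda>t. 1 - \<eta> * u t) \<longlongrightarrow> 1 - \<eta> * 0) at_top"
    by (intro tendsto_intros u0)+
  note lims = this[simplified]
  have C: "(C \<longlongrightarrow> C0) at_top"
    unfolding C_def[abs_def] C0_def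
  proof (rule isCont_tendsto_compose[OF _ Cplx[OF lims(1,2)]])
    \<comment> \<open>The imaginary part 2a is positive, so the limit stays off the branch cut for
      every \<eta>, including \<eta> = 0 on the cone itself.\<close>
    have "Complex (2 * \<eta>) (2 * a) \<notin> \<real>\<^sub>\<le>\<^sub>0"
      using assms by (simp add: complex_nonpos_Reals_iff)
    then show "isCont csqrt (Complex (2 * \<eta>) (2 * a))" by (rule continuous_at_csqrt)
  qed
  have Z: "(Z \<longlongrightarrow> Complex 0 1) at_top"
    unfolding Z_def[abs_def] by (rule Cplx[OF lims(3,4)])
  have C0: "C0 \<noteq> 0"
  proof -
    have "Complex (2 * \<eta>) (2 * a) \<noteq> 0" using assms by (simp add: complex_eq_iff)
    then show ?thesis by (simp only: C0_def csqrt_eq_0 not_False_eq_True)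
  qed
  have sq: "((\<lambda>t. sqrt (u t)) \<longlongrightarrow> sqrt 0) at_top" by (intro tendsto_real_sqrt u0)
  have ev: "\<forall>\<^sub>F t in at_top. 0 < t + \<eta>"
    using eventually_gt_at_top[of "- \<eta>"] by eventually_elim simp
  have facts: "Complex a t = Z t * of_real r" "zeta a t (r\<^sup>2) = C t * of_real (sqrt r)" "C t \<noteq> 0"
    if r: "0 < r" "r = t + \<eta>" for r t
  proof -
    have ru: "r * u t = 1" using r by (simp add: u_def)
    have "t = r - \<eta>" using r by simp
    show "Complex a t = Z t * of_real r"
    proof (rule complex_eqI)
      have "a * u t * r = a * (r * u t)" by simp
      then show "Re (Complex a t) = Re (Z t * of_real r)" unfolding ru by (simp add: Z_def)
      have "(1 - \<eta> * u t) * r = r - \<eta> * (r * u t)" by (simp add: algebra_simps)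
      then show "Im (Complex a t) = Im (Z t * of_real r)" unfolding ru using \<open>t = r - \<eta>\<close> by (simp add: Z_def)
    qed
    have "(r\<^sup>2 - t\<^sup>2 + a\<^sup>2) / r = 2 * \<eta> + (a\<^sup>2 - \<eta>\<^sup>2) * u t" "2 * a * t / r = 2 * a - 2 * a * \<eta> * u t"
      using r(1) unfolding u_def r(2)[symmetric] \<open>t = r - \<eta>\<close> by (simp_all add: field_simps power2_eq_square)
    then show z: "zeta a t (r\<^sup>2) = C t * of_real (sqrt r)"
      using zeta_div_sqrt[OF assms r(1), of t] by (simp add: C_def)
    show "C t \<noteq> 0"
      using z zeta_nonzero[OF assms, of "r\<^sup>2" t] by auto
  qed
  have "((\<lambda>t. 2 * Im ((1 + 2 * (Z t)\<^sup>2) / C t)) \<longlongrightarrow> 2 * Im ((1 + 2 * (Complex 0 1)\<^sup>2) / C0)) at_top"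
    by (intro tendsto_intros Z C C0)
  moreover have "\<forall>\<^sub>F t in at_top. 2 * Im ((1 + 2 * (Z t)\<^sup>2) / C t) = (t + \<eta>)\<^sup>2 * sqrt (t + \<eta>) * rem_t a t (t + \<eta>)"
    using ev
  proof eventually_elim
    case (elim t)
    define r where "r = t + \<eta>"
    have r: "0 < r" using elim by (simp add: r_def)
    note f = facts[OF r r_def]
    have "(of_real (r\<^sup>2) + 2 * (Complex a t)\<^sup>2) / zeta a t (r\<^sup>2) = ((1 + 2 * (Z t)\<^sup>2) / C t) * of_real (r\<^sup>2 / sqrt r)"
      unfolding f using f(3) r by (simp add: field_simps)
    then have "Im ((of_real (r\<^sup>2) + 2 * (Complex a t)\<^sup>2) / zeta a t (r\<^sup>2)) = Im ((1 + 2 * (Z t)\<^sup>2) / C t) * (r\<^sup>2 / sqrt r)"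
      by (simp only: times_complex.sel Re_complex_of_real Im_complex_of_real mult_zero_right add_0_left)
    moreover have "r\<^sup>2 * s * (2 * (X * (r\<^sup>2 / s)) / r ^ 4) = 2 * X" if "0 < s" for s X
      using r that by (simp add: field_simps eval_nat_numeral)
    ultimately have "r\<^sup>2 * sqrt r * rem_t a t r = 2 * Im ((1 + 2 * (Z t)\<^sup>2) / C t)"
      unfolding rem_t_def using r by (simp only: real_sqrt_gt_0_iff)
    then show ?case by (simp add: r_def)
  qed
  ultimately show "\<exists>l. ((\<lambda>t. (t + \<eta>)\<^sup>2 * sqrt (t + \<eta>) * rem_t a t (t + \<eta>)) \<longlongrightarrow> l) at_top"
    by (blast intro: Lim_transform_eventually)
  have "((\<lambda>t. 8 * Re (Z t * C t) * u t - 8 * a\<^sup>2 * (u t)\<^sup>2 * sqrt (u t) - 2 * Re (Z t / C t)) \<longlongrightarrow>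
      8 * Re (Complex 0 1 * C0) * 0 - 8 * a\<^sup>2 * 0\<^sup>2 * sqrt 0 - 2 * Re (Complex 0 1 / C0)) at_top"
    by (intro tendsto_intros Z C C0 u0)
  moreover have "\<forall>\<^sub>F t in at_top. 8 * Re (Z t * C t) * u t - 8 * a\<^sup>2 * (u t)\<^sup>2 * sqrt (u t) - 2 * Re (Z t / C t)
      = (t + \<eta>)\<^sup>2 * sqrt (t + \<eta>) * rem_r a t (t + \<eta>)"
    using ev
  proof eventually_elim
    case (elim t)
    define r s where "r = t + \<eta>" and "s = sqrt r"
    have r: "0 < r" using elim by (simp add: r_def)
    have s: "0 < s" "r = s * s" using r by (simp_all add: s_def)
    note f = facts[OF r r_def, folded s_def]
    have "Complex a t * zeta a t (r\<^sup>2) = (Z t * C t) * of_real (r * s)" "Complex a t / zeta a t (r\<^sup>2) = (Z t / C t) * of_real (r / s)"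
      unfolding f using f(3) s(1) by (simp_all add: field_simps)
    then have 1: "Re (Complex a t * zeta a t (r\<^sup>2)) = Re (Z t * C t) * (r * s)" "Re (Complex a t / zeta a t (r\<^sup>2)) = Re (Z t / C t) * (r / s)"
      by (simp_all only: times_complex.sel(1)[of _ "of_real _"] Re_complex_of_real Im_complex_of_real mult_zero_right diff_zero)
    have 2: "u t = 1 / (s * s)" "sqrt (1 / (s * s)) = 1 / s"
      using s by (simp_all add: u_def r_def[symmetric] real_sqrt_divide)
    have "8 * X * (1 / (s * s)) - 8 * a\<^sup>2 * (1 / (s * s))\<^sup>2 * (1 / s) - 2 * Y
        = (s * s)\<^sup>2 * s * ((8 * (X * (s * s * s)) - 8 * a\<^sup>2) / (s * s) ^ 5 - 2 * (Y * (s * s / s)) / (s * s) ^ 3)" for X Y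
      using s(1) by (simp add: field_simps eval_nat_numeral)
    then show ?case
      unfolding rem_r_def r_def[symmetric] 1 2 s_def[symmetric] unfolding s(2) .
  qed
  ultimately show "\<exists>l. ((\<lambda>t. (t + \<eta>)\<^sup>2 * sqrt (t + \<eta>) * rem_r a t (t + \<eta>)) \<longlongrightarrow> l) at_top"
    by (blast intro: Lim_transform_eventually)
qed

section \<open>Exterior energy of a superposition\<close>

context superposition begin

text \<open>The pointwise energy as a function of r alone; through \<open>v_remainder\<close> it
  agrees with the energy of the solution away from the origin.\<close>

definition energy_density :: "real \<Rightarrow> real \<Rightarrow> real" where
  "energy_density t r = (\<Sum>j<n. c j * rem_t (a j) t r)\<^sup>2 + (\<Sum>j<n. c j * rem_r (a j) t r)\<^sup>2"

lemma measurable_energy_density: "energy_density t \<in> borel_measurable borel"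
proof -
  have "rem_t (a j) t \<in> borel_measurable borel" "rem_r (a j) t \<in> borel_measurable borel" if "j < n" for j
  proof -
    have "continuous_on UNIV (\<lambda>r::real. zeta (a j) t (r\<^sup>2))"
      by (rule continuous_on_zeta) (use a_pos[OF that] in \<open>auto intro!: continuous_intros\<close>)
    then have [measurable]: "(\<lambda>r::real. zeta (a j) t (r\<^sup>2)) \<in> borel_measurable borel"
      by (rule borel_measurable_continuous_onI)
    have [measurable]: "Re \<in> borel_measurable borel" "Im \<in> borel_measurable borel"
      by (intro borel_measurable_continuous_onI continuous_intros)+
    have [measurable]: "complex_of_real \<in> borel_measurable borel"
      by (intro borel_measurable_continuous_onI continuous_intros)
    show "rem_t (a j) t \<in> borel_measurable borel" "rem_r (a j) t \<in> borel_measurable borel"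
      unfolding rem_t_def[abs_def] rem_r_def[abs_def] by measurable
  qed
  then show ?thesis
    unfolding energy_density_def[abs_def]
    by (intro borel_measurable_add borel_measurable_power borel_measurable_sum borel_measurable_times borel_measurable_const) auto
qed

text \<open>Polar coordinates, then the shift r = t + \<eta>: in the frame moving with the cone the
  domain of integration no longer depends on t. As t is positive, the origin, where
  \<open>v_remainder\<close> fails, is outside the region.\<close>

lemma exterior_energy_radial:
  assumes "0 < t"
  shows "(LINT x:{x. t \<le> norm x}|lebesgue. (v_t t x)\<^sup>2 + (norm (Dv t x))\<^sup>2) =
    unit_ball_vol 6 * 6 * (LINT \<eta>|lborel. indicator {0..} \<eta> * ((t + \<eta>) ^ 5 * energy_density t (t + \<eta>)))"
proof -
  define g where "g r = indicator {t..} r * energy_density t r" for r :: real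
  have g: "g \<in> borel_measurable borel"
    unfolding g_def[abs_def] using measurable_energy_density by measurable
  have eq: "indicator {x. t \<le> norm x} x *\<^sub>R ((v_t t x)\<^sup>2 + (norm (Dv t x))\<^sup>2) = g (norm x)" for x
  proof (cases "t \<le> norm x")
    case True
    then have "x \<noteq> 0" using assms by auto
    then show ?thesis
      using True v_remainder[OF \<open>x \<noteq> 0\<close>, of t] by (simp add: g_def energy_density_def)
  qed (simp add: g_def)
  have "(LINT x:{x. t \<le> norm x}|lebesgue. (v_t t x)\<^sup>2 + (norm (Dv t x))\<^sup>2) = (LINT (x::R6)|lebesgue. g (norm x))"
    unfolding set_lebesgue_integral_def eq ..
  also have "\<dots> = (LINT (x::R6)|lborel. g (norm x))"
    by (rule integral_completion) (use g in measurable)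
  also have "\<dots> = (LINT r|lborel. unit_ball_vol DIM(R6) * DIM(R6) * (indicator {0..} r * r ^ (DIM(R6) - 1) * g r))"
    by (rule integral_radial[OF g])
  also have "\<dots> = unit_ball_vol 6 * 6 * (LINT r|lborel. indicator {0..} r * r ^ 5 * g r)"
    by simp
  also have "(LINT r|lborel. indicator {0..} r * r ^ 5 * g r) = \<bar>1\<bar> *\<^sub>R (LINT \<eta>|lborel. indicator {0..} (t + 1 * \<eta>) * (t + 1 * \<eta>) ^ 5 * g (t + 1 * \<eta>))"
    by (rule lborel_integral_real_affine) simp
  also have "\<dots> = (LINT \<eta>|lborel. indicator {0..} \<eta> * ((t + \<eta>) ^ 5 * energy_density t (t + \<eta>)))"
  proof -
    have "indicator {0..} (t + 1 * \<eta>) * (t + 1 * \<eta>) ^ 5 * g (t + 1 * \<eta>)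
        = indicator {0..} \<eta> * ((t + \<eta>) ^ 5 * energy_density t (t + \<eta>))" for \<eta> :: real
      using assms by (auto simp: g_def indicator_def)
    then show ?thesis by (simp only: abs_one scaleR_one)
  qed
  finally show ?thesis .
qed

text \<open>The weight (t + \<eta>)^5 is the square of the factor in \<open>rem_limits\<close>, so
  it can be moved inside both squared sums.\<close>

lemma energy_density_limit:
  "\<exists>l. ((\<lambda>t. (t + \<eta>) ^ 5 * energy_density t (t + \<eta>)) \<longlongrightarrow> l) at_top"
proof -
  have "\<forall>j\<in>{..<n}. \<exists>l. ((\<lambda>t. (t + \<eta>)\<^sup>2 * sqrt (t + \<eta>) * rem_t (a j) t (t + \<eta>)) \<longlongrightarrow> l) at_top"
    by (intro ballI rem_limits(1) a_pos) simp
  from bchoice[OF this] obtain l where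
    l: "\<forall>j\<in>{..<n}. ((\<lambda>t. (t + \<eta>)\<^sup>2 * sqrt (t + \<eta>) * rem_t (a j) t (t + \<eta>)) \<longlongrightarrow> l j) at_top" ..
  have "\<forall>j\<in>{..<n}. \<exists>l. ((\<lambda>t. (t + \<eta>)\<^sup>2 * sqrt (t + \<eta>) * rem_r (a j) t (t + \<eta>)) \<longlongrightarrow> l) at_top"
    by (intro ballI rem_limits(2) a_pos) simp
  from bchoice[OF this] obtain m where
    m: "\<forall>j\<in>{..<n}. ((\<lambda>t. (t + \<eta>)\<^sup>2 * sqrt (t + \<eta>) * rem_r (a j) t (t + \<eta>)) \<longlongrightarrow> m j) at_top" ..
  have "((\<lambda>t. (\<Sum>j<n. c j * ((t + \<eta>)\<^sup>2 * sqrt (t + \<eta>) * rem_t (a j) t (t + \<eta>)))\<^sup>2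
      + (\<Sum>j<n. c j * ((t + \<eta>)\<^sup>2 * sqrt (t + \<eta>) * rem_r (a j) t (t + \<eta>)))\<^sup>2)
      \<longlongrightarrow> (\<Sum>j<n. c j * l j)\<^sup>2 + (\<Sum>j<n. c j * m j)\<^sup>2) at_top"
    by (intro tendsto_add tendsto_power tendsto_sum tendsto_mult[OF tendsto_const] l[rule_format] m[rule_format])
  note lim = this
  have "\<forall>\<^sub>F t in at_top. (\<Sum>j<n. c j * ((t + \<eta>)\<^sup>2 * sqrt (t + \<eta>) * rem_t (a j) t (t + \<eta>)))\<^sup>2
      + (\<Sum>j<n. c j * ((t + \<eta>)\<^sup>2 * sqrt (t + \<eta>) * rem_r (a j) t (t + \<eta>)))\<^sup>2 = (t + \<eta>) ^ 5 * energy_density t (t + \<eta>)"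
    using eventually_gt_at_top[of "- \<eta>"]
  proof eventually_elim
    case (elim t)
    define s where "s = (t + \<eta>)\<^sup>2 * sqrt (t + \<eta>)"
    have "0 \<le> t + \<eta>" using elim by simp
    then have s: "s\<^sup>2 = (t + \<eta>) ^ 5"
      by (simp add: s_def power_mult_distrib flip: power_mult) (simp add: eval_nat_numeral)
    have "(\<Sum>j<n. c j * (s * f j))\<^sup>2 = s\<^sup>2 * (\<Sum>j<n. c j * f j)\<^sup>2" for f :: "nat \<Rightarrow> real"
    proof -
      have "(\<Sum>j<n. c j * (s * f j)) = s * (\<Sum>j<n. c j * f j)"
        by (simp add: sum_distrib_left mult_ac)
      then show ?thesis by (simp add: power_mult_distrib)
    qed
    then show ?case
      unfolding s_def[symmetric] energy_density_def by (simp add: s distrib_left)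
  qed
  from Lim_transform_eventually[OF lim this] show ?thesis ..
qed

text \<open>Both sums obey the exterior bound with constant 160, whence 51200 = 2 * 160^2.\<close>

lemma energy_density_bound:
  assumes "\<And>j. j < n \<Longrightarrow> a j \<le> t" "0 < t" "0 \<le> \<eta>"
  shows "(t + \<eta>) ^ 5 * energy_density t (t + \<eta>) \<le> 51200 * (\<Sum>j<n. \<bar>c j\<bar> * qprof (a j) \<eta>)\<^sup>2"
proof -
  define s where "s = (t + \<eta>)\<^sup>2 * sqrt (t + \<eta>)"
  have r: "0 < t + \<eta>" using assms by simp
  then have s: "s\<^sup>2 = (t + \<eta>) ^ 5" and s0: "0 < s"
    by (simp_all add: s_def power_mult_distrib flip: power_mult) (simp add: eval_nat_numeral)
  let ?Q = "\<Sum>j<n. \<bar>c j\<bar> * qprof (a j) \<eta>"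
  have le: "(\<Sum>j<n. c j * f j)\<^sup>2 \<le> (160 * ?Q / s)\<^sup>2"
    if f: "\<And>j. j < n \<Longrightarrow> \<bar>f j\<bar> \<le> 160 * qprof (a j) \<eta> / s" for f :: "nat \<Rightarrow> real"
  proof -
    have "\<bar>\<Sum>j<n. c j * f j\<bar> \<le> (\<Sum>j<n. \<bar>c j\<bar> * (160 * qprof (a j) \<eta> / s))"
    proof (rule order_trans[OF sum_abs], rule sum_mono)
      fix j assume "j \<in> {..<n}"
      then show "\<bar>c j * f j\<bar> \<le> \<bar>c j\<bar> * (160 * qprof (a j) \<eta> / s)"
        unfolding abs_mult by (intro mult_left_mono f) auto
    qed
    also have "\<dots> = 160 * ?Q / s" by (simp add: sum_distrib_left sum_divide_distrib mult_ac)
    finally have "\<bar>\<Sum>j<n. c j * f j\<bar>\<^sup>2 \<le> (160 * ?Q / s)\<^sup>2" by (intro power_mono) auto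
    then show ?thesis by simp
  qed
  have "energy_density t (t + \<eta>) \<le> (160 * ?Q / s)\<^sup>2 + (160 * ?Q / s)\<^sup>2"
    unfolding energy_density_def
    by (intro add_mono le; unfold qprof_def s_def; intro rem_bounds_exterior a_pos assms)
  also have "\<dots> = 51200 * ?Q\<^sup>2 / (t + \<eta>) ^ 5"
    by (simp add: power_divide power_mult_distrib s)
  finally show ?thesis
    using r by (simp add: pos_le_divide_eq mult.commute)
qed

text \<open>Dominated convergence in the moving frame gives the limit; the integral of the majorant
  bounds it. That majorant uses only the absolute values of the coefficients, so smallness comes
  from the separation of the scales and not from signs.\<close>

lemma exterior_energy_limit:
  assumes "(\<Sum>j<n. \<Sum>k<n. \<bar>c j\<bar> * \<bar>c k\<bar> * min (sqrt (a j / a k)) (sqrt (a k / a j))) \<le> B"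
  shows "\<exists>L \<le> unit_ball_vol 6 * 6 * (51200 * (2 * B)).
    ((\<lambda>t. LINT x:{x. t \<le> norm x}|lebesgue. (v_t t x)\<^sup>2 + (norm (Dv t x))\<^sup>2) \<longlongrightarrow> L) at_top"
proof -
  define s where "s t \<eta> = indicator {0..} \<eta> * ((t + \<eta>) ^ 5 * energy_density t (t + \<eta>))" for t \<eta> :: real
  obtain f0 where f0: "\<And>\<eta>. ((\<lambda>t. (t + \<eta>) ^ 5 * energy_density t (t + \<eta>)) \<longlongrightarrow> f0 \<eta>) at_top"
    using energy_density_limit by metis
  define f where "f \<eta> = indicator {0..} \<eta> * f0 \<eta>" for \<eta> :: real
  \<comment> \<open>The square of the summed profiles, written as a double sum so that
    \<open>qprof_product\<close> applies to each pair.\<close>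
  define w where "w \<eta> = 51200 * (\<Sum>j<n. \<Sum>k<n. \<bar>c j\<bar> * \<bar>c k\<bar> * (indicator {0..} \<eta> * (qprof (a j) \<eta> * qprof (a k) \<eta>)))" for \<eta> :: real
  have w_eq: "w \<eta> = indicator {0..} \<eta> * (51200 * (\<Sum>j<n. \<bar>c j\<bar> * qprof (a j) \<eta>)\<^sup>2)" for \<eta>
    unfolding w_def power2_eq_square sum_product unfolding sum_distrib_left
    by (intro sum.cong refl) (simp add: mult_ac)
  have sm: "s t \<in> borel_measurable lborel" for t
  proof -
    have [measurable]: "energy_density t \<in> borel_measurable borel" by (rule measurable_energy_density)
    show ?thesis unfolding s_def[abs_def] by measurable
  qed
  have lim: "((\<lambda>t. s t \<eta>) \<longlongrightarrow> f \<eta>) at_top" for \<eta>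
    unfolding s_def f_def by (intro tendsto_mult tendsto_const f0)
  \<comment> \<open>Measurability passes to the limit along integer times, since it is preserved by
    limits of sequences.\<close>
  have fm: "f \<in> borel_measurable lborel"
  proof (rule borel_measurable_LIMSEQ_real)
    show "(\<lambda>i. s (real i) \<eta>) \<longlonglongrightarrow> f \<eta>" for \<eta>
      by (rule filterlim_compose[OF lim filterlim_real_sequentially])
  qed (rule sm)
  have ip: "integrable lborel (\<lambda>\<eta>. \<bar>c j\<bar> * \<bar>c k\<bar> * (indicator {0..} \<eta> * (qprof (a j) \<eta> * qprof (a k) \<eta>)))"
    if "j < n" "k < n" for j k
    by (rule integrable_mult_right[OF qprof_product(1)[OF a_pos[OF that(1)] a_pos[OF that(2)]]])
  have wi: "integrable lborel w"
    unfolding w_def[abs_def]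
    by (intro integrable_mult_right Bochner_Integration.integrable_sum ip) auto
  have "(LINT \<eta>|lborel. w \<eta>) = 51200 * (\<Sum>j<n. \<Sum>k<n. \<bar>c j\<bar> * \<bar>c k\<bar> *
      (LINT \<eta>|lborel. indicator {0..} \<eta> * (qprof (a j) \<eta> * qprof (a k) \<eta>)))"
  proof -
    have "(LINT \<eta>|lborel. w \<eta>) = 51200 * (LINT \<eta>|lborel. (\<Sum>j<n. \<Sum>k<n. \<bar>c j\<bar> * \<bar>c k\<bar> * (indicator {0..} \<eta> * (qprof (a j) \<eta> * qprof (a k) \<eta>))))"
      unfolding w_def by (rule integral_mult_right_zero)
    also have "(LINT \<eta>|lborel. (\<Sum>j<n. \<Sum>k<n. \<bar>c j\<bar> * \<bar>c k\<bar> * (indicator {0..} \<eta> * (qprof (a j) \<eta> * qprof (a k) \<eta>))))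
        = (\<Sum>j<n. LINT \<eta>|lborel. (\<Sum>k<n. \<bar>c j\<bar> * \<bar>c k\<bar> * (indicator {0..} \<eta> * (qprof (a j) \<eta> * qprof (a k) \<eta>))))"
      by (intro Bochner_Integration.integral_sum Bochner_Integration.integrable_sum ip) auto
    also have "\<dots> = (\<Sum>j<n. \<Sum>k<n. LINT \<eta>|lborel. \<bar>c j\<bar> * \<bar>c k\<bar> * (indicator {0..} \<eta> * (qprof (a j) \<eta> * qprof (a k) \<eta>)))"
      by (intro sum.cong refl Bochner_Integration.integral_sum ip) auto
    finally show ?thesis unfolding integral_mult_right_zero .
  qed
  \<comment> \<open>For each pair both orders of \<open>qprof_product\<close> are available; their
    minimum measures the distance of the two scales.\<close>
  also have "\<dots> \<le> 51200 * (\<Sum>j<n. \<Sum>k<n. \<bar>c j\<bar> * \<bar>c k\<bar> * (2 * min (sqrt (a j / a k)) (sqrt (a k / a j))))"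
  proof (intro mult_left_mono sum_mono)
    fix j k assume "j \<in> {..<n}" "k \<in> {..<n}"
    then have jk: "0 < a j" "0 < a k" using a_pos by auto
    have "(LINT \<eta>|lborel. indicator {0..} \<eta> * (qprof (a j) \<eta> * qprof (a k) \<eta>)) \<le> 2 * sqrt (a j / a k)"
      by (rule qprof_product(2)[OF jk])
    moreover have "(LINT \<eta>|lborel. indicator {0..} \<eta> * (qprof (a j) \<eta> * qprof (a k) \<eta>)) \<le> 2 * sqrt (a k / a j)"
      using qprof_product(2)[OF jk(2,1)] by (simp only: mult.commute[of "qprof (a k) _"])
    ultimately show "(LINT \<eta>|lborel. indicator {0..} \<eta> * (qprof (a j) \<eta> * qprof (a k) \<eta>)) \<le> 2 * min (sqrt (a j / a k)) (sqrt (a k / a j))"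
      by (simp only: min_def split: if_splits) simp
  qed auto
  also have "\<dots> = 51200 * (2 * (\<Sum>j<n. \<Sum>k<n. \<bar>c j\<bar> * \<bar>c k\<bar> * min (sqrt (a j / a k)) (sqrt (a k / a j))))"
    by (simp only: sum_distrib_left mult.left_commute[of _ 2])
  also have "\<dots> \<le> 51200 * (2 * B)" using assms by simp
  finally have wB: "(LINT \<eta>|lborel. w \<eta>) \<le> 51200 * (2 * B)" .
  \<comment> \<open>From this time on \<open>t\<close> is positive and exceeds every scale, as
    \<open>energy_density_bound\<close> demands.\<close>
  have bound: "\<bar>s t \<eta>\<bar> \<le> w \<eta>" if t: "1 + (\<Sum>j<n. \<bar>a j\<bar>) \<le> t" for t \<eta>
  proof (cases "0 \<le> \<eta>")
    case True
    have "0 < 1 + (\<Sum>j<n. \<bar>a j\<bar>)" by (simp add: add_pos_nonneg)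
    then have t0: "0 < t" using t by (rule less_le_trans)
    have "a j \<le> t" if "j < n" for j
    proof -
      have "\<bar>a j\<bar> \<le> (\<Sum>j<n. \<bar>a j\<bar>)" using that by (intro member_le_sum) auto
      then show ?thesis using t by simp
    qed
    from energy_density_bound[OF this t0 True]
    have "s t \<eta> \<le> w \<eta>" using True by (simp add: s_def w_eq)
    moreover have "0 \<le> s t \<eta>" using True t0 by (simp add: s_def energy_density_def)
    ultimately show ?thesis by simp
  qed (simp add: s_def w_eq)
  have evb: "\<forall>\<^sub>F t in at_top. AE \<eta> in lborel. norm (s t \<eta>) \<le> w \<eta>"
    using eventually_ge_at_top[of "1 + (\<Sum>j<n. \<bar>a j\<bar>)"]
    by eventually_elim (simp add: bound)
  have I: "((\<lambda>t. LINT \<eta>|lborel. s t \<eta>) \<longlongrightarrow> (LINT \<eta>|lborel. f \<eta>)) at_top"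
    by (rule integral_dominated_convergence_at_top[OF fm sm wi AE_I2[OF lim] evb])
  have "(LINT \<eta>|lborel. f \<eta>) \<le> 51200 * (2 * B)"
  proof (rule tendsto_upperbound[OF I])
    show "\<forall>\<^sub>F t in at_top. (LINT \<eta>|lborel. s t \<eta>) \<le> 51200 * (2 * B)"
      using eventually_ge_at_top[of "1 + (\<Sum>j<n. \<bar>a j\<bar>)"]
    proof eventually_elim
      case (elim t)
      have "norm (s t \<eta>) \<le> norm (w \<eta>)" "s t \<eta> \<le> w \<eta>" for \<eta>
        using bound[OF elim, of \<eta>] unfolding real_norm_def by linarith+
      note b = this
      have "integrable lborel (s t)"
        by (rule Bochner_Integration.integrable_bound[OF wi sm AE_I2[OF b(1)]])
      then have "(LINT \<eta>|lborel. s t \<eta>) \<le> (LINT \<eta>|lborel. w \<eta>)"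
        by (rule integral_mono[OF _ wi b(2)])
      then show ?case using wB by simp
    qed
  qed simp
  then have "unit_ball_vol 6 * 6 * (LINT \<eta>|lborel. f \<eta>) \<le> unit_ball_vol 6 * 6 * (51200 * (2 * B))"
    by (intro mult_left_mono) auto
  moreover have "((\<lambda>t. LINT x:{x. t \<le> norm x}|lebesgue. (v_t t x)\<^sup>2 + (norm (Dv t x))\<^sup>2)
      \<longlongrightarrow> unit_ball_vol 6 * 6 * (LINT \<eta>|lborel. f \<eta>)) at_top"
  proof (rule Lim_transform_eventually[OF tendsto_mult[OF tendsto_const I]])
    show "\<forall>\<^sub>F t in at_top. unit_ball_vol 6 * 6 * (LINT \<eta>|lborel. s t \<eta>) =
        (LINT x:{x. t \<le> norm x}|lebesgue. (v_t t x)\<^sup>2 + (norm (Dv t x))\<^sup>2)"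
      using eventually_gt_at_top[of 0]
      by eventually_elim (simp add: exterior_energy_radial s_def)
  qed
  ultimately show ?thesis by blast
qed

end

section \<open>Logarithmically spread scales\<close>

text \<open>The terms are 2 to the power -|j - k|: the indices k \<le> j contribute at most 2, the
  others at most 1.\<close>

lemma sum_min_powers_le: "(\<Sum>k<m. min ((2::real) ^ j / 2 ^ k) (2 ^ k / 2 ^ j)) \<le> 3"
proof -
  have low: "(\<Sum>k<m. if k \<le> j then (2::real) ^ k else 0) \<le> 2 ^ Suc j"
  proof -
    have "(\<Sum>k<m. if k \<le> j then (2::real) ^ k else 0) = (\<Sum>k\<in>{..<m} \<inter> {k. k \<le> j}. 2 ^ k)"
      by (simp add: sum.inter_restrict)
    also have "\<dots> \<le> (\<Sum>k<Suc j. 2 ^ k)"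
      by (intro sum_mono2) auto
    also have "\<dots> = 2 ^ Suc j - 1"
      by (subst sum_gp_strict) simp
    finally show ?thesis by simp
  qed
  \<comment> \<open>The subtracted tail of the geometric series is what makes the induction go
    through.\<close>
  have high: "(\<Sum>k<m. if j < k then (2::real) ^ j / 2 ^ k else 0) \<le> 1 - (if j < m then 2 * 2 ^ j / 2 ^ m else 0)" for m
  proof (induction m)
    case (Suc m)
    consider "j < m" | "j = m" | "m < j" by linarith
    then show ?case
    proof cases
      case 1
      then show ?thesis using Suc by simp
    next
      case 2
      then have "(\<Sum>k<m. if j < k then (2::real) ^ j / 2 ^ k else 0) = 0"
        by (intro sum.neutral) auto
      then show ?thesis using 2 by simp
    qed (use Suc in simp)
  qed simp
  have "(\<Sum>k<m. min ((2::real) ^ j / 2 ^ k) (2 ^ k / 2 ^ j))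
      \<le> (\<Sum>k<m. (if k \<le> j then 2 ^ k else 0) / 2 ^ j + (if j < k then 2 ^ j / 2 ^ k else 0))"
    by (intro sum_mono) (auto simp: min_def)
  also have "\<dots> = (\<Sum>k<m. if k \<le> j then 2 ^ k else 0) / 2 ^ j + (\<Sum>k<m. if j < k then 2 ^ j / 2 ^ k else 0)"
    by (simp add: sum.distrib sum_divide_distrib)
  also have "\<dots> \<le> 2 ^ Suc j / 2 ^ j + 1"
    using high[of m] by (intro add_mono divide_right_mono low) (auto split: if_splits intro: order_trans)
  finally show ?thesis by simp
qed

text \<open>The indices below N give 1/2, 1/8, and so on downwards, those from N on give 2, 8, and
  so on upwards: the factor 2 puts r = 1 in the middle of the gap between the halves. Neighbouring
  scales have ratio 4, whose square root 2 is the base of the geometric sums.\<close>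

definition scale :: "nat \<Rightarrow> nat \<Rightarrow> real" where
  "scale N j = 2 * 4 ^ j / 4 ^ N"

definition weight :: "real \<Rightarrow> nat \<Rightarrow> nat \<Rightarrow> real" where
  "weight \<kappa> N j = (if j < N then \<kappa> / sqrt N else - (\<kappa> / sqrt N))"

lemma sum_split_halves:
  fixes f :: "nat \<Rightarrow> real"
  shows "(\<Sum>j<2 * N. f j) = (\<Sum>j<N. f j) + (\<Sum>j<N. f (N + j))"
proof -
  have "(\<Sum>j<2 * N. f j) = (\<Sum>j<N + N. f j)" by (simp add: mult_2)
  also have "\<dots> = (\<Sum>j<N. f j) + (\<Sum>j=N..<N + N. f j)"
    by (simp add: lessThan_atLeast0 sum.atLeastLessThan_concat)
  also have "(\<Sum>j=N..<N + N. f j) = (\<Sum>j<N. f (N + j))"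
    using sum.shift_bounds_nat_ivl[of f 0 N N] by (simp add: lessThan_atLeast0 add.commute)
  finally show ?thesis .
qed

lemma superposition_scales: "superposition (2 * N) (weight \<kappa> N) (scale N)"
proof
  show "0 < scale N j" for j by (simp add: scale_def)
  show "(\<Sum>j<2 * N. weight \<kappa> N j) = 0"
    unfolding sum_split_halves by (simp add: weight_def)
qed

text \<open>All weights have modulus |\<kappa>|/sqrt N, and each of the 2N rows sums to at most 3,
  so N cancels: 2N * 3 * \<kappa>^2/N.\<close>

lemma interaction_bound:
  assumes "0 < N"
  shows "(\<Sum>j<2 * N. \<Sum>k<2 * N. \<bar>weight \<kappa> N j\<bar> * \<bar>weight \<kappa> N k\<bar> *
    min (sqrt (scale N j / scale N k)) (sqrt (scale N k / scale N j))) \<le> 6 * \<kappa>\<^sup>2"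
proof -
  have root: "sqrt (scale N j / scale N k) = 2 ^ j / 2 ^ k" for j k
  proof -
    have "(4::real) ^ i = (2 ^ i)\<^sup>2" for i
      by (simp add: power2_eq_square flip: power_mult_distrib)
    then have "scale N j / scale N k = (2 ^ j / 2 ^ k)\<^sup>2"
      by (simp add: scale_def power_divide)
    then show ?thesis by simp
  qed
  have w: "\<bar>weight \<kappa> N j\<bar> * \<bar>weight \<kappa> N k\<bar> = \<kappa>\<^sup>2 / N" for j k
    by (simp add: weight_def abs_divide power2_eq_square abs_mult_self_eq flip: abs_mult)
  have "(\<Sum>j<2 * N. \<Sum>k<2 * N. \<bar>weight \<kappa> N j\<bar> * \<bar>weight \<kappa> N k\<bar> *
      min (sqrt (scale N j / scale N k)) (sqrt (scale N k / scale N j)))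
    = (\<Sum>j<2 * N. \<kappa>\<^sup>2 / N * (\<Sum>k<2 * N. min (2 ^ j / 2 ^ k) (2 ^ k / 2 ^ j)))"
    unfolding root w by (simp only: sum_distrib_left)
  also have "\<dots> \<le> (\<Sum>j<2 * N. \<kappa>\<^sup>2 / N * 3)"
    by (intro sum_mono mult_left_mono sum_min_powers_le) auto
  also have "\<dots> = 6 * \<kappa>\<^sup>2" using assms by simp
  finally show ?thesis .
qed

text \<open>On the shell every small scale contributes at least 1/7 and every large one takes away
  at most 1/16, and 1/7 - 1/16 exceeds 1/16. The N differences times \<kappa>/sqrt N give the growth
  sqrt N.\<close>

lemma initial_data_lower_bound:
  assumes "0 < N" "0 < \<kappa>" "1 \<le> norm x" "norm x \<le> 2"
  shows "\<kappa> * sqrt N / 16 \<le> superposition.v (2 * N) (weight \<kappa> N) (scale N) 0 x"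
proof -
  define r where "r = norm x"
  have r: "1 \<le> r" "r \<le> 2" using assms by (auto simp: r_def)
  have r2: "r\<^sup>2 \<le> 4" "1 \<le> r\<^sup>2" using r power_mono[of r 2 2] power_mono[of 1 r 2] by auto
  let ?h = "\<lambda>j. 1 / (scale N j + sqrt (r\<^sup>2 + (scale N j)\<^sup>2))\<^sup>2"
  have h1: "1 / 7 \<le> ?h j" if "j < N" for j
  proof -
    have "(4::real) ^ Suc j \<le> 4 ^ N" using that by (intro power_increasing) auto
    then have s: "0 < scale N j" "scale N j \<le> 1 / 2" by (simp_all add: scale_def field_simps)
    then have "(scale N j)\<^sup>2 \<le> (1 / 2)\<^sup>2" by (intro power_mono) auto
    \<comment> \<open>The constants are 4 + 1/4 < 2.1^2 and then (0.5 + 2.1)^2 = 6.76 < 7.\<close>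
    then have "r\<^sup>2 + (scale N j)\<^sup>2 \<le> (21 / 10)\<^sup>2" using r2 by (simp add: power2_eq_square)
    then have "sqrt (r\<^sup>2 + (scale N j)\<^sup>2) \<le> 21 / 10" by (intro real_le_lsqrt) auto
    then have "(scale N j + sqrt (r\<^sup>2 + (scale N j)\<^sup>2))\<^sup>2 \<le> (1 / 2 + 21 / 10)\<^sup>2"
      using s by (intro power_mono add_mono) auto
    also have "\<dots> \<le> 7" by (simp add: power2_eq_square)
    finally have "(scale N j + sqrt (r\<^sup>2 + (scale N j)\<^sup>2))\<^sup>2 \<le> 7" .
    moreover have "0 < scale N j + sqrt (r\<^sup>2 + (scale N j)\<^sup>2)" using s by (intro add_pos_nonneg) auto
    ultimately show ?thesis by (intro divide_left_mono) auto
  qed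
  have h2: "?h (N + j) \<le> 1 / 16" for j
  proof -
    have "(1::real) \<le> 4 ^ j" by simp
    then have s: "2 \<le> scale N (N + j)" by (simp add: scale_def power_add)
    have "(2::real)\<^sup>2 \<le> (scale N (N + j))\<^sup>2" using s by (intro power_mono) auto
    then have "2\<^sup>2 \<le> r\<^sup>2 + (scale N (N + j))\<^sup>2" using r2 by simp
    then have "2 \<le> sqrt (r\<^sup>2 + (scale N (N + j))\<^sup>2)" by (rule real_le_rsqrt)
    then have "(2 + 2)\<^sup>2 \<le> (scale N (N + j) + sqrt (r\<^sup>2 + (scale N (N + j))\<^sup>2))\<^sup>2"
      using s by (intro power_mono add_mono) auto
    then have "1 / (scale N (N + j) + sqrt (r\<^sup>2 + (scale N (N + j))\<^sup>2))\<^sup>2 \<le> 1 / (2 + 2)\<^sup>2"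
      by (intro divide_left_mono) (auto simp: power2_eq_square intro!: mult_pos_pos)
    then show ?thesis by (simp add: power2_eq_square)
  qed
  have "real N / 7 = (\<Sum>j<N. 1 / 7)" by simp
  also have "\<dots> \<le> (\<Sum>j<N. ?h j)" by (intro sum_mono h1) auto
  finally have S1: "real N / 7 \<le> (\<Sum>j<N. ?h j)" .
  have "(\<Sum>j<N. ?h (N + j)) \<le> (\<Sum>j<N. 1 / 16)" by (intro sum_mono h2)
  then have S2: "(\<Sum>j<N. ?h (N + j)) \<le> real N / 16" by simp
  have "superposition.v (2 * N) (weight \<kappa> N) (scale N) 0 x
      = (\<Sum>j<2 * N. weight \<kappa> N j / (scale N j + sqrt (r\<^sup>2 + (scale N j)\<^sup>2))\<^sup>2)"
    unfolding superposition.v_0[OF superposition_scales] r_def ..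
  also have "\<dots> = \<kappa> / sqrt N * (\<Sum>j<N. ?h j) - \<kappa> / sqrt N * (\<Sum>j<N. ?h (N + j))"
    unfolding sum_split_halves by (simp add: weight_def sum_distrib_left sum_negf)
  also have "\<dots> = \<kappa> / sqrt N * ((\<Sum>j<N. ?h j) - (\<Sum>j<N. ?h (N + j)))"
    by (simp add: right_diff_distrib)
  finally have v: "superposition.v (2 * N) (weight \<kappa> N) (scale N) 0 x
      = \<kappa> / sqrt N * ((\<Sum>j<N. ?h j) - (\<Sum>j<N. ?h (N + j)))" .
  have "\<kappa> * sqrt N / 16 = \<kappa> / sqrt N * (real N / 16)"
    using assms(1) by (simp add: field_simps)
  also have "\<dots> \<le> \<kappa> / sqrt N * ((\<Sum>j<N. ?h j) - (\<Sum>j<N. ?h (N + j)))"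
    using assms(1,2) S1 S2 by (intro mult_left_mono) auto
  finally show ?thesis unfolding v .
qed

text \<open>A ball of radius 1/4 about a point of norm 3/2 lies inside the shell and has explicit
  positive volume; on the shell 1/r \<ge> 1/2, hence m/2. The form \<open>2 * 1\<close> matches the
  shell with R = 1.\<close>

lemma shell_norm_lower_bound:
  fixes u :: "R6 \<Rightarrow> real"
  assumes "continuous_on UNIV u" "0 \<le> m" "\<And>x. 1 \<le> norm x \<Longrightarrow> norm x \<le> 2 \<Longrightarrow> m \<le> u x"
  shows "m / 2 * sqrt (measure lborel (ball (0::R6) (1 / 4)))
    \<le> L2_norm_on {x. 1 \<le> norm x \<and> norm x \<le> 2 * 1} (\<lambda>x. inverse (norm x) * u x)"
proof -
  obtain e :: R6 where e: "e \<in> Basis"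
    using nonempty_Basis by blast
  define z where "z = (3 / 2 :: real) *\<^sub>R e"
  define S where "S = {x::R6. 1 \<le> norm x \<and> norm x \<le> 2 * 1}"
  define f where "f x = (norm (inverse (norm x) * u x))\<^sup>2" for x
  have z: "norm z = 3 / 2" using e by (simp add: z_def)
  have sub: "ball z (1 / 4) \<subseteq> S"
  proof
    fix x assume "x \<in> ball z (1 / 4)"
    then have "norm (z - x) < 1 / 4" by (simp add: dist_norm)
    then show "x \<in> S"
      using norm_triangle_ineq2[of z x] norm_triangle_ineq2[of x z] z by (simp add: S_def norm_minus_commute)
  qed
  have "S = cball 0 2 - ball 0 1" by (auto simp: S_def)
  then have S: "compact S" by (simp add: compact_diff)
  have fS: "continuous_on S f"
    unfolding f_def
    by (intro continuous_intros continuous_on_subset[OF assms(1)]) (auto simp: S_def)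
  have int: "integrable lborel (\<lambda>x. indicator S x *\<^sub>R f x)"
    by (rule borel_integrable_compact[OF S fS])
  have "(m / 2)\<^sup>2 * measure lborel (ball z (1 / 4)) = (LINT x|lborel. (m / 2)\<^sup>2 * indicator (ball z (1 / 4)) x)"
    by simp
  also have "\<dots> \<le> (LINT x|lborel. indicator S x *\<^sub>R f x)"
  proof (rule integral_mono[OF _ int])
    show "integrable lborel (\<lambda>x. (m / 2)\<^sup>2 * indicator (ball z (1 / 4)) x)"
      by (intro integrable_mult_right integrable_real_indicator emeasure_bounded_finite) auto
    show "(m / 2)\<^sup>2 * indicator (ball z (1 / 4)) x \<le> indicator S x *\<^sub>R f x" for x
    proof (cases "x \<in> ball z (1 / 4)")
      case True
      then have x: "x \<in> S" using sub by blast
      then have n: "1 \<le> norm x" "norm x \<le> 2" by (auto simp: S_def)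
      have "0 < norm x" using n(1) by linarith
      then have "1 / 2 \<le> inverse (norm x)"
        using le_imp_inverse_le[OF n(2)] by simp
      then have "1 / 2 * m \<le> inverse (norm x) * u x"
        using assms(2) assms(3)[OF n] by (intro mult_mono) auto
      then have "(m / 2)\<^sup>2 \<le> (inverse (norm x) * u x)\<^sup>2"
        using assms(2) by (intro power_mono) auto
      then show ?thesis using True x by (simp add: f_def)
    qed (simp add: f_def)
  qed
  also have "\<dots> = (LINT x:S|lebesgue. f x)"
    unfolding set_lebesgue_integral_def
    by (rule integral_completion[symmetric]) (rule borel_measurable_integrable[OF int])
  finally have "sqrt ((m / 2)\<^sup>2 * measure lborel (ball z (1 / 4))) \<le> L2_norm_on S (\<lambda>x. inverse (norm x) * u x)"
    unfolding L2_norm_on_def f_def by (rule real_sqrt_le_mono)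
  moreover have "measure lborel (ball z (1 / 4)) = measure lborel (ball (0::R6) (1 / 4))"
    by (simp add: content_ball)
  ultimately show ?thesis
    using assms(2) unfolding S_def by (simp add: real_sqrt_mult)
qed

theorem lemmaA1:
  "\<exists>u0 :: nat \<Rightarrow> R6 \<Rightarrow> real.
     (\<forall>n. u0 n \<in> Hdot1) \<and>
     ((\<lambda>n. SUP R\<in>{0::real<..}.
         ereal (L2_norm_on {x. R \<le> norm x \<and> norm x \<le> 2 * R} (\<lambda>x. inverse (norm x) * u0 n x)))
        \<longlonglongrightarrow> \<infinity>) \<and>
     (\<exists>u ut Du.
        (\<forall>n. free_wave_solution (u0 n) (\<lambda>x. 0) (u n) (ut n) (Du n)) \<and>
        (\<forall>n. \<exists>L\<le>1.
           ((\<lambda>t. LINT x:{x. t \<le> norm x}|lebesgue. (ut n t x)\<^sup>2 + (norm (Du n t x))\<^sup>2)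
              \<longlongrightarrow> L) at_top))"
proof -
  \<comment> \<open>The constant of \<open>exterior_energy_limit\<close> with the 6 of
    \<open>interaction_bound\<close>; choosing \<kappa> as 1/sqrt K makes the limiting energy at
    most 1.\<close>
  define K where "K = unit_ball_vol 6 * 6 * (51200 * (2 * 6))"
  have K: "0 < K" by (simp add: K_def)
  define \<kappa> where "\<kappa> = 1 / sqrt K"
  have \<kappa>: "0 < \<kappa>" "K * \<kappa>\<^sup>2 = 1" using K by (simp_all add: \<kappa>_def power_divide)
  \<comment> \<open>\<open>Suc n\<close> is the number of scales in each half, so that it is
    positive for every n.\<close>
  define u where "u n = superposition.v (2 * Suc n) (weight \<kappa> (Suc n)) (scale (Suc n))" for n
  define ut where "ut n = superposition.v_t (2 * Suc n) (weight \<kappa> (Suc n)) (scale (Suc n))" for n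
  define Du where "Du n = superposition.Dv (2 * Suc n) (weight \<kappa> (Suc n)) (scale (Suc n))" for n
  note sp = superposition_scales[of "Suc _" \<kappa>]
  have Hdot: "u n 0 \<in> Hdot1" for n
    unfolding u_def by (rule superposition.v_0_Hdot1[OF sp])
  have wave: "free_wave_solution (u n 0) (\<lambda>x. 0) (u n) (ut n) (Du n)" for n
    unfolding u_def ut_def Du_def by (rule superposition.v_free_wave[OF sp])
  have ext: "\<exists>L\<le>1. ((\<lambda>t. LINT x:{x. t \<le> norm x}|lebesgue. (ut n t x)\<^sup>2 + (norm (Du n t x))\<^sup>2) \<longlongrightarrow> L) at_top" for n
  proof -
    have "unit_ball_vol 6 * 6 * (51200 * (2 * (6 * \<kappa>\<^sup>2))) = 1"
      using \<kappa>(2) by (simp add: K_def mult_ac)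
    with superposition.exterior_energy_limit[OF sp interaction_bound[of "Suc n" \<kappa>, OF zero_less_Suc]]
    show ?thesis unfolding ut_def Du_def by simp
  qed
  define S where "S n = (SUP R\<in>{0::real<..}.
      ereal (L2_norm_on {x. R \<le> norm x \<and> norm x \<le> 2 * R} (\<lambda>x. inverse (norm x) * u n 0 x)))" for n
  define \<delta> where "\<delta> = \<kappa> / 32 * sqrt (measure lborel (ball (0::R6) (1 / 4)))"
  have \<delta>: "0 < \<delta>" using \<kappa>(1) by (simp add: \<delta>_def content_ball_pos)
  have low: "ereal (\<delta> * sqrt (Suc n)) \<le> S n" for n
  proof -
    have "continuous_on UNIV (u n 0)"
      using continuous_on_compose2[OF superposition.continuous_v(1)[OF sp]
          continuous_on_Pair[OF continuous_on_const[of UNIV 0] continuous_on_id], of n]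
      by (simp add: u_def)
    moreover have "0 \<le> \<kappa> * sqrt (Suc n) / 16" using \<kappa>(1) by simp
    moreover have "\<kappa> * sqrt (Suc n) / 16 \<le> u n 0 x" if "1 \<le> norm x" "norm x \<le> 2" for x
      unfolding u_def by (rule initial_data_lower_bound[OF zero_less_Suc \<kappa>(1) that])
    ultimately have "\<kappa> * sqrt (Suc n) / 16 / 2 * sqrt (measure lborel (ball (0::R6) (1 / 4)))
        \<le> L2_norm_on {x. 1 \<le> norm x \<and> norm x \<le> 2 * 1} (\<lambda>x. inverse (norm x) * u n 0 x)"
      by (rule shell_norm_lower_bound)
    then have "\<delta> * sqrt (Suc n) \<le> L2_norm_on {x. 1 \<le> norm x \<and> norm x \<le> 2 * 1} (\<lambda>x. inverse (norm x) * u n 0 x)"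
      by (simp add: \<delta>_def mult_ac)
    \<comment> \<open>The shell R = 1 alone already bounds the supremum from below.\<close>
    then show ?thesis
      unfolding S_def by (intro SUP_upper2[of "1::real"]) auto
  qed
  have "filterlim (\<lambda>n. \<delta> * sqrt (Suc n)) at_top sequentially"
    by (intro filterlim_tendsto_pos_mult_at_top[OF tendsto_const \<delta>] filterlim_compose[OF sqrt_at_top]
        filterlim_compose[OF filterlim_real_sequentially] filterlim_Suc)
  then have "(\<lambda>n. ereal (\<delta> * sqrt (Suc n))) \<longlonglongrightarrow> \<infinity>"
    by (simp add: tendsto_PInfty_eq_at_top)
  then have "S \<longlonglongrightarrow> \<infinity>"
    by (rule tendsto_sandwich[OF _ _ _ tendsto_const, rotated 2]) (use low in auto)
  then show ?thesis
    unfolding S_def using Hdot wave ext by (intro exI[of _ "\<lambda>n. u n 0"] conjI exI[of _ u] exI[of _ ut] exI[of _ Du] allI) auto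
qed

end
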